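(* Let $c(n)=m\mu(k)$ when $n=m^2k$ with $k$ squarefree. Then the series $\sum_{n=1}^\infty\frac{c(n)\log n}{n}$ converges and \[\sum_{n=1}^\infty\frac{c(n)\log n}{n}=-\frac{\gamma}{2},\] where $\gamma$ is Euler's constant.
   Context: $\mu$ is the Möbius function. Equivalently, $c(n)$ is defined by $\sum_{n\ge1}c(n)n^{-s}=\zeta(2s-1)/\zeta(s)$ for $\operatorname{Re}(s)>1$. *)

theory Defs
  imports "HOL-Analysis.Analysis" "HOL-Computational_Algebra.Squarefree"
begin

definition moebius_mu :: "nat \<Rightarrow> int" where
  "moebius_mu n = (if squarefree n then (-1) ^ card (prime_factors n) else 0)"

text \<open>
  For \<open>n > 0\<close>, \<open>square_part n\<close> and \<open>squarefree_part n\<close> are the unique \<open>m\<close> and \<open>k\<close> with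
  \<open>n = m\<^sup>2 k\<close> and \<open>k\<close> squarefree; the lemma below confirms this reading.
\<close>
definition coeff_c :: "nat \<Rightarrow> int" where
  "coeff_c n = int (square_part n) * moebius_mu (squarefree_part n)"

lemma coeff_c_square_times_squarefree:
  assumes "m > 0" and "squarefree k"
  shows "coeff_c (m\<^sup>2 * k) = int m * moebius_mu k"
proof -
  have "m dvd square_part (m\<^sup>2 * k)"
    by (simp add: dvd_square_part_iff)
  then obtain t where t: "square_part (m\<^sup>2 * k) = m * t" ..
  have "(m * t)\<^sup>2 dvd m\<^sup>2 * k"
    by (simp flip: t)
  hence "t\<^sup>2 dvd k"
    using assms(1) by (simp add: power_mult_distrib)
  with assms(2) have "t = 1"
    using squarefreeD [of k t] by simp
  with t have m: "square_part (m\<^sup>2 * k) = m"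
    by simp
  have "squarefree_part (m\<^sup>2 * k) * m\<^sup>2 = m\<^sup>2 * k"
    using squarefree_decompose [of "m\<^sup>2 * k"] unfolding m by (rule sym)
  hence "squarefree_part (m\<^sup>2 * k) * m\<^sup>2 = k * m\<^sup>2"
    by (simp only: mult.commute)
  hence "squarefree_part (m\<^sup>2 * k) = k"
    using assms(1) by (auto simp only: mult_cancel2 power_eq_0_iff)
  with m show ?thesis
    by (simp add: coeff_c_def)
qed

end

theory Submission
  imports Defs "HOL-Complex_Analysis.Complex_Analysis" "HOL-Real_Asymp.Real_Asymp"
begin

text \<open>
  Put \<open>a(n) = c(n)/n\<close> and \<open>A(T) = \<Sum>n\<le>e\<^sup>T. a(n)\<close>. Abel summation gives
  \<open>\<Sum>n\<le>e\<^sup>T. a(n) ln n = T (A(T) - 1/2) - Q(T)\<close>, where \<open>Q(T)\<close> is the integral of \<open>A - 1/2\<close> over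
  \<open>[0, T]\<close>. The Laplace transform of \<open>A - 1/2\<close> is \<open>g(z) = (\<zeta>(1 + 2z)/\<zeta>(1 + z) - 1/2)/z\<close>, and
  \<open>g(0) = \<gamma>/2\<close>. So it suffices to show \<open>Q(T) \<longlongrightarrow> g(0)\<close> and \<open>A(T) - 1/2 = o(1/T)\<close>. The second
  is stronger than what the prime number theorem gives, so a rate of convergence is needed: Newman's contour
  argument is run on a contour of height \<open>R = T\<^sup>7\<close> that reaches into \<open>Re z < 0\<close> by a constant times
  \<open>1/\<surd>T\<close>. It yields \<open>Q(T) = \<gamma>/2 + O(T\<^sup>-\<^sup>5)\<close>, and difference quotients of \<open>Q\<close> with step \<open>T\<^sup>-\<^sup>3\<close>
  recover \<open>A\<close>. The contour is admissible because the 3-4-1 inequality, together with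
  \<open>\<zeta>(s) = O(|t|\<^sup>\<eta>)\<close> near \<open>Re s = 1\<close> for each \<open>\<eta> > 0\<close>, excludes zeros up to a distance of order
  \<open>|t|\<^sup>-\<^sup>5\<^sup>\<eta>\<close> to the left of that line; \<open>\<eta> = 1/70\<close> suffices.
\<close>

section \<open>The zeta function to the right of the imaginary axis\<close>

text \<open>The prime number theorem only yields A(T) -> 1/2, whereas the Abel formula multiplies
  A(T) - 1/2 by T. Newman's method normally starts from a bounded function; here the a priori bound
  is |A(T)| <= (1 + T)^2, from |a(m^2 k)| <= 1/(m k), so a polynomial loss runs through all
  estimates and fixes the exponents. At height R this loss costs T^2/R, and R = T^7 turns it into
  T^-5. The zero-free width at that height is of order R^(-5 eta), which is T^(-1/2) for eta = 1/70,
  so on the left vertical side exp(T z) contributes exp(-d sqrt T) and beats every power of T. With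
  step h = T^-3 the difference quotient of Q is within O(T^-2) of 0, and the variation of A on
  [T, T + h] is O(T h) = O(T^-2) up to an exponentially small term; both survive multiplication by
  T. The bound for that variation, a sum of |a(n)| over a short interval, takes the place that
  monotonicity has in a Tauberian argument. Working with (s - 1) zeta(s) throughout removes the
  pole, so g is holomorphic at 0, and the constants 1/2 and gamma/2 come from a value and a
  derivative at s = 1.\<close>

lemma norm_nat_powr: "norm ((of_nat n :: complex) powr s) = real n powr Re s"
  by (simp add: norm_powr_real_powr)

lemma nat_powr_mult: "(of_nat (m * n) :: complex) powr s = of_nat m powr s * of_nat n powr s"
  by (simp add: powr_times_real)

lemma nat_powr_0: "n > 0 \<Longrightarrow> (of_nat n :: complex) powr 0 = 1"
  by simp

text \<open>The sum is unordered so that it can be split and reindexed (by multiples of a prime, by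
  divisor pairs, by pairs (m, k)) without tracking an order of summation.\<close>

definition zeta_series :: "complex \<Rightarrow> complex" where
  "zeta_series s = (\<Sum>\<^sub>\<infinity>n\<in>{0<..}. of_nat n powr (-s))"

text \<open>\<open>zeta_gap n s\<close> is \<open>s - 1\<close> times the difference of \<open>(n + 1)\<^sup>-\<^sup>s\<close> and the integral of \<open>x\<^sup>-\<^sup>s\<close> over
  \<open>[n + 1, n + 2]\<close>; so \<open>reg_zeta s\<close> is \<open>(s - 1) \<zeta>(s)\<close>, continued to \<open>Re s > 0\<close>.\<close>

definition zeta_gap :: "nat \<Rightarrow> complex \<Rightarrow> complex" where
  "zeta_gap n s = (s - 1) * of_nat (Suc n) powr (-s) + of_nat (n + 2) powr (1 - s) - of_nat (Suc n) powr (1 - s)"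

definition reg_zeta :: "complex \<Rightarrow> complex" where
  "reg_zeta s = 1 + (\<Sum>n. zeta_gap n s)"

section \<open>Continuation of (s - 1) zeta(s) to Re s > 0\<close>

lemma powr_summable_on:
  assumes "a < -1"
  shows "(\<lambda>n. real n powr a) summable_on A"
proof -
  have "summable (\<lambda>n. real n powr a)"
    using assms by (simp add: summable_real_powr_iff)
  then have "(\<lambda>n. real n powr a) summable_on UNIV"
    by (rule summable_nonneg_imp_summable_on) simp
  then show ?thesis
    by (rule summable_on_subset) simp
qed

lemma zeta_terms_abs_summable:
  assumes "Re s > 1"
  shows "(\<lambda>n. norm ((of_nat n :: complex) powr (-s))) summable_on A"
  using powr_summable_on[of "- Re s"] assms by (simp add: norm_nat_powr)

lemma zeta_terms_summable:
  assumes "Re s > 1"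
  shows "(\<lambda>n. (of_nat n :: complex) powr (-s)) summable_on A"
  using zeta_terms_abs_summable[OF assms] by (rule abs_summable_summable)

text \<open>The mean value inequality on the segment from n + 1 to n + 2 is used twice: for an
  auxiliary function whose increment is the gap, and for z^-s, whose increment controls the
  derivative of that function. Each use gains a factor 1/n over n^(1 - Re s), which makes the gaps
  summable in the whole half-plane.\<close>

lemma norm_zeta_gap_le:
  assumes "Re s > 0"
  shows "norm (zeta_gap n s) \<le> norm (s - 1) * norm s * real (Suc n) powr (- Re s - 1)"
proof -
  define N where "N = real (Suc n)"
  define S where "S = closed_segment (of_real N) (of_real (N + 1) :: complex)"
  have N1: "N \<ge> 1" by (simp add: N_def)
  have S_real: "\<exists>x. z = of_real x \<and> N \<le> x \<and> x \<le> N + 1" if "z \<in> S" for z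
    using that unfolding S_def closed_segment_of_real by (auto simp: closed_segment_eq_real_ivl)
  have S_diff: "norm (z - of_real N) \<le> 1" if z: "z \<in> S" for z
  proof -
    obtain x where x: "z = of_real x" "N \<le> x" "x \<le> N + 1"
      using S_real[OF z] by blast
    have "z - of_real N = of_real (x - N)" by (simp add: x)
    then show ?thesis by (simp only: norm_of_real) (use x in auto)
  qed
  have cS: "convex S" by (simp add: S_def)
  have NS: "of_real N \<in> S" "of_real (N + 1) \<in> S"
    by (simp_all add: S_def)
  have S_pos: "z \<notin> \<real>\<^sub>\<le>\<^sub>0" "z \<noteq> 0" if "z \<in> S" for z
    using S_real[OF that] N1 by (auto simp: complex_nonpos_Reals_iff)
  have inner: "norm (z powr (-s) - of_real N powr (-s)) \<le> norm s * N powr (- Re s - 1) * norm (z - of_real N)"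
    if z: "z \<in> S" for z
  proof (rule field_differentiable_bound[OF cS _ _ z NS(1)])
    fix u assume u: "u \<in> S"
    show "((\<lambda>z. z powr (-s)) has_field_derivative (- s) * u powr (-s - 1)) (at u within S)"
      using S_pos[OF u] by (auto intro!: derivative_eq_intros simp: powr_diff)
    obtain x where x: "u = of_real x" "N \<le> x" "x \<le> N + 1"
      using S_real[OF u] by blast
    have "norm (u powr (-s - 1)) = x powr (- Re s - 1)"
      using x N1 by (simp add: norm_powr_real_powr)
    also have "\<dots> \<le> N powr (- Re s - 1)"
      using x N1 assms by (intro powr_mono2') auto
    finally show "norm ((- s) * u powr (-s - 1)) \<le> norm s * N powr (- Re s - 1)"
      by (simp add: norm_mult mult_left_mono)
  qed
  \<comment> \<open>The slope of the linear term is minus the derivative of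
    \<open>z powr (1 - s)\<close> at \<open>N\<close>, so the derivative of \<open>\<psi>\<close>
    vanishes at \<open>N\<close> and is small on the segment.\<close>
  define \<psi> where "\<psi> = (\<lambda>z. z powr (1 - s) + (s - 1) * of_real N powr (-s) * z)"
  have "norm (\<psi> (of_real (N + 1)) - \<psi> (of_real N))
      \<le> norm (s - 1) * (norm s * N powr (- Re s - 1)) * norm (of_real (N + 1) - of_real N :: complex)"
  proof (rule field_differentiable_bound[OF cS _ _ NS(2) NS(1)])
    fix u assume u: "u \<in> S"
    show "(\<psi> has_field_derivative (1 - s) * (u powr (-s) - of_real N powr (-s))) (at u within S)"
    proof -
      have "((\<lambda>z. z powr (1 - s)) has_field_derivative (1 - s) * u powr (-s)) (at u within S)"
        using has_field_derivative_powr[OF S_pos(1)[OF u], of "1 - s"] by (simp add: has_field_derivative_at_within)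
      then show ?thesis
        unfolding \<psi>_def
        by (rule DERIV_add[THEN DERIV_cong]) (auto intro!: derivative_eq_intros simp: algebra_simps)
    qed
    have "norm (u powr (-s) - of_real N powr (-s)) \<le> norm s * N powr (- Re s - 1) * norm (u - of_real N)"
      by (rule inner[OF u])
    also have "\<dots> \<le> norm s * N powr (- Re s - 1) * 1"
      by (intro mult_left_mono S_diff[OF u]) auto
    finally show "norm ((1 - s) * (u powr (-s) - of_real N powr (-s))) \<le> norm (s - 1) * (norm s * N powr (- Re s - 1))"
      by (simp add: norm_mult norm_minus_commute mult_left_mono)
  qed
  also have "norm (of_real (N + 1) - of_real N :: complex) = 1" by simp
  also have "\<psi> (of_real (N + 1)) - \<psi> (of_real N) = zeta_gap n s"
    by (simp add: \<psi>_def zeta_gap_def N_def algebra_simps)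
  finally show ?thesis by (simp add: N_def mult.assoc)
qed

lemma summable_Suc_powr:
  assumes "a < -1"
  shows "summable (\<lambda>n. real (Suc n) powr a)"
  using assms by (subst summable_Suc_iff) (simp add: summable_real_powr_iff)

lemma zeta_gap_summable_norm:
  assumes "Re s > 0"
  shows "summable (\<lambda>n. norm (zeta_gap n s))"
proof (rule summable_comparison_test')
  show "summable (\<lambda>n. norm (s - 1) * norm s * real (Suc n) powr (- Re s - 1))"
    using assms by (intro summable_mult summable_Suc_powr) auto
  show "norm (norm (zeta_gap n s)) \<le> norm (s - 1) * norm s * real (Suc n) powr (- Re s - 1)" if "n \<ge> 0" for n
    using norm_zeta_gap_le[OF assms] by simp
qed

lemma zeta_gap_sums:
  assumes "Re s > 0"
  shows "(\<lambda>n. zeta_gap n s) sums (reg_zeta s - 1)"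
  using zeta_gap_summable_norm[OF assms] unfolding reg_zeta_def
  by (simp add: summable_norm_cancel summable_sums)

text \<open>The powers with exponent 1 - s telescope. Used twice: with N tending to infinity to
  identify \<open>reg_zeta\<close> for Re s > 1, and with N close to |Im s| for the growth
  bound.\<close>

lemma sum_zeta_gap:
  "(\<Sum>n<N. zeta_gap n s) = (s - 1) * (\<Sum>n<N. of_nat (Suc n) powr (-s)) + of_nat (Suc N) powr (1 - s) - 1"
  by (induction N) (simp_all add: zeta_gap_def algebra_simps)

definition zeta_gap' :: "nat \<Rightarrow> complex \<Rightarrow> complex" where
  "zeta_gap' n s = of_nat (Suc n) powr (-s) - (s - 1) * of_nat (Suc n) powr (-s) * ln (of_nat (Suc n))
     - of_nat (n + 2) powr (1 - s) * ln (of_nat (n + 2)) + of_nat (Suc n) powr (1 - s) * ln (of_nat (Suc n))"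

lemma zeta_gap_has_field_derivative: "(zeta_gap n has_field_derivative zeta_gap' n s) (at s)"
proof -
  have *: "((\<lambda>s. c powr (a - s)) has_field_derivative - (c powr (a - s) * ln c)) (at s)"
    if "c \<noteq> 0" for a c :: complex
  proof -
    have "((\<lambda>z. c powr z) has_field_derivative ln c * c powr (a - s)) (at (a - s))"
      using that by (rule has_field_derivative_powr_right)
    moreover have "((\<lambda>s. a - s) has_field_derivative -1) (at s)"
      by (auto intro!: derivative_eq_intros)
    ultimately show ?thesis
      using DERIV_chain2[of "\<lambda>z. c powr z" "ln c * c powr (a - s)" "\<lambda>s. a - s" s "-1" UNIV]
      by (simp add: mult.commute)
  qed
  have "of_nat (Suc n) \<noteq> (0::complex)" "of_nat (n + 2) \<noteq> (0::complex)"
    by (simp_all del: of_nat_Suc of_nat_add)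
  note d = *[OF this(1), of 0] *[OF this(1), of 1] *[OF this(2), of 1]
  show ?thesis
    unfolding zeta_gap_def[abs_def] zeta_gap'_def
    by (rule derivative_eq_intros d[simplified diff_0] refl)+ (simp add: algebra_simps)
qed

text \<open>On the ball of radius Re x / 2 about x the gap bound is uniformly summable, so termwise
  differentiation is allowed. The series of derivatives is exported along with the derivative
  because it has to be evaluated at 1.\<close>

lemma reg_zeta_has_field_derivative:
  assumes "Re s > 0"
  obtains D where "(reg_zeta has_field_derivative D) (at s)" "(\<lambda>n. zeta_gap' n s) sums D"
proof -
  have "\<exists>g g'. \<forall>x\<in>{s. Re s > 0}. ((\<lambda>n. zeta_gap n x) sums g x) \<and> ((\<lambda>n. zeta_gap' n x) sums g' x)
      \<and> (g has_field_derivative g' x) (at x)"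
  proof (rule series_and_derivative_comparison_local)
    show "open {s. Re s > 0}" by (rule open_halfspace_Re_gt)
    show "(zeta_gap n has_field_derivative zeta_gap' n x) (at x)" for n x
      by (rule zeta_gap_has_field_derivative)
    fix x :: complex assume x: "x \<in> {s. Re s > 0}"
    define d where "d = Re x / 2"
    define M where "M = norm x + d + 1"
    define h where "h = (\<lambda>n. M * M * real (Suc n) powr (- d - 1))"
    have d: "d > 0" using x by (simp add: d_def)
    have "summable h"
      unfolding h_def using d by (intro summable_mult summable_Suc_powr) auto
    moreover have "norm (zeta_gap n y) \<le> h n" if y: "y \<in> ball x d \<inter> {s. Re s > 0}" for n y
    proof -
      have nd: "norm (y - x) < d" using y by (simp add: dist_norm norm_minus_commute)
      have "\<bar>Re y - Re x\<bar> \<le> norm (y - x)" using abs_Re_le_cmod[of "y - x"] by simp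
      then have r: "Re y > d" using nd unfolding d_def by linarith
      have "norm y \<le> norm x + norm (y - x)" by norm
      then have n1: "norm y \<le> M" using nd by (simp add: M_def)
      have "norm (y - 1) \<le> norm y + 1"
        using norm_triangle_ineq4[of y 1] by simp
      also have "norm y \<le> norm x + norm (y - x)" by norm
      finally have n2: "norm (y - 1) \<le> M" using nd unfolding M_def by linarith
      have "norm (zeta_gap n y) \<le> norm (y - 1) * norm y * real (Suc n) powr (- Re y - 1)"
        using y by (intro norm_zeta_gap_le) simp
      also have "\<dots> \<le> M * M * real (Suc n) powr (- d - 1)"
        using n1 n2 r norm_ge_zero[of y] by (intro mult_mono powr_mono) (auto simp del: norm_ge_zero)
      finally show ?thesis by (simp add: h_def)
    qed
    ultimately show "\<exists>d h. 0 < d \<and> summable h \<and>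
        (\<forall>\<^sub>F n in sequentially. \<forall>y\<in>ball x d \<inter> {s. 0 < Re s}. norm (zeta_gap n y) \<le> h n)"
      using d by (intro exI[of _ d] exI[of _ h]) auto
  qed
  then obtain g g' where g: "\<And>x. Re x > 0 \<Longrightarrow> (\<lambda>n. zeta_gap n x) sums g x"
    "\<And>x. Re x > 0 \<Longrightarrow> (\<lambda>n. zeta_gap' n x) sums g' x"
    "\<And>x. Re x > 0 \<Longrightarrow> (g has_field_derivative g' x) (at x)" by auto
  have "((\<lambda>x. 1 + g x) has_field_derivative g' s) (at s)"
    using g(3)[OF assms] by (auto intro!: derivative_eq_intros)
  then have "(reg_zeta has_field_derivative g' s) (at s)"
    by (rule has_field_derivative_transform_within_open[OF _ open_halfspace_Re_gt[of 0]])
      (use assms g(1) in \<open>auto simp: reg_zeta_def sums_iff\<close>)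
  then show ?thesis using that g(2)[OF assms] by blast
qed

lemma reg_zeta_holomorphic: "reg_zeta holomorphic_on {s. Re s > 0}"
  by (rule holomorphic_onI)
    (metis reg_zeta_has_field_derivative field_differentiable_def field_differentiable_at_within mem_Collect_eq)

lemma reg_zeta_1: "reg_zeta 1 = 1"
proof -
  have "zeta_gap n 1 = 0" for n
    using nat_powr_0[of "Suc n"] nat_powr_0[of "n + 2"]
    by (simp add: zeta_gap_def del: of_nat_Suc of_nat_add powr_0)
  then show ?thesis by (simp add: reg_zeta_def)
qed

text \<open>This is the constant term in zeta(s) = 1/(s - 1) + gamma + ..., and it is where Euler's
  constant enters the final value: at s = 1 the differentiated gaps become 1/(n + 1) + ln(n + 1) -
  ln(n + 2).\<close>

lemma reg_zeta_deriv_1: "(reg_zeta has_field_derivative euler_mascheroni) (at 1)"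
proof -
  obtain D where D: "(reg_zeta has_field_derivative D) (at 1)" "(\<lambda>n. zeta_gap' n 1) sums D"
    using reg_zeta_has_field_derivative[of 1] by auto
  have "zeta_gap' n 1 = inverse (of_nat (n+1)) + of_real (ln (of_nat (n+1))) - of_real (ln (of_nat (n+2)))" for n
  proof -
    have "ln (of_nat k :: complex) = of_real (ln (real k))" if "k > 0" for k
      using Ln_of_real[of "real k"] that by simp
    note l = this
    show ?thesis
      using l[of "n + 1"] l[of "n + 2"] nat_powr_0[of "n + 1"] nat_powr_0[of "n + 2"]
      unfolding zeta_gap'_def Suc_eq_plus1 by (simp add: powr_minus del: of_nat_Suc of_nat_add powr_0)
  qed
  then have "D = euler_mascheroni"
    using D(2) euler_mascheroni_sum sums_unique2 by (metis (no_types, lifting) sums_cong)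
  with D(1) show ?thesis by simp
qed

text \<open>The boundary term (N + 1)^(1 - s) of the telescoped gaps tends to 0 exactly when Re s >
  1.\<close>

lemma reg_zeta_eq_zeta_series:
  assumes s: "Re s > 1"
  shows "reg_zeta s = (s - 1) * zeta_series s"
proof -
  have "(\<lambda>N. \<Sum>n<N. zeta_gap n s) \<longlonglongrightarrow> reg_zeta s - 1"
    using zeta_gap_sums[of s] s by (simp add: sums_def)
  moreover have "(\<lambda>N. (s - 1) * (\<Sum>n<N. of_nat (Suc n) powr (-s)) + of_nat (Suc N) powr (1 - s) - 1)
      \<longlonglongrightarrow> (s - 1) * zeta_series s + 0 - 1"
  proof (intro tendsto_intros)
    have "((\<lambda>n. of_nat n powr (-s)) has_sum zeta_series s) {0<..}"
      unfolding zeta_series_def by (intro has_sum_infsum zeta_terms_summable s)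
    then have "((\<lambda>n. of_nat (Suc n) powr (-s)) has_sum zeta_series s) UNIV"
      by (subst has_sum_reindex_bij_witness[of _ "\<lambda>n. n - 1" Suc]) auto
    then have "(\<lambda>n. of_nat (Suc n) powr (-s)) sums zeta_series s"
      by (rule has_sum_imp_sums)
    then show "(\<lambda>N. \<Sum>n<N. of_nat (Suc n) powr (-s)) \<longlonglongrightarrow> zeta_series s"
      by (simp add: sums_def)
    have "(\<lambda>N. norm (of_nat (Suc N) powr (1 - s))) \<longlonglongrightarrow> 0"
      unfolding norm_nat_powr
      by (rule filterlim_compose[OF tendsto_neg_powr[of "Re (1 - s)"]
            filterlim_compose[OF filterlim_real_sequentially filterlim_Suc]])
        (use s in \<open>auto simp: filterlim_ident\<close>)
    then show "(\<lambda>N. of_nat (Suc N) powr (1 - s)) \<longlonglongrightarrow> 0"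
      by (rule tendsto_norm_zero_cancel)
  qed
  ultimately have "reg_zeta s - 1 = (s - 1) * zeta_series s + 0 - 1"
    unfolding sum_zeta_gap by (rule LIMSEQ_unique)
  then show ?thesis by simp
qed

section \<open>Euler product and the 3-4-1 inequality\<close>

definition sifted :: "nat set \<Rightarrow> nat set" where
  "sifted A = {n. n > 0 \<and> (\<forall>p\<in>A. \<not> p dvd n)}"

text \<open>One step of the sieve of Eratosthenes. No prime of \<open>A\<close> divides p, so the
  multiples of p in \<open>sifted A\<close> are precisely p times the elements of
  \<open>sifted A\<close>, and their share of the sum is p^-s times the whole.\<close>

lemma infsum_sifted_insert:
  assumes s: "Re s > 1" and p: "prime p" "p \<notin> A" and A: "\<And>q. q \<in> A \<Longrightarrow> prime q"
  shows "(\<Sum>\<^sub>\<infinity>n\<in>sifted (insert p A). of_nat n powr (-s)) =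
    (1 - of_nat p powr (-s)) * (\<Sum>\<^sub>\<infinity>n\<in>sifted A. (of_nat n :: complex) powr (-s))"
proof -
  let ?f = "\<lambda>n. (of_nat n :: complex) powr (-s)"
  have p0: "p > 0" using p by (simp add: prime_gt_0_nat)
  have eq: "sifted A = sifted (insert p A) \<union> (*) p ` sifted A" (is "_ = _ \<union> ?I")
  proof (intro equalityI subsetI)
    fix n assume n: "n \<in> sifted A"
    show "n \<in> sifted (insert p A) \<union> ?I"
    proof (cases "p dvd n")
      case True
      then obtain m where m: "n = p * m" ..
      with n have "m \<in> sifted A" by (auto simp: sifted_def)
      with m show ?thesis by blast
    next
      case False
      with n show ?thesis by (auto simp: sifted_def)
    qed
  next
    fix n assume "n \<in> sifted (insert p A) \<union> ?I"
    then show "n \<in> sifted A"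
    proof
      assume "n \<in> ?I"
      then obtain m where m: "n = p * m" "m \<in> sifted A" by blast
      have "\<not> q dvd n" if q: "q \<in> A" for q
      proof
        assume "q dvd n"
        then have "q dvd p \<or> q dvd m"
          using A[OF q] m(1) by (simp add: prime_dvd_mult_iff)
        moreover have "\<not> q dvd p"
          using A[OF q] p q primes_dvd_imp_eq by blast
        ultimately show False using m(2) q by (auto simp: sifted_def)
      qed
      with m p0 show ?thesis by (auto simp: sifted_def)
    qed (auto simp: sifted_def)
  qed
  have disj: "sifted (insert p A) \<inter> ?I = {}"
    by (auto simp: sifted_def)
  have inj: "inj_on ((*) p) (sifted A)"
    using p0 by (auto simp: inj_on_def)
  have "infsum ?f (sifted A) = infsum ?f (sifted (insert p A)) + infsum ?f ?I"
    by (subst eq, rule infsum_Un_disjoint) (use s disj in \<open>auto intro: zeta_terms_summable\<close>)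
  also have "infsum ?f ?I = of_nat p powr (-s) * infsum ?f (sifted A)"
    by (simp add: infsum_reindex[OF inj] o_def nat_powr_mult infsum_cmult_right' del: of_nat_mult)
  finally show ?thesis by (simp add: algebra_simps)
qed

lemma infsum_sifted:
  assumes s: "Re s > 1" and "finite A" and "\<And>q. q \<in> A \<Longrightarrow> prime q"
  shows "(\<Sum>\<^sub>\<infinity>n\<in>sifted A. (of_nat n :: complex) powr (-s)) =
    (\<Prod>p\<in>A. 1 - of_nat p powr (-s)) * zeta_series s"
  using assms(2,3)
proof (induction A)
  case empty
  have "sifted {} = {0<..}" by (auto simp: sifted_def)
  then show ?case by (simp add: zeta_series_def)
next
  case (insert p A)
  then show ?case
    by (subst infsum_sifted_insert[OF s]) (auto simp: mult.assoc)
qed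

lemma infsum_tail_tendsto_0:
  fixes g :: "nat \<Rightarrow> real"
  assumes "g summable_on UNIV"
  shows "(\<lambda>N. infsum g {N<..}) \<longlonglongrightarrow> 0"
proof -
  have "infsum g {N<..} = infsum g UNIV - (\<Sum>n<Suc N. g n)" for N
  proof -
    have "infsum g ({..N} \<union> {N<..}) = infsum g {..N} + infsum g {N<..}"
      by (rule infsum_Un_disjoint) (use assms in \<open>auto intro: summable_on_subset\<close>)
    moreover have "{..N} \<union> {N<..} = UNIV" by auto
    ultimately show ?thesis by (simp add: lessThan_Suc_atMost)
  qed
  moreover have "(\<lambda>N. infsum g UNIV - (\<Sum>n<Suc N. g n)) \<longlonglongrightarrow> infsum g UNIV - infsum g UNIV"
    using has_sum_imp_sums[OF has_sum_infsum[OF assms]]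
    by (intro tendsto_intros filterlim_compose[OF _ filterlim_Suc]) (simp add: sums_def)
  ultimately show ?thesis by simp
qed

text \<open>After sieving by the primes up to N only 1 and some integers above N remain, so the
  error is at most a tail of an absolutely convergent series. Putting the product on the same side
  as zeta avoids inverses and makes nonvanishing immediate.\<close>

lemma euler_product_tendsto:
  assumes s: "Re s > 1"
  shows "(\<lambda>N. (\<Prod>p | prime p \<and> p \<le> N. 1 - of_nat p powr (-s)) * zeta_series s) \<longlonglongrightarrow> 1"
proof -
  let ?f = "\<lambda>n. (of_nat n :: complex) powr (-s)"
  let ?A = "\<lambda>N. {p::nat. prime p \<and> p \<le> N}"
  have bound: "norm ((\<Prod>p\<in>?A N. 1 - of_nat p powr (-s)) * zeta_series s - 1) \<le> infsum (\<lambda>n. norm (?f n)) {N<..}" for N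
  proof -
    define B where "B = sifted (?A N) - {1}"
    have 1: "1 \<in> sifted (?A N)"
      by (auto simp: sifted_def)
    have BN: "B \<subseteq> {N<..}"
    proof
      fix n assume n: "n \<in> B"
      then have "n > 0" "n \<noteq> 1" by (auto simp: B_def sifted_def)
      then obtain p where p: "prime p" "p dvd n" using prime_factor_nat by blast
      moreover have "p \<le> n" using p \<open>n > 0\<close> by (simp add: dvd_imp_le)
      ultimately show "n \<in> {N<..}" using n unfolding B_def sifted_def by force
    qed
    have "infsum ?f (sifted (?A N)) = infsum ?f (insert 1 B)"
      using 1 by (intro arg_cong[of _ _ "infsum ?f"]) (auto simp: B_def)
    also have "\<dots> = 1 + infsum ?f B"
      by (subst infsum_insert) (use s in \<open>auto intro: zeta_terms_summable simp: B_def\<close>)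
    also have "infsum ?f (sifted (?A N)) = (\<Prod>p\<in>?A N. 1 - of_nat p powr (-s)) * zeta_series s"
      by (rule infsum_sifted[OF s]) auto
    finally have "norm ((\<Prod>p\<in>?A N. 1 - of_nat p powr (-s)) * zeta_series s - 1) = norm (infsum ?f B)"
      by (simp only: add_diff_cancel_left')
    also have "\<dots> \<le> infsum (\<lambda>n. norm (?f n)) B"
      by (rule norm_infsum_bound) (rule zeta_terms_abs_summable[OF s])
    also have "\<dots> \<le> infsum (\<lambda>n. norm (?f n)) {N<..}"
      by (rule infsum_mono2) (use BN in \<open>auto intro: zeta_terms_abs_summable[OF s]\<close>)
    finally show ?thesis .
  qed
  have "(\<lambda>N. (\<Prod>p\<in>?A N. 1 - of_nat p powr (-s)) * zeta_series s - 1) \<longlonglongrightarrow> 0"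
    by (rule Lim_null_comparison[OF always_eventually[OF allI[OF bound]]
          infsum_tail_tendsto_0[OF zeta_terms_abs_summable[OF s]]])
  then show ?thesis by (simp add: LIM_zero_iff)
qed

lemma zeta_series_nonzero:
  assumes s: "Re s > 1"
  shows "zeta_series s \<noteq> 0"
proof
  assume "zeta_series s = 0"
  with euler_product_tendsto[OF s] have "(\<lambda>N. 0::complex) \<longlonglongrightarrow> 1" by simp
  then show False using LIMSEQ_unique[OF tendsto_const] by fastforce
qed

text \<open>Expand ln |1 - r v| as a power series in r for v = 1, u, u^2. With weights 3, 4, 1 the
  coefficients combine to -2 r^n (1 + Re u^n)^2 / n, because 3 + 4 cos x + cos 2x = 2 (1 + cos
  x)^2.\<close>

lemma mertens_factor_le_1:
  fixes r :: real and u :: complex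
  assumes r: "0 \<le> r" "r < 1" and u: "norm u = 1"
  shows "norm (1 - of_real r :: complex) ^ 3 * norm (1 - of_real r * u) ^ 4 * norm (1 - of_real r * u\<^sup>2) \<le> 1"
proof -
  have ln_sums: "(\<lambda>n. - (r ^ n * Re (v ^ n)) / real n) sums ln (norm (1 - of_real r * v))"
    and nz: "norm (1 - of_real r * v) > 0" if v: "norm v = 1" for v :: complex
  proof -
    have n1: "norm (- (of_real r * v)) < 1" using v r by (simp add: norm_mult)
    have nz: "1 + - (of_real r * v) \<noteq> 0"
    proof
      assume "1 + - (of_real r * v) = 0"
      then have "of_real r * v = 1" by simp
      then have "norm (of_real r * v) = 1" by simp
      then show False using n1 by simp
    qed
    have "(\<lambda>n. - ((- (- (of_real r * v))) ^ n) / of_nat n) sums ln (1 + - (of_real r * v))"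
      by (rule Ln_series'[OF n1])
    then have "(\<lambda>n. Re (- ((of_real r * v) ^ n) / of_nat n)) sums Re (ln (1 + - (of_real r * v)))"
      using sums_Re by fastforce
    moreover have "Re (- ((of_real r * v) ^ n) / of_nat n) = - (r ^ n * Re (v ^ n)) / real n" for n
      by (simp add: power_mult_distrib flip: of_real_power)
    moreover have "Re (ln (1 + - (of_real r * v))) = ln (norm (1 - of_real r * v))"
      using nz by simp
    ultimately show "(\<lambda>n. - (r ^ n * Re (v ^ n)) / real n) sums ln (norm (1 - of_real r * v))"
      by (simp only:)
    show "norm (1 - of_real r * v) > 0" using nz by simp
  qed
  have u2: "norm (u\<^sup>2) = 1" by (simp add: norm_power u)
  note l = ln_sums[OF norm_one] ln_sums[OF u] ln_sums[OF u2]
  let ?L = "3 * ln (norm (1 - of_real r * 1 :: complex)) + 4 * ln (norm (1 - of_real r * u)) + ln (norm (1 - of_real r * u\<^sup>2))"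
  have "(\<lambda>n. 3 * (- (r ^ n * Re (1 ^ n)) / real n) + 4 * (- (r ^ n * Re (u ^ n)) / real n)
      + - (r ^ n * Re ((u\<^sup>2) ^ n)) / real n) sums ?L"
    by (intro sums_add sums_mult l)
  moreover have "3 * (- (r ^ n * Re (1 ^ n)) / real n) + 4 * (- (r ^ n * Re (u ^ n)) / real n)
      + - (r ^ n * Re ((u\<^sup>2) ^ n)) / real n = - (2 * r ^ n * (1 + Re (u ^ n))\<^sup>2 / real n)" for n
  proof -
    have "(Re (u ^ n))\<^sup>2 + (Im (u ^ n))\<^sup>2 = 1"
      by (simp add: norm_power u flip: cmod_power2)
    moreover have "(u\<^sup>2) ^ n = (u ^ n)\<^sup>2"
      by (metis mult.commute power_mult)
    then have "Re ((u\<^sup>2) ^ n) = (Re (u ^ n))\<^sup>2 - (Im (u ^ n))\<^sup>2"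
      by (simp add: Re_power2)
    ultimately have "Re ((u\<^sup>2) ^ n) = 2 * (Re (u ^ n))\<^sup>2 - 1" by simp
    moreover have "3 * (- (q * 1) / k) + 4 * (- (q * c) / k) + - (q * (2 * c\<^sup>2 - 1)) / k = - (2 * q * (1 + c)\<^sup>2 / k)"
      for q c k :: real
      by (simp add: algebra_simps power2_eq_square add_divide_distrib diff_divide_distrib)
    ultimately show ?thesis by simp
  qed
  ultimately have "(\<lambda>n. - (2 * r ^ n * (1 + Re (u ^ n))\<^sup>2 / real n)) sums ?L" by simp
  then have "?L \<le> 0"
    by (rule sums_le[OF _ _ sums_zero, rotated]) (use r in auto)
  moreover have "ln (norm (1 - of_real r * 1 :: complex) ^ 3 * norm (1 - of_real r * u) ^ 4 * norm (1 - of_real r * u\<^sup>2)) = ?L"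
    using nz[OF norm_one] nz[OF u] nz[OF u2] by (simp add: ln_mult ln_realpow)
  moreover have "norm (1 - of_real r * 1 :: complex) ^ 3 * norm (1 - of_real r * u) ^ 4 * norm (1 - of_real r * u\<^sup>2) > 0"
    using nz[OF norm_one] nz[OF u] nz[OF u2] by (intro mult_pos_pos zero_less_power)
  ultimately show ?thesis
    using ln_le_zero_iff by fastforce
qed

text \<open>The finite Euler products satisfy the reverse inequality factor by factor. Multiplied by
  the zeta values, the weighted product stays below the left-hand side for every N, while it tends
  to 1.\<close>

theorem zeta_series_341:
  assumes x: "x > 1"
  shows "norm (zeta_series (of_real x)) ^ 3 * norm (zeta_series (Complex x t)) ^ 4 * norm (zeta_series (Complex x (2 * t))) \<ge> 1"
    (is "?Z \<ge> 1")
proof -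
  let ?A = "\<lambda>N. {p::nat. prime p \<and> p \<le> N}"
  define P where "P = (\<lambda>s N. \<Prod>p\<in>?A N. 1 - (of_nat p :: complex) powr (-s))"
  let ?Q = "\<lambda>N. norm (P (of_real x) N * zeta_series (of_real x)) ^ 3 * norm (P (Complex x t) N * zeta_series (Complex x t)) ^ 4
     * norm (P (Complex x (2 * t)) N * zeta_series (Complex x (2 * t)))"
  have "?Q \<longlonglongrightarrow> norm (1::complex) ^ 3 * norm (1::complex) ^ 4 * norm (1::complex)"
    unfolding P_def by (intro tendsto_intros euler_product_tendsto) (use x in auto)
  moreover have "?Q N \<le> ?Z" for N
  proof -
    have "norm (P (of_real x) N) ^ 3 * norm (P (Complex x t) N) ^ 4 * norm (P (Complex x (2 * t)) N) \<le> 1"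
      unfolding P_def prod_norm[symmetric] prod_power_distrib prod.distrib[symmetric]
    proof (rule prod_le_1, safe)
      fix p :: nat assume p: "prime p"
      define r where "r = real p powr (-x)"
      define u where "u = (of_nat p :: complex) powr (- (\<i> * of_real t))"
      have p2: "real p \<ge> 2" using prime_ge_2_nat[OF p] by simp
      have r: "0 \<le> r" "r < 1"
        using p2 x by (auto simp: r_def powr_less_one)
      have nu: "norm u = 1" using p2 by (simp add: u_def norm_nat_powr)
      have e1: "(of_nat p :: complex) powr (- of_real x) = of_real r"
        using powr_of_real[of "real p" "-x"] by (simp add: r_def)
      have c: "Complex x y = of_real x + \<i> * of_real y" for y
        by (simp add: complex_eq_iff)
      have e2: "(of_nat p :: complex) powr (- Complex x t) = of_real r * u"
      proof -
        have "of_real r * u = (of_nat p :: complex) powr (- of_real x + - (\<i> * of_real t))"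
          by (simp only: e1 u_def powr_add)
        then show ?thesis unfolding c by simp
      qed
      have e3: "(of_nat p :: complex) powr (- Complex x (2 * t)) = of_real r * u\<^sup>2"
      proof -
        have "u\<^sup>2 = (of_nat p :: complex) powr (- (\<i> * of_real t) + - (\<i> * of_real t))"
          by (simp only: power2_eq_square u_def powr_add)
        also have "- (\<i> * of_real t) + - (\<i> * of_real t) = - (\<i> * of_real (2 * t))" by simp
        finally have "of_real r * u\<^sup>2 = (of_nat p :: complex) powr (- of_real x + - (\<i> * of_real (2 * t)))"
          by (simp only: e1 powr_add)
        then show ?thesis unfolding c by simp
      qed
      show "norm (1 - (of_nat p :: complex) powr - of_real x) ^ 3 * norm (1 - (of_nat p :: complex) powr - Complex x t) ^ 4 *
          norm (1 - (of_nat p :: complex) powr - Complex x (2 * t)) \<le> 1"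
        unfolding e1 e2 e3 by (rule mertens_factor_le_1[OF r nu])
    qed auto
    then have "norm (P (of_real x) N) ^ 3 * norm (P (Complex x t) N) ^ 4 * norm (P (Complex x (2 * t)) N) * ?Z \<le> 1 * ?Z"
      by (intro mult_right_mono) auto
    then show ?thesis by (simp add: norm_mult power_mult_distrib mult_ac)
  qed
  ultimately show ?thesis
    by (intro LIMSEQ_le_const2[of ?Q]) auto
qed

section \<open>Growth of zeta near the line Re s = 1\<close>

lemma powr_diff_ge:
  fixes x a :: real
  assumes "x > 0" "a > 0"
  shows "a * (x + 1) powr (-a - 1) \<le> x powr (-a) - (x + 1) powr (-a)"
proof -
  have "\<exists>z>x. z < x + 1 \<and> (x + 1) powr (-a) - x powr (-a) = (x + 1 - x) * ((-a) * z powr (-a - 1))"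
    by (rule MVT2) (use assms in \<open>auto intro!: derivative_eq_intros simp: powr_diff\<close>)
  then obtain z where z: "x < z" "z < x + 1" "(x + 1) powr (-a) - x powr (-a) = (-a) * z powr (-a - 1)"
    by auto
  have "(x + 1) powr (-a - 1) \<le> z powr (-a - 1)"
    using z assms by (intro powr_mono2') auto
  then have "a * (x + 1) powr (-a - 1) \<le> a * z powr (-a - 1)"
    using assms by simp
  with z(3) show ?thesis by simp
qed

text \<open>The integral test in telescoping form: \<open>powr_diff_ge\<close> dominates each term
  by a difference of consecutive values of x^-a / a.\<close>

lemma sums_powr_tail_le:
  assumes N: "N > 0" and a: "a > 0"
  shows "(\<Sum>n. real (Suc (n + N)) powr (-a - 1)) \<le> real N powr (-a) / a"
    and "summable (\<lambda>n. real (Suc (n + N)) powr (-a - 1))"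
proof -
  show sm: "summable (\<lambda>n. real (Suc (n + N)) powr (-a - 1))"
    using a by (intro summable_ignore_initial_segment[of "\<lambda>n. real (Suc n) powr (-a - 1)"] summable_Suc_powr) auto
  have "(\<Sum>n<M. real (Suc (n + N)) powr (-a - 1)) \<le> real N powr (-a) / a" for M
  proof -
    have "(\<Sum>n<M. real (Suc (n + N)) powr (-a - 1)) \<le> (\<Sum>n<M. real (n + N) powr (-a) / a - real (Suc n + N) powr (-a) / a)"
    proof (rule sum_mono)
      fix n
      have "a * (real (n + N) + 1) powr (-a - 1) \<le> real (n + N) powr (-a) - (real (n + N) + 1) powr (-a)"
        using N a by (intro powr_diff_ge) auto
      then show "real (Suc (n + N)) powr (-a - 1) \<le> real (n + N) powr (-a) / a - real (Suc n + N) powr (-a) / a"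
        using a by (simp add: field_simps)
    qed
    also have "\<dots> = real N powr (-a) / a - real (M + N) powr (-a) / a"
      using sum_lessThan_telescope'[of "\<lambda>n. real (n + N) powr (-a) / a" M] by simp
    also have "\<dots> \<le> real N powr (-a) / a" using a by simp
    finally show ?thesis .
  qed
  with sm show "(\<Sum>n. real (Suc (n + N)) powr (-a - 1)) \<le> real N powr (-a) / a"
    by (intro suminf_le_const)
qed

lemma harm_le_ln: "N > 0 \<Longrightarrow> (\<Sum>n<N. 1 / real (Suc n)) \<le> 1 + ln (real N)"
  using euler_mascheroni_sequence_decreasing[of 1 N]
  by (simp add: harm_altdef inverse_eq_divide)

text \<open>The gaps are cut at N, the ceiling of V = 3 + |Im s|. The first N collapse to a partial
  Dirichlet sum plus a boundary term; the others are bounded one by one. In the partial sum one half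
  of \<open>\<eta>\<close> pays for lying to the left of Re s = 1, the other half for the logarithm
  of the harmonic sum; the remaining power of V comes from the factor s - 1.\<close>

lemma reg_zeta_growth:
  assumes \<eta>: "0 < \<eta>" "\<eta> \<le> 1"
  obtains C where "C > 0"
    "\<And>s. 1 - \<eta> / 2 \<le> Re s \<Longrightarrow> Re s \<le> 3 \<Longrightarrow> norm (reg_zeta s) \<le> C * (3 + \<bar>Im s\<bar>) powr (1 + \<eta>)"
proof
  define e where "e = \<eta> / 2"
  have e: "0 < e" "e \<le> 1/2" using \<eta> by (auto simp: e_def)
  define C where "C = 2 * (1 + 1 / e) + 5"
  show "C > 0" using e by (simp add: C_def add_pos_pos)
  fix s assume s: "1 - \<eta> / 2 \<le> Re s" "Re s \<le> 3"
  define V where "V = 3 + \<bar>Im s\<bar>"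
  define N where "N = nat \<lceil>V\<rceil>"
  have V: "V \<ge> 3" by (simp add: V_def)
  have N: "V \<le> real N" "real N \<le> V + 1" "N > 0"
    using V unfolding N_def by linarith+
  have N2: "real N \<le> 2 * V" "real N \<ge> 1" using N V by linarith+
  have s0: "Re s > 0" using s \<eta> by simp
  have ns: "norm s \<le> V"
    using cmod_le[of s] s s0 by (simp add: V_def)
  have ns1: "norm (s - 1) \<le> V"
    using cmod_le[of "s - 1"] s \<eta> by (simp add: V_def)
  have powr_le: "(2 * V) powr a \<le> 2 * V powr a" if "0 \<le> a" "a \<le> 1" for a
  proof -
    have "(2::real) powr a \<le> 2 powr 1" using that by (intro powr_mono) auto
    then show ?thesis using V by (simp add: powr_mult mult_right_mono)
  qed
  have "reg_zeta s - 1 = (\<Sum>n. zeta_gap (n + N) s) + (\<Sum>n<N. zeta_gap n s)"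
    using suminf_split_initial_segment[of "\<lambda>n. zeta_gap n s" N] zeta_gap_sums[OF s0]
    by (simp add: sums_iff)
  then have "reg_zeta s = (s - 1) * (\<Sum>n<N. of_nat (Suc n) powr (-s)) + of_nat (Suc N) powr (1 - s) + (\<Sum>n. zeta_gap (n + N) s)"
    unfolding sum_zeta_gap by (simp add: algebra_simps)
  then have "norm (reg_zeta s) \<le> norm ((s - 1) * (\<Sum>n<N. of_nat (Suc n) powr (-s)))
      + norm (of_nat (Suc N) powr (1 - s) :: complex) + norm (\<Sum>n. zeta_gap (n + N) s)"
    by (metis (no_types, lifting) norm_triangle_mono norm_triangle_ineq order_refl)
  moreover have "norm ((s - 1) * (\<Sum>n<N. of_nat (Suc n) powr (-s))) \<le> V * (2 * V powr \<eta> * (1 + 1 / e))"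
  proof -
    have "norm (\<Sum>n<N. (of_nat (Suc n) :: complex) powr (-s)) \<le> (\<Sum>n<N. real N powr e * (1 / real (Suc n)))"
    proof (rule sum_norm_le)
      fix n assume n: "n \<in> {..<N}"
      have "norm ((of_nat (Suc n) :: complex) powr (-s)) = real (Suc n) powr (- Re s)"
        by (simp only: norm_nat_powr) simp
      also have "\<dots> \<le> real (Suc n) powr (e - 1)"
        using s by (intro powr_mono) (auto simp: e_def)
      also have "\<dots> = real (Suc n) powr e / real (Suc n)"
        by (simp add: powr_diff)
      also have "\<dots> \<le> real N powr e / real (Suc n)"
        using n e by (intro divide_right_mono powr_mono2) auto
      finally show "norm ((of_nat (Suc n) :: complex) powr (-s)) \<le> real N powr e * (1 / real (Suc n))" by simp
    qed
    also have "\<dots> \<le> real N powr e * (1 + ln (real N))"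
      unfolding sum_distrib_left[symmetric] by (intro mult_left_mono harm_le_ln N) auto
    also have "\<dots> \<le> real N powr e * (real N powr e + real N powr e / e)"
      using ln_powr_bound[of "real N" e] ge_one_powr_ge_zero[of "real N" e] e N2
      by (intro mult_left_mono add_mono) auto
    also have "\<dots> = real N powr \<eta> * (1 + 1 / e)"
      by (simp add: algebra_simps e_def flip: powr_add)
    also have "\<dots> \<le> (2 * V) powr \<eta> * (1 + 1 / e)"
      using N2 e \<eta> by (intro mult_right_mono powr_mono2) auto
    also have "\<dots> \<le> 2 * V powr \<eta> * (1 + 1 / e)"
      using powr_le[of \<eta>] e \<eta> by (intro mult_right_mono) auto
    finally show ?thesis
      unfolding norm_mult by (intro mult_mono ns1) (use V in auto)
  qed
  moreover have "norm (of_nat (Suc N) powr (1 - s) :: complex) \<le> 2 * V powr (1 + \<eta>)"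
  proof -
    have "norm (of_nat (Suc N) powr (1 - s) :: complex) = real (Suc N) powr (1 - Re s)"
      by (simp only: norm_nat_powr) simp
    also have "\<dots> \<le> real (Suc N) powr 1"
      using s0 by (intro powr_mono) auto
    also have "\<dots> \<le> 2 * V powr 1" using N V by simp
    also have "\<dots> \<le> 2 * V powr (1 + \<eta>)"
      using V \<eta> by (intro mult_left_mono powr_mono) auto
    finally show ?thesis .
  qed
  moreover have "norm (\<Sum>n. zeta_gap (n + N) s) \<le> V * V * (V powr (\<eta> - 1) / (1/2))"
  proof -
    have smn: "summable (\<lambda>n. norm (zeta_gap (n + N) s))"
      by (rule summable_ignore_initial_segment[OF zeta_gap_summable_norm[OF s0]])
    have "norm (\<Sum>n. zeta_gap (n + N) s) \<le> (\<Sum>n. norm (zeta_gap (n + N) s))"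
      by (rule summable_norm[OF smn])
    also have "\<dots> \<le> (\<Sum>n. V * V * real (Suc (n + N)) powr (- (1 - e) - 1))"
    proof (rule suminf_le[OF _ smn])
      show "summable (\<lambda>n. V * V * real (Suc (n + N)) powr (- (1 - e) - 1))"
        using e N by (intro summable_mult sums_powr_tail_le) auto
      fix n
      have "norm (zeta_gap (n + N) s) \<le> norm (s - 1) * norm s * real (Suc (n + N)) powr (- Re s - 1)"
        by (rule norm_zeta_gap_le[OF s0])
      also have "\<dots> \<le> V * V * real (Suc (n + N)) powr (- (1 - e) - 1)"
        using s V by (intro mult_mono ns ns1 powr_mono) (auto simp: e_def)
      finally show "norm (zeta_gap (n + N) s) \<le> V * V * real (Suc (n + N)) powr (- (1 - e) - 1)" .
    qed
    also have "\<dots> = V * V * (\<Sum>n. real (Suc (n + N)) powr (- (1 - e) - 1))"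
      using e N by (intro suminf_mult sums_powr_tail_le) auto
    also have "\<dots> \<le> V * V * (real N powr (-(1 - e)) / (1 - e))"
      using e N V by (intro mult_left_mono sums_powr_tail_le) auto
    also have "\<dots> \<le> V * V * (V powr (\<eta> - 1) / (1/2))"
    proof (intro mult_left_mono frac_le)
      have "real N powr (- (1 - e)) \<le> V powr (-(1 - e))"
        using e N V by (intro powr_mono2') auto
      also have "\<dots> \<le> V powr (\<eta> - 1)"
        using e V by (intro powr_mono) (auto simp: e_def)
      finally show "real N powr (- (1 - e)) \<le> V powr (\<eta> - 1)" .
    qed (use e V in auto)
    finally show ?thesis .
  qed
  moreover have "V * (2 * V powr \<eta> * (1 + 1 / e)) + 2 * V powr (1 + \<eta>) + V * V * (V powr (\<eta> - 1) / (1/2)) \<le> C * V powr (1 + \<eta>)"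
  proof -
    define q where "q = V * V powr \<eta>"
    have q: "q \<ge> 0" "V powr (1 + \<eta>) = q" "V * V powr (\<eta> - 1) = V powr \<eta>"
      using V by (simp_all add: q_def powr_add powr_diff)
    have "V * (2 * V powr \<eta> * (1 + 1 / e)) = 2 * (1 + 1 / e) * q"
      by (simp add: q_def)
    moreover have "V * V * (V powr (\<eta> - 1) / (1/2)) = 2 * q"
      using q(3) by (simp add: q_def mult.assoc)
    ultimately show ?thesis using q(1,2) by (simp add: C_def algebra_simps)
  qed
  ultimately show "norm (reg_zeta s) \<le> C * (3 + \<bar>Im s\<bar>) powr (1 + \<eta>)"
    unfolding V_def[symmetric] by linarith
qed

section \<open>A quantitative zero-free region\<close>

lemma norm_Complex_ge: "\<bar>t\<bar> \<le> norm (Complex x t)"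
  using abs_Im_le_cmod[of "Complex x t"] by simp

text \<open>Cauchy's inequality bounds the derivative on the horizontal segment. Circles of radius
  \<open>\<eta> / 4\<close> about points with Re >= 1 - \<open>\<eta> / 4\<close> stay where the
  growth bound holds; 16 is 4 from the reciprocal radius times 4 from doubling V.\<close>

lemma reg_zeta_lipschitz:
  assumes \<eta>: "0 < \<eta>" "\<eta> \<le> 1"
  obtains D where "D > 0"
    "\<And>s x. 1 - \<eta> / 4 \<le> Re s \<Longrightarrow> Re s \<le> x \<Longrightarrow> x \<le> 2 \<Longrightarrow>
      norm (reg_zeta (Complex x (Im s)) - reg_zeta s) \<le> D * (x - Re s) * (3 + \<bar>Im s\<bar>) powr (1 + \<eta>)"
proof -
  obtain C where C: "C > 0"
    "\<And>s. 1 - \<eta> / 2 \<le> Re s \<Longrightarrow> Re s \<le> 3 \<Longrightarrow> norm (reg_zeta s) \<le> C * (3 + \<bar>Im s\<bar>) powr (1 + \<eta>)"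
    using reg_zeta_growth[OF \<eta>] by blast
  show ?thesis
  proof
    show "16 * C / \<eta> > 0" using C \<eta> by simp
    fix s x assume s: "1 - \<eta> / 4 \<le> Re s" "Re s \<le> x" "x \<le> 2"
    define V where "V = 3 + \<bar>Im s\<bar>"
    have V: "V \<ge> 3" by (simp add: V_def)
    let ?S = "closed_segment s (Complex x (Im s))"
    have seg: "Im w = Im s \<and> Re s \<le> Re w \<and> Re w \<le> x" if w: "w \<in> ?S" for w
    proof -
      have "s = Complex (Re s) (Im s)" by simp
      then have "w \<in> closed_segment (Complex (Re s) (Im s)) (Complex x (Im s))" using w by metis
      then show ?thesis using s
        by (auto simp: closed_segment_same_Im closed_segment_eq_real_ivl)
    qed
    have "norm (reg_zeta (Complex x (Im s)) - reg_zeta s) \<le> 16 * C / \<eta> * V powr (1 + \<eta>) * norm (Complex x (Im s) - s)"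
    proof (rule field_differentiable_bound[where S = ?S])
      fix w assume w: "w \<in> ?S"
      have Rw: "Re w > 0" using seg[OF w] s \<eta> by linarith
      have fd: "reg_zeta field_differentiable at w"
        using reg_zeta_has_field_derivative[OF Rw] field_differentiable_def by blast
      show "(reg_zeta has_field_derivative deriv reg_zeta w) (at w within ?S)"
        using fd by (simp add: field_differentiable_derivI has_field_derivative_at_within)
      have ball: "1 - \<eta> / 2 \<le> Re u \<and> Re u \<le> 3 \<and> \<bar>Im u\<bar> \<le> \<bar>Im s\<bar> + 1" if u: "norm (w - u) \<le> \<eta> / 4" for u
      proof -
        have "\<bar>Re w - Re u\<bar> \<le> \<eta> / 4" "\<bar>Im s - Im u\<bar> \<le> \<eta> / 4"
          using abs_Re_le_cmod[of "w - u"] abs_Im_le_cmod[of "w - u"] u seg[OF w] by simp_all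
        then show ?thesis using seg[OF w] s \<eta> by (intro conjI) linarith+
      qed
      have pos: "cball w (\<eta> / 4) \<subseteq> {s. Re s > 0}"
        using ball \<eta> by (fastforce simp: dist_norm)
      have "norm ((deriv ^^ 1) reg_zeta w) \<le> fact 1 * (C * (2 * V) powr (1 + \<eta>)) / (\<eta> / 4) ^ 1"
      proof (rule Cauchy_inequality)
        show "reg_zeta holomorphic_on ball w (\<eta> / 4)" "continuous_on (cball w (\<eta> / 4)) reg_zeta"
          using reg_zeta_holomorphic pos ball_subset_cball
          by (meson holomorphic_on_subset order_trans holomorphic_on_imp_continuous_on)+
        fix u assume u: "norm (w - u) = \<eta> / 4"
        have "norm (reg_zeta u) \<le> C * (3 + \<bar>Im u\<bar>) powr (1 + \<eta>)"
          using ball[of u] u by (intro C(2)) auto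
        also have "\<dots> \<le> C * (2 * V) powr (1 + \<eta>)"
          using ball[of u] u C(1) \<eta> by (intro mult_left_mono powr_mono2) (auto simp: V_def)
        finally show "norm (reg_zeta u) \<le> C * (2 * V) powr (1 + \<eta>)" .
      qed (use \<eta> in auto)
      also have "(2 * V) powr (1 + \<eta>) = 2 powr (1 + \<eta>) * V powr (1 + \<eta>)"
        using V by (simp add: powr_mult)
      also have "fact 1 * (C * (2 powr (1 + \<eta>) * V powr (1 + \<eta>))) / (\<eta> / 4) ^ 1 = 2 powr (1 + \<eta>) * (4 * C / \<eta> * V powr (1 + \<eta>))"
        using \<eta> by simp
      also have "\<dots> \<le> 2 powr 2 * (4 * C / \<eta> * V powr (1 + \<eta>))"
        using C(1) \<eta> by (intro mult_right_mono powr_mono) auto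
      also have "\<dots> = 16 * C / \<eta> * V powr (1 + \<eta>)" by simp
      finally show "norm (deriv reg_zeta w) \<le> 16 * C / \<eta> * V powr (1 + \<eta>)" by simp
    qed (auto simp: convex_closed_segment)
    also have "norm (Complex x (Im s) - s) = x - Re s"
    proof -
      have "Complex x (Im s) - s = of_real (x - Re s)" by (simp add: complex_eq_iff)
      then show ?thesis using s(2) by (simp only: norm_of_real)
    qed
    finally show "norm (reg_zeta (Complex x (Im s)) - reg_zeta s) \<le> 16 * C / \<eta> * (x - Re s) * (3 + \<bar>Im s\<bar>) powr (1 + \<eta>)"
      by (simp only: V_def mult_ac)
  qed
qed

text \<open>The 3-4-1 argument divides by |s - 1| and is useless near s = 1; there continuity at 1
  supplies the lower bound instead.\<close>

lemma reg_zeta_near_1: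
  obtains \<rho> where "0 < \<rho>" "\<rho> \<le> 1" "\<And>z. norm z \<le> 2 * \<rho> \<Longrightarrow> norm (reg_zeta (1 + z)) \<ge> 1 / 2"
proof -
  have "isCont reg_zeta 1"
    using reg_zeta_deriv_1 by (rule DERIV_isCont)
  then obtain d where d: "d > 0" "\<And>s. dist s 1 < d \<Longrightarrow> dist (reg_zeta s) (reg_zeta 1) < 1 / 2"
    unfolding continuous_at by (metis LIM_def dist_self half_gt_zero zero_less_one)
  define \<rho> where "\<rho> = min 1 (d / 3)"
  have r: "0 < \<rho>" "\<rho> \<le> 1" using d by (auto simp: \<rho>_def)
  have "norm (reg_zeta (1 + z)) \<ge> 1 / 2" if z: "norm z \<le> 2 * \<rho>" for z
  proof -
    have "norm z < d" using z d(1) unfolding \<rho>_def by linarith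
    then have "norm (reg_zeta (1 + z) - 1) < 1 / 2"
      using d(2)[of "1 + z"] by (simp add: dist_norm reg_zeta_1)
    moreover have "norm (1::complex) \<le> norm (reg_zeta (1 + z)) + norm (1 - reg_zeta (1 + z))"
      by (metis add_diff_cancel_left' diff_add_cancel norm_triangle_ineq)
    ultimately show ?thesis by (simp add: norm_minus_commute)
  qed
  with r that show ?thesis by blast
qed

text \<open>The bound for \<open>\<zeta>(1 + \<kappa> + it)\<close> coming from the 3-4-1 inequality is carried over to the left of the
  line \<open>Re s = 1\<close> by the Lipschitz estimate; \<open>\<kappa> = c |t|\<^sup>-\<^sup>5\<^sup>\<eta>\<close> makes it win by a factor 2.\<close>

lemma reg_zeta_lower_bound:
  assumes \<eta>: "0 < \<eta>" "\<eta> \<le> 1 / 4"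
  obtains c m where "0 < c" "c \<le> 1 / 4" "0 < m"
    "\<And>z. Re z \<le> 0 \<Longrightarrow> - c * (3 + \<bar>Im z\<bar>) powr (- 5 * \<eta>) \<le> Re z \<Longrightarrow> m \<le> norm (reg_zeta (1 + z))"
proof -
  have \<eta>1: "0 < \<eta>" "\<eta> \<le> 1" using \<eta> by auto
  obtain C where C: "C > 0"
    "\<And>s. 1 - \<eta> / 2 \<le> Re s \<Longrightarrow> Re s \<le> 3 \<Longrightarrow> norm (reg_zeta s) \<le> C * (3 + \<bar>Im s\<bar>) powr (1 + \<eta>)"
    using reg_zeta_growth[OF \<eta>1] by blast
  obtain D where D: "D > 0"
    "\<And>s x. 1 - \<eta> / 4 \<le> Re s \<Longrightarrow> Re s \<le> x \<Longrightarrow> x \<le> 2 \<Longrightarrow>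
      norm (reg_zeta (Complex x (Im s)) - reg_zeta s) \<le> D * (x - Re s) * (3 + \<bar>Im s\<bar>) powr (1 + \<eta>)"
    using reg_zeta_lipschitz[OF \<eta>1] by blast
  obtain \<rho> where \<rho>: "0 < \<rho>" "\<rho> \<le> 1" "\<And>z. norm z \<le> 2 * \<rho> \<Longrightarrow> norm (reg_zeta (1 + z)) \<ge> 1 / 2"
    using reg_zeta_near_1 by blast
  \<comment> \<open>Collects the constants of the 3-4-1 step: 729 = 9^3 and 8 come from the upper
    bounds at 1 + \<open>\<kappa>\<close> and 1 + \<open>\<kappa>\<close> + 2it, and
    \<open>(\<rho> / 4) ^ 4\<close> from |s - 1| >= \<open>\<rho> * V / 4\<close>.\<close>
  define b where "b = (\<rho> / 4) ^ 4 * (\<rho> / (8 * 729 * C ^ 4))"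
  have b: "b > 0" using \<rho> C by (simp add: b_def)
  \<comment> \<open>The three bounds keep the point in the strip of the Lipschitz estimate, in the
    disc of \<open>reg_zeta_near_1\<close> when |t| is small, and make the 3-4-1 bound twice as
    large as the Lipschitz error (256 = 4^4).\<close>
  define c where "c = Min {\<eta> / 4, \<rho>, b / (256 * D ^ 4)}"
  have c: "c > 0" "c \<le> \<eta> / 4" "c \<le> \<rho>" "c \<le> b / (256 * D ^ 4)"
    using \<eta> \<rho> b D by (auto simp: c_def)
  define m where "m = min (1/2) (D * c)"
  have m: "m > 0" using D c by (simp add: m_def)
  have main: "m \<le> norm (reg_zeta (1 + z))" if z: "Re z \<le> 0" "- c * (3 + \<bar>Im z\<bar>) powr (- 5 * \<eta>) \<le> Re z" for z
  proof -
    define t where "t = Im z"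
    define V where "V = 3 + \<bar>t\<bar>"
    define W where "W = V powr \<eta>"
    define \<kappa> where "\<kappa> = c / W ^ 5"
    have V: "V \<ge> 3" by (simp add: V_def)
    have W: "W \<ge> 1" using V \<eta> by (simp add: W_def ge_one_powr_ge_zero)
    have W5: "V powr (- 5 * \<eta>) = 1 / W ^ 5"
      using V by (simp add: W_def powr_powr powr_minus divide_inverse mult.commute flip: powr_numeral)
    have zk: "- \<kappa> \<le> Re z" using z(2) W5 by (simp add: \<kappa>_def V_def t_def)
    have "1 \<le> W ^ 5" using W by simp
    then have "c / W ^ 5 \<le> c / 1" using c(1) W by (intro divide_left_mono) auto
    then have \<kappa>: "0 < \<kappa>" "\<kappa> \<le> c"
      using W c by (auto simp: \<kappa>_def)
    show ?thesis
    proof (cases "\<bar>t\<bar> < \<rho>")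
      case True
      have "norm z \<le> 2 * \<rho>"
        using cmod_le[of z] True zk z(1) \<kappa> c by (simp add: t_def)
      then show ?thesis using \<rho>(3) by (force simp: m_def)
    next
      case False
      then have t: "\<rho> \<le> \<bar>t\<bar>" "\<bar>t\<bar> > 0" using \<rho> by auto
      have "3 * \<rho> \<le> 3 * \<bar>t\<bar>" using t by simp
      moreover have "\<rho> * \<bar>t\<bar> \<le> 1 * \<bar>t\<bar>" using \<rho> by (intro mult_right_mono) auto
      \<comment> \<open>Away from the real axis |s - 1| is comparable to V, so passing between zeta
        and \<open>reg_zeta\<close> costs only a constant.\<close>
      ultimately have tV: "\<rho> * V / 4 \<le> \<bar>t\<bar>" by (simp add: V_def algebra_simps)
      have V1: "V powr (1 + \<eta>) = V * W" using V by (simp add: W_def powr_add)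
      have k1: "1 + \<kappa> > 1" "1 + \<kappa> \<le> 2" using \<kappa> c \<eta> by auto
      have z1: "norm (zeta_series (of_real (1 + \<kappa>))) \<le> 9 * C / \<kappa>"
      proof -
        have "norm (reg_zeta (of_real (1 + \<kappa>))) \<le> C * (3 + \<bar>Im (of_real (1 + \<kappa>))\<bar>) powr (1 + \<eta>)"
          using k1 \<eta> by (intro C(2)) auto
        also have "\<dots> \<le> C * 3 powr 2"
          using \<eta> C(1) by (simp only: Im_complex_of_real abs_zero add_0_right) (intro mult_left_mono powr_mono, auto)
        finally have "norm (reg_zeta (of_real (1 + \<kappa>))) \<le> 9 * C" by simp
        moreover have "reg_zeta (of_real (1 + \<kappa>)) = of_real \<kappa> * zeta_series (of_real (1 + \<kappa>))"
          using reg_zeta_eq_zeta_series[of "of_real (1 + \<kappa>)"] k1 by simp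
        ultimately show ?thesis using \<kappa> by (simp add: norm_mult field_simps)
      qed
      have z3: "norm (zeta_series (Complex (1 + \<kappa>) (2 * t))) \<le> 8 * C * W / \<rho>"
      proof -
        let ?s = "Complex (1 + \<kappa>) (2 * t)"
        have "norm (reg_zeta ?s) \<le> C * (3 + \<bar>Im ?s\<bar>) powr (1 + \<eta>)"
          using k1 \<eta> by (intro C(2)) auto
        also have "\<dots> \<le> C * (2 * V) powr (1 + \<eta>)"
          using C(1) \<eta> by (intro mult_left_mono powr_mono2) (auto simp: V_def)
        also have "\<dots> = C * (2 powr (1 + \<eta>) * (V * W))"
          using V V1 by (simp add: powr_mult)
        also have "\<dots> \<le> C * (2 powr 2 * (V * W))"
          using C(1) \<eta> V W by (intro mult_left_mono mult_right_mono powr_mono) auto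
        finally have "norm (reg_zeta ?s) \<le> 4 * C * V * W" by simp
        moreover have "reg_zeta ?s = (?s - 1) * zeta_series ?s"
          using k1 by (intro reg_zeta_eq_zeta_series) auto
        moreover have "?s - 1 = Complex \<kappa> (2 * t)" by (simp add: complex_eq_iff)
        ultimately have "norm (Complex \<kappa> (2 * t)) * norm (zeta_series ?s) \<le> 4 * C * V * W"
          by (simp add: norm_mult)
        moreover have "\<rho> * V / 2 \<le> norm (Complex \<kappa> (2 * t))"
          using norm_Complex_ge[of "2 * t" \<kappa>] tV by simp
        then have "\<rho> * V / 2 * norm (zeta_series ?s) \<le> norm (Complex \<kappa> (2 * t)) * norm (zeta_series ?s)"
          by (intro mult_right_mono) auto
        ultimately have "V * (\<rho> * norm (zeta_series ?s)) \<le> V * (8 * C * W)" by (simp add: mult_ac)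
        then have "\<rho> * norm (zeta_series ?s) \<le> 8 * C * W" using V by simp
        then show ?thesis using \<rho> by (simp add: field_simps)
      qed
      let ?s = "Complex (1 + \<kappa>) t"
      have "1 \<le> norm (zeta_series (of_real (1 + \<kappa>))) ^ 3 * norm (zeta_series ?s) ^ 4 * norm (zeta_series (Complex (1 + \<kappa>) (2 * t)))"
        by (rule zeta_series_341[OF k1(1)])
      also have "\<dots> \<le> (9 * C / \<kappa>) ^ 3 * norm (zeta_series ?s) ^ 4 * (8 * C * W / \<rho>)"
        using z1 z3 C \<kappa> by (intro mult_mono power_mono) auto
      finally have "\<kappa> ^ 3 * \<rho> \<le> 8 * 729 * C ^ 4 * W * norm (zeta_series ?s) ^ 4"
        using \<kappa> \<rho> C by (simp add: field_simps power3_eq_cube power4_eq_xxxx)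
      then have z2: "\<kappa> ^ 3 * (\<rho> / (8 * 729 * C ^ 4)) \<le> W * norm (zeta_series ?s) ^ 4"
        using C by (simp add: field_simps)
      have "reg_zeta ?s = (?s - 1) * zeta_series ?s"
        using k1 by (intro reg_zeta_eq_zeta_series) auto
      then have "norm (reg_zeta ?s) = norm (Complex \<kappa> t) * norm (zeta_series ?s)"
      proof -
        have "?s - 1 = Complex \<kappa> t" by (simp add: complex_eq_iff)
        with \<open>reg_zeta ?s = (?s - 1) * zeta_series ?s\<close> show ?thesis by (simp only: norm_mult)
      qed
      moreover have "\<rho> * V / 4 \<le> norm (Complex \<kappa> t)"
        using norm_Complex_ge[of t \<kappa>] tV by simp
      ultimately have "\<rho> * V / 4 * norm (zeta_series ?s) \<le> norm (reg_zeta ?s)"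
        by (metis mult_right_mono norm_ge_zero)
      then have "(\<rho> * V / 4 * norm (zeta_series ?s)) ^ 4 \<le> norm (reg_zeta ?s) ^ 4"
        using \<rho> V by (intro power_mono) auto
      moreover have "(\<rho> / 4) ^ 4 * V ^ 4 * (\<kappa> ^ 3 * (\<rho> / (8 * 729 * C ^ 4))) \<le> (\<rho> / 4) ^ 4 * V ^ 4 * (W * norm (zeta_series ?s) ^ 4)"
        using z2 \<rho> V by (intro mult_left_mono) auto
      moreover have "(\<rho> / 4) ^ 4 * V ^ 4 * (\<kappa> ^ 3 * (\<rho> / (8 * 729 * C ^ 4))) = b * V ^ 4 * \<kappa> ^ 3"
        by (simp add: b_def)
      moreover have "(\<rho> / 4) ^ 4 * V ^ 4 * (W * norm (zeta_series ?s) ^ 4) = W * (\<rho> * V / 4 * norm (zeta_series ?s)) ^ 4"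
        by (simp add: power_mult_distrib power_divide)
      ultimately have "b * V ^ 4 * \<kappa> ^ 3 \<le> W * norm (reg_zeta ?s) ^ 4"
        using W by (smt (verit) mult_left_mono)
      \<comment> \<open>Origin of the exponent 5: the left side contains W^5 and one more power of
        \<open>\<kappa>\<close> than the right side, so \<open>\<kappa>\<close> has to be a constant
        over W^5.\<close>
      moreover have "W * (4 * D * \<kappa> * V * W) ^ 4 \<le> b * V ^ 4 * \<kappa> ^ 3"
      proof -
        have "W * (4 * D * \<kappa> * V * W) ^ 4 = 256 * D ^ 4 * (\<kappa> * W ^ 5) * V ^ 4 * \<kappa> ^ 3"
          by (simp add: power_mult_distrib eval_nat_numeral)
        also have "\<kappa> * W ^ 5 = c" using W by (simp add: \<kappa>_def)
        also have "256 * D ^ 4 * c * V ^ 4 * \<kappa> ^ 3 \<le> b * V ^ 4 * \<kappa> ^ 3"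
          using c(4) D(1) V \<kappa> by (intro mult_right_mono) (auto simp: field_simps)
        finally show ?thesis .
      qed
      ultimately have "W * (4 * D * \<kappa> * V * W) ^ 4 \<le> W * norm (reg_zeta ?s) ^ 4" by linarith
      then have "(4 * D * \<kappa> * V * W) ^ 4 \<le> norm (reg_zeta ?s) ^ 4" using W by simp
      then have big: "4 * D * \<kappa> * V * W \<le> norm (reg_zeta ?s)"
        by (rule power_le_imp_le_base[of _ 3, simplified]) auto
      have "norm (reg_zeta (Complex (1 + \<kappa>) (Im (1 + z))) - reg_zeta (1 + z))
          \<le> D * (1 + \<kappa> - Re (1 + z)) * (3 + \<bar>Im (1 + z)\<bar>) powr (1 + \<eta>)"
        using zk z(1) \<kappa> c k1 by (intro D(2)) auto
      also have "\<dots> = D * (\<kappa> - Re z) * (V * W)"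
        using V1 by (simp add: V_def t_def)
      also have "\<dots> \<le> D * (2 * \<kappa>) * (V * W)"
        using zk D(1) V W by (intro mult_right_mono mult_left_mono) auto
      finally have small: "norm (reg_zeta ?s - reg_zeta (1 + z)) \<le> 2 * D * \<kappa> * V * W"
        by (simp add: t_def mult_ac)
      have "norm (reg_zeta ?s) \<le> norm (reg_zeta ?s - reg_zeta (1 + z)) + norm (reg_zeta (1 + z))"
        by (metis diff_add_cancel norm_triangle_ineq)
      then have "2 * D * \<kappa> * V * W \<le> norm (reg_zeta (1 + z))"
        using big small by linarith
      \<comment> \<open>The bound so far depends on t. Since \<open>\<eta>\<close> is at most 1/4,
        W^4 is at most V, so \<open>\<kappa> * V * W\<close> = c V / W^4 is at least c and the bound
        becomes uniform.\<close>
      moreover have "D * c \<le> 2 * D * \<kappa> * V * W"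
      proof -
        have "W ^ 4 = V powr (4 * \<eta>)" using V by (simp add: W_def powr_powr mult.commute flip: powr_numeral)
        also have "\<dots> \<le> V powr 1" using V \<eta> by (intro powr_mono) auto
        finally have "W ^ 4 \<le> V" using V by simp
        then have "c * W ^ 4 \<le> c * V" using c by simp
        then have "c \<le> \<kappa> * V * W" using W by (simp add: \<kappa>_def field_simps eval_nat_numeral)
        then have "D * c \<le> D * (\<kappa> * V * W)" using D by simp
        moreover have "0 \<le> D * (\<kappa> * V * W)" using D \<kappa> V W by simp
        ultimately show ?thesis by (simp add: mult_ac)
      qed
      ultimately show ?thesis by (simp add: m_def)
    qed
  qed
  have "c \<le> 1 / 4" using c \<eta> by simp
  with main c(1) m that show ?thesis by blast
qed

section \<open>The Dirichlet series of the coefficients\<close>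

lemma abs_moebius_mu_le: "\<bar>moebius_mu n\<bar> \<le> 1"
  by (simp add: moebius_mu_def)

lemma moebius_mu_1: "moebius_mu 1 = 1"
  by (simp add: moebius_mu_def)

lemma moebius_mu_prime_mult:
  assumes p: "prime p" and e: "\<not> p dvd e"
  shows "moebius_mu (p * e) = - moebius_mu e"
proof -
  have cop: "coprime p e" using p e prime_imp_coprime by blast
  have "squarefree (p * e) \<longleftrightarrow> squarefree e"
  proof
    assume "squarefree (p * e)"
    then show "squarefree e" by (rule squarefree_mono[rotated]) simp
  next
    assume "squarefree e"
    then show "squarefree (p * e)"
      using squarefree_mult_coprime[OF cop] squarefree_prime[OF p] by blast
  qed
  moreover have "card (prime_factors (p * e)) = Suc (card (prime_factors e))"
  proof -
    have e0: "e \<noteq> 0" using e by (metis dvd_0_right)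
    have "prime_factors (p * e) = insert p (prime_factors e)"
      using p e0 by (simp add: prime_factors_product prime_prime_factors prime_gt_0_nat)
    moreover have "p \<notin> prime_factors e" using e by (auto simp: in_prime_factors_iff)
    ultimately show ?thesis by simp
  qed
  ultimately show ?thesis by (simp add: moebius_mu_def)
qed

text \<open>For a prime p dividing n, the divisors e prime to p cancel against the divisors p e. Any
  other divisor is divisible by p^2 and contributes 0.\<close>

lemma sum_moebius_mu_divisors:
  assumes n: "n > 0"
  shows "(\<Sum>d | d dvd n. moebius_mu d) = (if n = 1 then 1 else 0)"
proof (cases "n = 1")
  case True
  then show ?thesis using moebius_mu_1 by simp
next
  case False
  then obtain p where p: "prime p" "p dvd n" using prime_factor_nat by blast
  have fin: "finite {d. d dvd n}" using n by simp
  let ?A = "{d. d dvd n \<and> \<not> p dvd d}" and ?B = "{d. d dvd n \<and> p dvd d}"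
  have "(\<Sum>d | d dvd n. moebius_mu d) = sum moebius_mu (?A \<union> ?B)"
    by (rule sum.cong) auto
  also have "\<dots> = sum moebius_mu ?A + sum moebius_mu ?B"
    using fin by (intro sum.union_disjoint) auto
  also have "sum moebius_mu ?B = sum moebius_mu ((*) p ` ?A)"
  proof (rule sum.mono_neutral_right)
    show "finite ?B" using fin by simp
    show "(*) p ` ?A \<subseteq> ?B"
      using p prime_imp_coprime by (auto intro: divides_mult)
    show "\<forall>d\<in>?B - (*) p ` ?A. moebius_mu d = 0"
    proof
      fix d assume d: "d \<in> ?B - (*) p ` ?A"
      then obtain e where e: "d = p * e" by auto
      have "e dvd n" using d e dvd_mult_right by auto
      then have "p dvd e" using d e by blast
      then have "p\<^sup>2 dvd d" using e by (simp add: power2_eq_square)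
      then have "\<not> squarefree d" using p not_prime_unit not_squarefreeI by blast
      then show "moebius_mu d = 0" by (simp add: moebius_mu_def)
    qed
  qed
  also have "\<dots> = (\<Sum>e\<in>?A. moebius_mu (p * e))"
    using p by (subst sum.reindex) (auto simp: inj_on_def prime_gt_0_nat)
  also have "\<dots> = (\<Sum>e\<in>?A. - moebius_mu e)"
    using p by (intro sum.cong) (auto simp: moebius_mu_prime_mult)
  finally show ?thesis using False by (simp add: sum_negf)
qed

lemma has_sum_prod_times:
  fixes f g :: "'a \<Rightarrow> complex"
  assumes f: "(\<lambda>x. norm (f x)) summable_on A" and g: "(\<lambda>y. norm (g y)) summable_on B"
  shows "((\<lambda>(x, y). f x * g y) has_sum (infsum f A * infsum g B)) (A \<times> B)"
    and "(\<lambda>(x, y). norm (f x * g y)) summable_on (A \<times> B)"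
proof -
  have "(\<lambda>z. norm (case z of (x, y) \<Rightarrow> f x * g y)) summable_on (A \<times> B)"
    unfolding Infinite_Sum.abs_summable_on_Sigma_iff
  proof (intro conjI ballI)
    show "(\<lambda>y. norm (case (x, y) of (x, y) \<Rightarrow> f x * g y)) summable_on B" for x
      using g by (simp add: norm_mult summable_on_cmult_right)
    have "(\<lambda>x. norm (f x) * infsum (\<lambda>y. norm (g y)) B) summable_on A"
      using f by (rule summable_on_cmult_left)
    moreover have "0 \<le> infsum (\<lambda>y. norm (g y)) B" by (rule infsum_nonneg) simp
    ultimately show "(\<lambda>x. norm (infsum (\<lambda>y. norm (case (x, y) of (x, y) \<Rightarrow> f x * g y)) B)) summable_on A"
      by (simp add: norm_mult infsum_cmult_right' abs_mult)
  qed
  then show "(\<lambda>(x, y). norm (f x * g y)) summable_on (A \<times> B)"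
    and "((\<lambda>(x, y). f x * g y) has_sum (infsum f A * infsum g B)) (A \<times> B)"
  proof -
    assume *: "(\<lambda>z. norm (case z of (x, y) \<Rightarrow> f x * g y)) summable_on (A \<times> B)"
    then show "(\<lambda>(x, y). norm (f x * g y)) summable_on (A \<times> B)"
      by (simp add: case_prod_unfold)
    show "((\<lambda>(x, y). f x * g y) has_sum (infsum f A * infsum g B)) (A \<times> B)"
    proof (rule has_sum_SigmaI)
      show "((\<lambda>y. case (x, y) of (x, y) \<Rightarrow> f x * g y) has_sum (f x * infsum g B)) B" for x
        using has_sum_cmult_right[OF has_sum_infsum[OF abs_summable_summable[OF g]], of "f x"] by simp
      show "((\<lambda>x. f x * infsum g B) has_sum (infsum f A * infsum g B)) A"
        by (rule has_sum_cmult_left[OF has_sum_infsum[OF abs_summable_summable[OF f]]])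
      show "(\<lambda>(x, y). f x * g y) summable_on A \<times> B"
        using * by (rule abs_summable_summable)
    qed
  qed
qed

lemma moebius_terms_abs_summable:
  assumes "Re s > 1"
  shows "(\<lambda>n. norm (of_int (moebius_mu n) * (of_nat n :: complex) powr (-s))) summable_on A"
proof (rule Infinite_Sum.abs_summable_on_comparison_test[OF zeta_terms_abs_summable[OF assms]])
  fix n
  have "\<bar>real_of_int (moebius_mu n)\<bar> \<le> 1"
    using abs_moebius_mu_le[of n] by linarith
  then show "norm (of_int (moebius_mu n) * (of_nat n :: complex) powr (-s)) \<le> norm ((of_nat n :: complex) powr (-s))"
    by (simp add: norm_mult mult_left_le_one_le)
qed

text \<open>The product of the two series is a sum over pairs (d, m). Reindexed by (d m, d) and
  summed over d first, it has only the term n = 1 left.\<close>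

lemma moebius_series:
  assumes s: "Re s > 1"
  shows "(\<Sum>\<^sub>\<infinity>n\<in>{0<..}. of_int (moebius_mu n) * of_nat n powr (-s)) * zeta_series s = 1"
proof -
  let ?f = "\<lambda>n. of_int (moebius_mu n) * (of_nat n :: complex) powr (-s)"
  let ?g = "\<lambda>n. (of_nat n :: complex) powr (-s)"
  have "((\<lambda>(x, y). ?f x * ?g y) has_sum (infsum ?f {0<..} * infsum ?g {0<..})) ({0<..} \<times> {0<..})"
    by (intro has_sum_prod_times moebius_terms_abs_summable zeta_terms_abs_summable s)
  also have "?this \<longleftrightarrow> ((\<lambda>(n, d). ?f d * ?g (n div d)) has_sum (infsum ?f {0<..} * infsum ?g {0<..}))
      (Sigma {0<..} (\<lambda>n. {d. d dvd n}))"
    by (rule has_sum_reindex_bij_witness[of _ "\<lambda>(n, d). (d, n div d)" "\<lambda>(d, m). (d * m, d)"])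
      (auto elim!: dvdE)
  finally have *: "((\<lambda>(n, d). ?f d * ?g (n div d)) has_sum (infsum ?f {0<..} * infsum ?g {0<..}))
      (Sigma {0<..} (\<lambda>n. {d. d dvd n}))" .
  have "((\<lambda>n::nat. if n = 1 then 1 else 0) has_sum (infsum ?f {0<..} * infsum ?g {0<..})) {0<..}"
  proof (rule has_sum_Sigma'[OF *])
    fix n :: nat assume n: "n \<in> {0<..}"
    have "(\<Sum>d | d dvd n. ?f d * ?g (n div d)) = (\<Sum>d | d dvd n. of_int (moebius_mu d) * ?g n)"
    proof (rule sum.cong)
      fix d assume "d \<in> {d. d dvd n}"
      then show "?f d * ?g (n div d) = of_int (moebius_mu d) * ?g n"
        by (auto simp: mult.assoc simp flip: nat_powr_mult)
    qed simp
    also have "\<dots> = of_int (\<Sum>d | d dvd n. moebius_mu d) * ?g n"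
      by (simp add: sum_distrib_right)
    also have "\<dots> = (if n = 1 then 1 else 0)"
      using n by (simp add: sum_moebius_mu_divisors)
    finally show "((\<lambda>d. case (n, d) of (n, d) \<Rightarrow> ?f d * ?g (n div d)) has_sum (if n = 1 then 1 else 0)) {d. d dvd n}"
      using n by (intro has_sum_finiteI) auto
  qed
  moreover have "((\<lambda>n::nat. if n = 1 then 1 else 0) has_sum (1::complex)) {0<..}"
    by (rule has_sum_finite_neutralI[of "{1}"]) auto
  ultimately show ?thesis unfolding zeta_series_def by (rule has_sum_unique)
qed

text \<open>Allows a series over n to be read as a double series over m and k.\<close>

lemma square_squarefree_decomp_bij:
  "bij_betw (\<lambda>(m, k). m\<^sup>2 * k) ({0<..} \<times> {k::nat. squarefree k}) {0<..}"
proof (rule bij_betwI[where g = "\<lambda>n. (square_part n, squarefree_part n)"])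
  show "(\<lambda>(m, k). m\<^sup>2 * k) \<in> {0<..} \<times> {k::nat. squarefree k} \<rightarrow> {0<..}"
    by (auto intro!: Nat.gr0I)
  show "(\<lambda>n. (square_part n, squarefree_part n)) \<in> {0<..} \<rightarrow> {0<..} \<times> {k::nat. squarefree k}"
    by (auto intro!: Nat.gr0I)
  show "(case (square_part y, squarefree_part y) of (m, k) \<Rightarrow> m\<^sup>2 * k) = y" if "y \<in> {0<..}" for y :: nat
    using squarefree_decompose[of y] by (simp add: mult.commute)
  show "(square_part (case x of (m, k) \<Rightarrow> m\<^sup>2 * k), squarefree_part (case x of (m, k) \<Rightarrow> m\<^sup>2 * k)) = x"
    if x: "x \<in> {0<..} \<times> {k::nat. squarefree k}" for x
  proof -
    obtain m k where mk: "x = (m, k)" "m > 0" "squarefree k" using x by auto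
    have "m dvd square_part (m\<^sup>2 * k)"
      by (simp add: dvd_square_part_iff)
    then obtain t where t: "square_part (m\<^sup>2 * k) = m * t" ..
    have "(m * t)\<^sup>2 dvd m\<^sup>2 * k"
      by (simp flip: t)
    then have "t\<^sup>2 dvd k"
      using mk by (simp add: power_mult_distrib)
    with mk have "t = 1"
      using squarefreeD[of k t] by simp
    with t have m: "square_part (m\<^sup>2 * k) = m" by simp
    have "squarefree_part (m\<^sup>2 * k) * m\<^sup>2 = m\<^sup>2 * k"
      using squarefree_decompose[of "m\<^sup>2 * k"] unfolding m by (rule sym)
    then have "squarefree_part (m\<^sup>2 * k) = k"
      using mk by simp
    with m mk show ?thesis by simp
  qed
qed

definition coeff_a :: "nat \<Rightarrow> real" where
  "coeff_a n = real_of_int (coeff_c n) / real n"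

text \<open>For n = m^2 k the term c(n) n^-s factors as m^-(2s - 1) times mu(k) k^-s, so the double
  series is a product of two known ones.\<close>

lemma coeff_c_series:
  assumes s: "Re s > 1"
  shows "((\<lambda>n. of_int (coeff_c n) * of_nat n powr (-s)) has_sum (zeta_series (2 * s - 1) / zeta_series s)) {0<..}"
    and "(\<lambda>n. norm (of_int (coeff_c n) * (of_nat n :: complex) powr (-s))) summable_on {0<..}"
proof -
  let ?f = "\<lambda>n. of_int (moebius_mu n) * (of_nat n :: complex) powr (-s)"
  let ?g = "\<lambda>n. (of_nat n :: complex) powr (-(2 * s - 1))"
  let ?h = "\<lambda>n. of_int (coeff_c n) * (of_nat n :: complex) powr (-s)"
  have s2: "Re (2 * s - 1) > 1" using s by simp
  have h: "?h (m\<^sup>2 * k) = ?g m * ?f k" if "m > 0" "squarefree k" for m k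
  proof -
    have "(of_nat (m\<^sup>2 * k) :: complex) powr (-s) = (of_nat m powr (-s) * of_nat m powr (-s)) * of_nat k powr (-s)"
      by (simp only: power2_eq_square nat_powr_mult)
    moreover have "?g m = of_nat m powr 1 * (of_nat m powr (-s) * of_nat m powr (-s))"
      by (simp only: powr_add[symmetric]) simp
    ultimately show ?thesis
      using that by (simp add: coeff_c_square_times_squarefree)
  qed
  let ?S = "{0<..} \<times> {k::nat. squarefree k}"
  \<comment> \<open>\<open>moebius_mu\<close> vanishes off the squarefree numbers, so restricting
    the range of k leaves the value 1 / zeta(s).\<close>
  have "infsum ?f {k. squarefree k} = infsum ?f {0<..}"
    by (rule infsum_cong_neutral) (auto simp: moebius_mu_def intro: Nat.gr0I)
  moreover have "infsum ?f {0<..} = 1 / zeta_series s"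
    using moebius_series[OF s] zeta_series_nonzero[OF s] by (simp add: field_simps)
  ultimately have F: "infsum ?f {k. squarefree k} = 1 / zeta_series s" by simp
  have "((\<lambda>(m, k). ?g m * ?f k) has_sum (infsum ?g {0<..} * infsum ?f {k. squarefree k})) ?S"
    by (intro has_sum_prod_times moebius_terms_abs_summable zeta_terms_abs_summable s s2)
  also have "infsum ?g {0<..} * infsum ?f {k. squarefree k} = zeta_series (2 * s - 1) / zeta_series s"
    by (simp add: F zeta_series_def)
  also have "((\<lambda>(m, k). ?g m * ?f k) has_sum (zeta_series (2 * s - 1) / zeta_series s)) ?S
      \<longleftrightarrow> ((\<lambda>x. ?h (case x of (m, k) \<Rightarrow> m\<^sup>2 * k)) has_sum (zeta_series (2 * s - 1) / zeta_series s)) ?S"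
    by (rule has_sum_cong) (use h in \<open>auto simp del: of_nat_mult of_nat_power\<close>)
  also have "\<dots> \<longleftrightarrow> (?h has_sum (zeta_series (2 * s - 1) / zeta_series s)) {0<..}"
    by (rule has_sum_reindex_bij_betw[OF square_squarefree_decomp_bij])
  finally show "(?h has_sum (zeta_series (2 * s - 1) / zeta_series s)) {0<..}" .
  have "(\<lambda>(m, k). norm (?g m * ?f k)) summable_on ?S"
    by (intro has_sum_prod_times moebius_terms_abs_summable zeta_terms_abs_summable s s2)
  also have "?this \<longleftrightarrow> (\<lambda>x. norm (?h (case x of (m, k) \<Rightarrow> m\<^sup>2 * k))) summable_on ?S"
    by (rule summable_on_cong) (use h in \<open>auto simp del: of_nat_mult of_nat_power\<close>)
  also have "\<dots> \<longleftrightarrow> (\<lambda>n. norm (?h n)) summable_on {0<..}"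
    by (rule summable_on_reindex_bij_betw[OF square_squarefree_decomp_bij])
  finally show "(\<lambda>n. norm (?h n)) summable_on {0<..}" .
qed

text \<open>This is zeta(1 + 2z) / zeta(1 + z): the factors 2z and z hidden in the two values of
  \<open>reg_zeta\<close> leave the 2 in the denominator. In this form the point z = 0 is
  regular.\<close>

definition coeff_a_transform :: "complex \<Rightarrow> complex" where
  "coeff_a_transform z = reg_zeta (1 + 2 * z) / (2 * reg_zeta (1 + z))"

lemma coeff_a_series:
  assumes z: "Re z > 0"
  shows "((\<lambda>n. of_real (coeff_a n) * of_nat n powr (-z)) has_sum coeff_a_transform z) {0<..}"
    and "(\<lambda>n. \<bar>coeff_a n\<bar> * real n powr (- Re z)) summable_on {0<..}"
proof -
  have s: "Re (1 + z) > 1" using z by simp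
  have z0: "z \<noteq> 0" using z by auto
  have eq: "of_int (coeff_c n) * of_nat n powr (-(1 + z)) = of_real (coeff_a n) * of_nat n powr (-z)"
    if "n \<in> {0<..}" for n
  proof -
    have "(of_nat n :: complex) powr (-(1 + z)) = of_nat n powr (-1) * of_nat n powr (-z)"
      by (simp only: powr_add[symmetric]) simp
    then show ?thesis using that by (simp add: coeff_a_def powr_minus field_simps)
  qed
  have "zeta_series (2 * (1 + z) - 1) / zeta_series (1 + z) = coeff_a_transform z"
    using z0 zeta_series_nonzero[OF s] reg_zeta_eq_zeta_series[OF s] reg_zeta_eq_zeta_series[of "1 + 2 * z"] z
    by (simp add: coeff_a_transform_def)
  then have "((\<lambda>n. of_int (coeff_c n) * of_nat n powr (-(1 + z))) has_sum coeff_a_transform z) {0<..}"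
    using coeff_c_series(1)[OF s] by simp
  also have "?this \<longleftrightarrow> ((\<lambda>n. of_real (coeff_a n) * of_nat n powr (-z)) has_sum coeff_a_transform z) {0<..}"
    by (rule has_sum_cong) (rule eq)
  finally show "((\<lambda>n. of_real (coeff_a n) * of_nat n powr (-z)) has_sum coeff_a_transform z) {0<..}" .
  have "(\<lambda>n. norm (of_int (coeff_c n) * (of_nat n :: complex) powr (-(1 + z)))) summable_on {0<..}"
    by (rule coeff_c_series(2)[OF s])
  also have "?this \<longleftrightarrow> (\<lambda>n. \<bar>coeff_a n\<bar> * real n powr (- Re z)) summable_on {0<..}"
    by (rule summable_on_cong) (simp only: eq norm_mult norm_nat_powr norm_of_real, simp)
  finally show "(\<lambda>n. \<bar>coeff_a n\<bar> * real n powr (- Re z)) summable_on {0<..}" .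
qed

section \<open>Sums of absolute values of the coefficients\<close>

text \<open>For n = m^2 k one has |a(n)| <= m / (m^2 k) = 1/(m k), and n is determined by the pair.
  So sums over n are dominated by double harmonic sums over any set of pairs that covers
  them.\<close>

lemma sum_abs_coeff_a_le:
  assumes fin: "finite P" and A: "\<And>n. n \<in> A \<Longrightarrow> n > 0 \<and> (square_part n, squarefree_part n) \<in> P"
  shows "(\<Sum>n\<in>A. \<bar>coeff_a n\<bar>) \<le> (\<Sum>(m, k)\<in>P. 1 / real m * (1 / real k))"
proof -
  let ?j = "\<lambda>n::nat. (square_part n, squarefree_part n)"
  have inj: "inj_on ?j A"
    by (auto simp: inj_on_def intro: squarefree_decomposition_unique)
  have "(\<Sum>n\<in>A. \<bar>coeff_a n\<bar>) \<le> (\<Sum>n\<in>A. case ?j n of (m, k) \<Rightarrow> 1 / real m * (1 / real k))"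
  proof (rule sum_mono)
    fix n assume "n \<in> A"
    then have n: "n > 0" using A by blast
    define m k where "m = square_part n" and "k = squarefree_part n"
    have mk: "m > 0" "k > 0" using n by (auto simp: m_def k_def intro!: Nat.gr0I)
    have nmk: "n = k * m\<^sup>2" unfolding m_def k_def by (rule squarefree_decompose)
    have "\<bar>coeff_a n\<bar> = real m * \<bar>real_of_int (moebius_mu k)\<bar> / real n"
      by (simp add: coeff_a_def coeff_c_def m_def k_def abs_mult)
    also have "\<dots> \<le> real m * 1 / real n"
      using abs_moebius_mu_le[of k] by (intro divide_right_mono mult_left_mono) linarith+
    also have "\<dots> = 1 / real m * (1 / real k)"
      using mk by (simp add: nmk power2_eq_square)
    finally show "\<bar>coeff_a n\<bar> \<le> (case ?j n of (m, k) \<Rightarrow> 1 / real m * (1 / real k))"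
      by (simp add: m_def k_def)
  qed
  also have "\<dots> = (\<Sum>(m, k)\<in>?j ` A. 1 / real m * (1 / real k))"
    by (simp add: sum.reindex[OF inj])
  also have "\<dots> \<le> (\<Sum>(m, k)\<in>P. 1 / real m * (1 / real k))"
    by (rule sum_mono2) (use fin A in auto)
  finally show ?thesis .
qed

definition exp_seg :: "real \<Rightarrow> nat set" where
  "exp_seg T = {n. n > 0 \<and> real n \<le> exp T}"

lemma finite_exp_seg [simp]: "finite (exp_seg T)"
proof (rule finite_subset)
  show "exp_seg T \<subseteq> {..nat \<lfloor>exp T\<rfloor>}"
    by (auto simp: exp_seg_def le_nat_floor)
qed simp

lemma sum_inverse_exp_seg_le:
  assumes "T \<ge> 0"
  shows "(\<Sum>n\<in>exp_seg T. 1 / real n) \<le> 1 + T"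
proof -
  define N where "N = nat \<lfloor>exp T\<rfloor>"
  have e1: "exp T \<ge> 1" using assms by simp
  then have N: "real N \<le> exp T" "N \<ge> 1" "N > 0"
    unfolding N_def by (simp_all add: le_nat_floor)
  have "exp_seg T = Suc ` {..<N}"
  proof (intro equalityI subsetI)
    fix n assume "n \<in> exp_seg T"
    then have "n > 0" "n \<le> N" by (auto simp: exp_seg_def N_def le_nat_floor)
    then show "n \<in> Suc ` {..<N}" by (intro image_eqI[of _ _ "n - 1"]) auto
  next
    fix n assume "n \<in> Suc ` {..<N}"
    then have "n > 0" "n \<le> N" by auto
    then have "real n \<le> real N" by simp
    then show "n \<in> exp_seg T" using N \<open>n > 0\<close> by (simp add: exp_seg_def)
  qed
  then have "(\<Sum>n\<in>exp_seg T. 1 / real n) = (\<Sum>n<N. 1 / real (Suc n))"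
    by (simp add: sum.reindex)
  also have "\<dots> \<le> 1 + ln (real N)"
    using N by (intro harm_le_ln)
  also have "ln (real N) \<le> T" using N by (metis ln_exp ln_mono of_nat_0_less_iff)
  finally show ?thesis by simp
qed

lemma exp_seg_decomp:
  assumes "n \<in> exp_seg T"
  shows "square_part n \<in> exp_seg T" "squarefree_part n \<in> exp_seg T"
proof -
  have n: "n > 0" "real n \<le> exp T" using assms by (auto simp: exp_seg_def)
  have "n = squarefree_part n * (square_part n)\<^sup>2" by (rule squarefree_decompose)
  then have "square_part n dvd n" "squarefree_part n dvd n"
    by (metis dvd_triv_right dvd_triv_left dvd_power dvd_trans zero_less_numeral)+
  then have "square_part n \<le> n" "squarefree_part n \<le> n" "square_part n > 0" "squarefree_part n > 0"
    using n by (auto intro: dvd_imp_le Nat.gr0I)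
  then show "square_part n \<in> exp_seg T" "squarefree_part n \<in> exp_seg T"
    using n by (auto simp: exp_seg_def)
qed

text \<open>Both m and k are at most e^T, which gives two harmonic sums. All cancellation is
  discarded; the resulting factor of order T^2 is later paid for by the height of the
  contour.\<close>

lemma sum_abs_coeff_a_exp_seg:
  assumes "T \<ge> 0"
  shows "(\<Sum>n\<in>exp_seg T. \<bar>coeff_a n\<bar>) \<le> (1 + T)\<^sup>2"
proof -
  have "(\<Sum>n\<in>exp_seg T. \<bar>coeff_a n\<bar>) \<le> (\<Sum>(m, k)\<in>exp_seg T \<times> exp_seg T. 1 / real m * (1 / real k))"
  proof (rule sum_abs_coeff_a_le)
    show "n > 0 \<and> (square_part n, squarefree_part n) \<in> exp_seg T \<times> exp_seg T" if "n \<in> exp_seg T" for n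
      using that exp_seg_decomp[OF that] by (auto simp: exp_seg_def)
  qed simp
  also have "\<dots> = (\<Sum>m\<in>exp_seg T. 1 / real m) * (\<Sum>k\<in>exp_seg T. 1 / real k)"
    by (simp add: sum_product sum.cartesian_product)
  also have "\<dots> \<le> (1 + T) * (1 + T)"
    using assms by (intro mult_mono sum_inverse_exp_seg_le sum_nonneg) auto
  finally show ?thesis by (simp add: power2_eq_square)
qed

text \<open>Harmonic numbers minus logarithms decrease, so the sum is at most a logarithmic length
  plus one boundary term.\<close>

lemma sum_inverse_interval_le:
  assumes u: "0 < u" "u \<le> v" and A: "\<And>k. k \<in> A \<Longrightarrow> u < real k \<and> real k \<le> v"
  shows "(\<Sum>k\<in>A. 1 / real k) \<le> 1 / u + ln (v / u)"
proof -
  define K L where "K = nat \<lfloor>u\<rfloor>" and "L = nat \<lfloor>v\<rfloor>"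
  have K: "u < real (Suc K)" using u unfolding K_def by linarith
  have L: "real L \<le> v" using u unfolding L_def by linarith
  have sub: "A \<subseteq> {K<..L}"
  proof
    fix k assume "k \<in> A"
    then have k: "u < real k" "real k \<le> v" using A by auto
    then show "k \<in> {K<..L}" using u unfolding K_def L_def
      by (auto simp: le_nat_floor nat_less_iff floor_less_iff)
  qed
  have ln0: "ln (v / u) \<ge> 0" using u by simp
  show ?thesis
  proof (cases "K < L")
    case False
    then have "A = {}" using sub by auto
    then show ?thesis using ln0 u by simp
  next
    case True
    have "(\<Sum>k\<in>A. 1 / real k) \<le> (\<Sum>k\<in>{K<..L}. 1 / real k)"
      by (rule sum_mono2[OF _ sub]) auto
    also have "\<dots> = harm L - harm K"
    proof -
      have "harm L = harm K + (\<Sum>k\<in>{K<..L}. inverse (real k))"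
        unfolding harm_def using True by (subst sum.union_disjoint[symmetric]) (auto intro: sum.cong)
      then show ?thesis by (simp add: inverse_eq_divide)
    qed
    \<comment> \<open>The comparison starts at \<open>Suc K\<close> because \<open>K\<close> may be
      0; the term 1/(K + 1) is split off and bounded by 1/u.\<close>
    also have "\<dots> \<le> 1 / real (Suc K) + (ln (real L) - ln (real (Suc K)))"
      using euler_mascheroni_sequence_decreasing[of "Suc K" L] True
      by (simp add: harm_Suc inverse_eq_divide)
    also have "\<dots> \<le> 1 / u + (ln v - ln u)"
      using u K L True by (intro add_mono diff_mono ln_mono divide_left_mono) auto
    also have "ln v - ln u = ln (v / u)" using u by (simp add: ln_div)
    finally show ?thesis .
  qed
qed

text \<open>Either \<open>m\<close> or \<open>k\<close> runs through an interval whose endpoints are at least of order \<open>e\<^sup>T\<^sup>/\<^sup>4\<close>.\<close>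

lemma sum_abs_coeff_a_short:
  assumes T: "T \<ge> 0" and h: "0 \<le> h" "h \<le> 1"
  shows "(\<Sum>n\<in>exp_seg (T + h) - exp_seg T. \<bar>coeff_a n\<bar>) \<le> 6 * (1 + T) * (h + exp (- T / 4))"
proof -
  let ?I = "exp_seg (T + h)"
  \<comment> \<open>Small m: for fixed m, k runs through an interval whose left end is at least
    e^(T/2).\<close>
  define P1 where "P1 = (SIGMA m:exp_seg T. {k\<in>?I. exp T / real m ^ 2 < real k \<and> real k \<le> exp (T + h) / real m ^ 2 \<and> real m ^ 2 \<le> exp (T / 2)})"
  \<comment> \<open>Large m, with the roles exchanged: k is the outer index, so the pairs are stored
    as (k, m) and swapped back below.\<close>
  define P2 where "P2 = (SIGMA k:?I. {m\<in>?I. sqrt (exp T / real k) < real m \<and> real m \<le> sqrt (exp (T + h) / real k) \<and> exp (T / 2) \<le> real m ^ 2})"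
  have finP: "finite P1" "finite P2"
    unfolding P1_def P2_def by auto
  let ?g = "\<lambda>(m, k). 1 / real m * (1 / real k)"
  have "(\<Sum>n\<in>?I - exp_seg T. \<bar>coeff_a n\<bar>) \<le> sum ?g (P1 \<union> prod.swap ` P2)"
  proof (rule sum_abs_coeff_a_le)
    show "finite (P1 \<union> prod.swap ` P2)" using finP by simp
    fix n assume n: "n \<in> ?I - exp_seg T"
    define m k where "m = square_part n" and "k = squarefree_part n"
    have n0: "n > 0" "real n \<le> exp (T + h)" "exp T < real n"
      using n by (auto simp: exp_seg_def)
    have mk: "m \<in> ?I" "k \<in> ?I" using exp_seg_decomp n unfolding m_def k_def by auto
    then have mk0: "m > 0" "k > 0" by (auto simp: exp_seg_def)
    have "n = k * m\<^sup>2" unfolding m_def k_def by (rule squarefree_decompose)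
    then have nmk: "real n = real k * (real m)\<^sup>2" by simp
    have k: "exp T / real m ^ 2 < real k" "real k \<le> exp (T + h) / real m ^ 2"
      using n0 mk0 nmk by (auto simp: field_simps)
    have m: "exp T / real k < (real m)\<^sup>2" "(real m)\<^sup>2 \<le> exp (T + h) / real k"
      using n0 mk0 nmk by (auto simp: field_simps)
    have m': "sqrt (exp T / real k) < real m" "real m \<le> sqrt (exp (T + h) / real k)"
      using m by (auto simp: real_less_lsqrt real_le_rsqrt)
    have "(m, k) \<in> P1 \<union> prod.swap ` P2"
    proof (cases "real m ^ 2 \<le> exp (T / 2)")
      case True
      have "real m \<le> real m ^ 2" using mk0 by (simp add: self_le_power)
      also have "\<dots> \<le> exp (T / 2)" by (rule True)
      also have "\<dots> \<le> exp T" using T by simp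
      finally have "m \<in> exp_seg T" using mk0 by (simp add: exp_seg_def)
      then show ?thesis using True k mk by (auto simp: P1_def)
    next
      case False
      then have "(k, m) \<in> P2" using m' mk by (auto simp: P2_def)
      then show ?thesis by force
    qed
    with n0 show "n > 0 \<and> (square_part n, squarefree_part n) \<in> P1 \<union> prod.swap ` P2"
      by (simp add: m_def k_def)
  qed
  also have "\<dots> \<le> sum ?g P1 + sum ?g (prod.swap ` P2)"
  proof -
    have "0 \<le> sum ?g (P1 \<inter> prod.swap ` P2)" by (intro sum_nonneg) auto
    then show ?thesis using sum.union_inter[of P1 "prod.swap ` P2" ?g] finP by simp
  qed
  also have "sum ?g (prod.swap ` P2) = sum ?g P2"
    by (subst sum.reindex) (auto intro!: sum.cong simp: inj_on_def)
  also have "sum ?g P1 \<le> (1 + T) * (exp (- T / 2) + h)"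
  proof -
    have "sum ?g P1 = (\<Sum>m\<in>exp_seg T. 1 / real m * (\<Sum>k | k \<in> ?I \<and> exp T / real m ^ 2 < real k \<and> real k \<le> exp (T + h) / real m ^ 2 \<and> real m ^ 2 \<le> exp (T / 2). 1 / real k))"
      unfolding P1_def by (subst sum.Sigma[symmetric]) (auto simp: sum_distrib_left)
    also have "\<dots> \<le> (\<Sum>m\<in>exp_seg T. 1 / real m * (exp (- T / 2) + h))"
    proof (intro sum_mono mult_left_mono)
      fix m assume m: "m \<in> exp_seg T"
      then have m0: "m > 0" by (simp add: exp_seg_def)
      show "(\<Sum>k | k \<in> ?I \<and> exp T / real m ^ 2 < real k \<and> real k \<le> exp (T + h) / real m ^ 2 \<and> real m ^ 2 \<le> exp (T / 2). 1 / real k) \<le> exp (- T / 2) + h"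
        (is "sum _ ?K \<le> _")
      proof (cases "real m ^ 2 \<le> exp (T / 2)")
        case True
        have "sum (\<lambda>k. 1 / real k) ?K \<le> 1 / (exp T / real m ^ 2) + ln ((exp (T + h) / real m ^ 2) / (exp T / real m ^ 2))"
          using h m0 by (intro sum_inverse_interval_le) (auto intro: divide_right_mono)
        also have "(exp (T + h) / real m ^ 2) / (exp T / real m ^ 2) = exp h"
          using m0 by (simp add: exp_add)
        also have "1 / (exp T / real m ^ 2) = real m ^ 2 * exp (- T)"
          by (simp add: exp_minus field_simps)
        also have "\<dots> \<le> exp (T / 2) * exp (- T)" using True by (intro mult_right_mono) auto
        also have "\<dots> = exp (- T / 2)" by (simp flip: exp_add)
        finally show ?thesis by simp
      qed (use h in auto)
    qed auto
    also have "\<dots> = (\<Sum>m\<in>exp_seg T. 1 / real m) * (exp (- T / 2) + h)"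
      by (simp add: sum_distrib_right)
    also have "\<dots> \<le> (1 + T) * (exp (- T / 2) + h)"
      using h T by (intro mult_right_mono sum_inverse_exp_seg_le) auto
    finally show ?thesis .
  qed
  also have "sum ?g P2 \<le> (1 + (T + h)) * (2 * exp (- T / 4) + h)"
  proof -
    have "sum ?g P2 = (\<Sum>k\<in>?I. 1 / real k * (\<Sum>m | m \<in> ?I \<and> sqrt (exp T / real k) < real m \<and> real m \<le> sqrt (exp (T + h) / real k) \<and> exp (T / 2) \<le> real m ^ 2. 1 / real m))"
      unfolding P2_def by (subst sum.Sigma[symmetric]) (auto simp: sum_distrib_left)
    also have "\<dots> \<le> (\<Sum>k\<in>?I. 1 / real k * (2 * exp (- T / 4) + h))"
    proof (intro sum_mono mult_left_mono)
      fix k assume k: "k \<in> ?I"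
      then have k0: "k > 0" by (simp add: exp_seg_def)
      show "(\<Sum>m | m \<in> ?I \<and> sqrt (exp T / real k) < real m \<and> real m \<le> sqrt (exp (T + h) / real k) \<and> exp (T / 2) \<le> real m ^ 2. 1 / real m) \<le> 2 * exp (- T / 4) + h"
        (is "sum _ ?M \<le> _")
      proof (cases "?M = {}")
        case True
        show ?thesis using h by (simp only: True sum.empty) simp
      next
        case False
        then obtain m where m: "real m \<le> sqrt (exp (T + h) / real k)" "exp (T / 2) \<le> real m ^ 2" by blast
        have "real m ^ 2 \<le> (sqrt (exp (T + h) / real k))\<^sup>2" using m(1) by (intro power_mono) auto
        \<comment> \<open>A nonempty range of m forces k <= e^(T/2 + h); hence the left end sqrt(e^T
          / k) is at least e^(T/4 - h/2).\<close>
        then have "exp (T / 2) \<le> exp (T + h) / real k" using m(2) by simp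
        then have "real k \<le> exp (T + h) * exp (- (T / 2))"
          using k0 by (simp add: field_simps exp_minus)
        also have "\<dots> = exp (T / 2 + h)" by (simp flip: exp_add)
        finally have kle: "real k \<le> exp (T / 2 + h)" .
        have "sum (\<lambda>m. 1 / real m) ?M \<le> 1 / sqrt (exp T / real k) + ln (sqrt (exp (T + h) / real k) / sqrt (exp T / real k))"
          using h k0 by (intro sum_inverse_interval_le) (auto intro: divide_right_mono)
        also have "sqrt (exp (T + h) / real k) / sqrt (exp T / real k) = sqrt (exp h)"
          using k0 by (simp add: exp_add flip: real_sqrt_divide)
        also have "ln (sqrt (exp h)) = h / 2" by (simp add: ln_sqrt)
        also have "1 / sqrt (exp T / real k) = sqrt (real k * exp (- T))"
          using k0 by (simp add: real_sqrt_divide real_sqrt_mult exp_minus divide_inverse real_sqrt_inverse)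
        also have "\<dots> \<le> sqrt (exp (T / 2 + h) * exp (- T))"
          using kle by (intro real_sqrt_le_mono mult_right_mono) auto
        also have "exp (T / 2 + h) * exp (- T) = exp h * (exp (- T / 4))\<^sup>2"
          by (simp add: power2_eq_square flip: exp_add)
        also have "sqrt (exp h * (exp (- T / 4))\<^sup>2) = sqrt (exp h) * exp (- T / 4)"
          by (simp add: real_sqrt_mult)
        also have "\<dots> \<le> 2 * exp (- T / 4)"
        proof (rule mult_right_mono)
          have "exp h \<le> exp 1" using h by simp
          then have "exp h \<le> 4" using exp_le by linarith
          then have "exp h \<le> 2\<^sup>2" by simp
          then show "sqrt (exp h) \<le> 2" by (intro real_le_lsqrt) auto
        qed simp
        finally show ?thesis using h by simp
      qed
    qed auto
    also have "\<dots> = (\<Sum>k\<in>?I. 1 / real k) * (2 * exp (- T / 4) + h)"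
      by (simp add: sum_distrib_right)
    also have "\<dots> \<le> (1 + (T + h)) * (2 * exp (- T / 4) + h)"
      using h T by (intro mult_right_mono sum_inverse_exp_seg_le) auto
    finally show ?thesis .
  qed
  also have "(1 + T) * (exp (- T / 2) + h) + (1 + (T + h)) * (2 * exp (- T / 4) + h) \<le>
      (1 + T) * (exp (- T / 4) + h) + (2 * (1 + T)) * (2 * exp (- T / 4) + h)"
    using T h by (intro add_mono mult_left_mono mult_right_mono) auto
  also have "\<dots> \<le> 6 * (1 + T) * (h + exp (- T / 4))"
  proof -
    have "0 \<le> (1 + T) * (3 * h + exp (- T / 4))" using T h by simp
    then show ?thesis by (simp add: algebra_simps)
  qed
  finally show ?thesis by simp
qed

text \<open>Abel summation against \<open>(1 + ln n)\<^sup>2 \<le> K (n e\<^sup>-\<^sup>T)\<^sup>x\<^sup>/\<^sup>2\<close>, where \<open>K\<close> is the constant of the statement: this turns the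
  sum into a telescoping one.\<close>

lemma sum_abs_coeff_a_tail:
  fixes x T :: real
  assumes x: "x > 0" and T: "T \<ge> 0" and F: "finite F" "\<And>n. n \<in> F \<Longrightarrow> exp T < real n"
  shows "(\<Sum>n\<in>F. \<bar>coeff_a n\<bar> * real n powr (-x)) \<le> 2 * ((1 + T)\<^sup>2 * (1 + 4 / x)\<^sup>2) * exp (- x * T)"
proof -
  define K where "K = (1 + T)\<^sup>2 * (1 + 4 / x)\<^sup>2"
  define N where "N = nat \<lfloor>exp T\<rfloor>"
  define A where "A = (\<lambda>n. \<Sum>k\<in>{0<..n}. \<bar>coeff_a k\<bar>)"
  define d where "d = exp (- x * T / 2)"
  have K: "K \<ge> 0" by (simp add: K_def)
  have d: "d > 0" by (simp add: d_def)
  have N: "exp T < real (Suc N)" unfolding N_def by linarith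
  have AK: "A n \<le> K * d * real n powr (x / 2)" if n: "exp T < real n" for n
  proof -
    have n0: "real n > 0" using n by (meson exp_gt_zero less_trans)
    have "{0<..n} = exp_seg (ln (real n))" using n0 by (auto simp: exp_seg_def)
    moreover have lnT: "ln (real n) \<ge> T" using n n0 by (metis less_imp_le ln_exp ln_mono exp_gt_zero)
    ultimately have "A n \<le> (1 + ln (real n))\<^sup>2"
      using sum_abs_coeff_a_exp_seg[of "ln (real n)"] T by (simp add: A_def)
    also have "\<dots> \<le> ((1 + T) * ((1 + 4 / x) * exp (x * (ln (real n) - T) / 4)))\<^sup>2"
    proof (rule power_mono)
      \<comment> \<open>With u = ln n - T, the logarithm obeys 1 + ln n <= (1 + T)(1 + u), and 1 + u
        is absorbed by exp(x u / 4) at the cost of the factor 1 + 4/x.\<close>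
      define u where "u = ln (real n) - T"
      have u: "u \<ge> 0" using lnT by (simp add: u_def)
      have "x * u / 4 \<le> exp (x * u / 4)" using exp_ge_add_one_self[of "x * u / 4"] by linarith
      then have "u \<le> 4 / x * exp (x * u / 4)" using x by (simp add: field_simps)
      moreover have "1 \<le> exp (x * u / 4)" using x u by simp
      ultimately have "1 + u \<le> (1 + 4 / x) * exp (x * u / 4)" unfolding distrib_right by linarith
      moreover have "1 + ln (real n) \<le> (1 + T) * (1 + u)"
        using mult_left_mono[OF lnT T] by (simp add: u_def algebra_simps)
      ultimately show "1 + ln (real n) \<le> (1 + T) * ((1 + 4 / x) * exp (x * (ln (real n) - T) / 4))"
        using T unfolding u_def by (smt (verit) mult_left_mono)
    qed (use T lnT in auto)
    also have "\<dots> = K * (exp (x * (ln (real n) - T) / 4))\<^sup>2"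
      by (simp add: K_def power_mult_distrib)
    also have "(exp (x * (ln (real n) - T) / 4))\<^sup>2 = d * real n powr (x / 2)"
      using n0 by (simp add: d_def powr_def power2_eq_square algebra_simps flip: exp_add)
    finally show ?thesis by (simp add: mult.assoc)
  qed
  have A_Suc: "A (Suc n) = A n + \<bar>coeff_a (Suc n)\<bar>" for n
  proof -
    have "{0<..Suc n} = insert (Suc n) {0<..n}" by auto
    then show ?thesis by (simp add: A_def)
  qed
  \<comment> \<open>Abel summation carried out by induction: the first summand is the boundary term
    at M, the second bounds the accumulated differences by a telescoping sum.\<close>
  have main: "(\<Sum>n\<in>{N<..M}. \<bar>coeff_a n\<bar> * real n powr (-x))
      \<le> A M * real M powr (-x) + 2 * K * d * (real (Suc N) powr (-x / 2) - real M powr (-x / 2))" if "M \<ge> Suc N" for M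
    using that
  proof (induction M rule: dec_induct)
    case base
    have "{N<..Suc N} = {Suc N}" by auto
    moreover have "0 \<le> A N" by (auto simp: A_def intro: sum_nonneg)
    ultimately show ?case using A_Suc[of N] by (simp add: mult_right_mono del: of_nat_Suc)
  next
    case (step M)
    have M: "exp T < real M" using N step.hyps by (smt (verit) of_nat_le_iff)
    then have M0: "real M > 0" by (meson exp_gt_zero less_trans)
    \<comment> \<open>Square roots of the weights M^-x and (M + 1)^-x. Since A(M) <= K d / v and v^2
      - w^2 <= 2 v (v - w), the increment is at most 2 K d (v - w), which telescopes.\<close>
    define v w where "v = real M powr (-x / 2)" and "w = real (Suc M) powr (-x / 2)"
    have vw: "0 < w" "w \<le> v" "v > 0" using x M0 by (auto simp: v_def w_def intro!: powr_mono2')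
    have v2: "real M powr (-x) = v * v" "real (Suc M) powr (-x) = w * w"
      by (simp_all add: v_def w_def flip: powr_add)
    have "A M \<le> K * d * real M powr (x / 2)" by (rule AK[OF M])
    also have "real M powr (x / 2) = 1 / v"
      using powr_minus_divide[of "real M" "- x / 2"] by (simp add: v_def)
    finally have "A M * (v * v - w * w) \<le> K * d * (1 / v) * (v * v - w * w)"
      using vw mult_mono[of w v w v] by (intro mult_right_mono) auto
    also have "\<dots> = K * d * ((v + w) / v * (v - w))"
      by (simp add: algebra_simps diff_divide_distrib add_divide_distrib)
    also have "\<dots> \<le> K * d * (2 * (v - w))"
      using K d vw by (intro mult_left_mono mult_right_mono) (auto simp: field_simps)
    finally have *: "A M * (v * v - w * w) \<le> 2 * K * d * (v - w)" by (simp only: mult_ac)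
    have "{N<..Suc M} = insert (Suc M) {N<..M}" using step.hyps by auto
    then have "(\<Sum>n\<in>{N<..Suc M}. \<bar>coeff_a n\<bar> * real n powr (-x))
        = (\<Sum>n\<in>{N<..M}. \<bar>coeff_a n\<bar> * real n powr (-x)) + (A (Suc M) - A M) * (w * w)"
      by (simp add: A_Suc v2(2)[symmetric])
    also have "\<dots> \<le> A M * (v * v) + 2 * K * d * (real (Suc N) powr (-x / 2) - v) + (A (Suc M) - A M) * (w * w)"
      using step.IH unfolding v2 v_def by simp
    also have "\<dots> \<le> A (Suc M) * (w * w) + 2 * K * d * (real (Suc N) powr (-x / 2) - w)"
      using * by (simp add: algebra_simps)
    finally show ?case unfolding v2 w_def .
  qed
  obtain M where M: "M \<ge> Suc N" "F \<subseteq> {N<..M}"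
  proof
    show "F \<subseteq> {N<..max (Suc N) (Max (insert 0 F))}"
    proof
      fix n assume n: "n \<in> F"
      have "real N \<le> exp T" by (simp add: N_def)
      then have "N < n" using F(2)[OF n] by linarith
      moreover have "n \<le> Max (insert 0 F)" using F(1) n by (intro Max_ge) auto
      ultimately show "n \<in> {N<..max (Suc N) (Max (insert 0 F))}" by auto
    qed
  qed simp
  have eM: "exp T < real M" using N M(1) by (smt (verit) of_nat_le_iff)
  then have M0: "real M > 0" by (meson exp_gt_zero less_trans)
  have "(\<Sum>n\<in>F. \<bar>coeff_a n\<bar> * real n powr (-x)) \<le> (\<Sum>n\<in>{N<..M}. \<bar>coeff_a n\<bar> * real n powr (-x))"
    by (rule sum_mono2[OF _ M(2)]) auto
  also have "\<dots> \<le> A M * real M powr (-x) + 2 * K * d * (real (Suc N) powr (-x / 2) - real M powr (-x / 2))"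
    by (rule main[OF M(1)])
  also have "A M * real M powr (-x) \<le> K * d * real M powr (x / 2) * real M powr (-x)"
    by (intro mult_right_mono AK eM) auto
  also have "\<dots> = K * d * real M powr (-x / 2)" by (simp add: mult.assoc flip: powr_add)
  also have "\<dots> + 2 * K * d * (real (Suc N) powr (-x / 2) - real M powr (-x / 2)) \<le> 2 * K * d * real (Suc N) powr (-x / 2)"
    using K d by (simp add: algebra_simps)
  also have "\<dots> \<le> 2 * K * d * exp T powr (-x / 2)"
    using K d N x by (intro mult_left_mono powr_mono2') auto
  also have "\<dots> = 2 * K * exp (- x * T)"
    by (simp add: d_def powr_def flip: exp_add)
  finally show ?thesis by (simp add: K_def)
qed

section \<open>Newman's contour estimate\<close>

text \<open>The horizontal sides are cut at the imaginary axis because the integrand is estimated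
  differently on its two sides. The left abscissa is a parameter: the full transform is integrated
  up to \<open>- \<delta>\<close>, the entire truncated one up to \<open>- R\<close>.\<close>

lemma rectangle_Cauchy_formula:
  fixes f :: "complex \<Rightarrow> complex" and l R :: real
  assumes l: "l > 0" and R: "R > 0" and S: "open S" "convex S" and f: "f holomorphic_on S"
    and sub: "cbox (Complex (-l) (-R)) (Complex R R) \<subseteq> S"
  defines "J \<equiv> \<lambda>a b. contour_integral (linepath a b) (\<lambda>z. f z / z)"
  shows "2 * of_real pi * \<i> * f 0 =
      J (Complex 0 (-R)) (Complex R (-R)) + J (Complex R (-R)) (Complex R R) + J (Complex R R) (Complex 0 R)
    + J (Complex 0 R) (Complex (-l) R) + J (Complex (-l) R) (Complex (-l) (-R)) + J (Complex (-l) (-R)) (Complex 0 (-R))"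
    and "\<And>a b. closed_segment a b \<subseteq> S - {0} \<Longrightarrow> (\<lambda>z. f z / z) contour_integrable_on linepath a b"
proof -
  let ?\<phi> = "\<lambda>z. f z / z"
  let ?a = "Complex (-l) (-R)" and ?c = "Complex R R"
  have cont: "continuous_on (S - {0}) ?\<phi>"
    using holomorphic_on_imp_continuous_on[OF f] by (auto intro!: continuous_intros intro: continuous_on_subset)
  show int: "?\<phi> contour_integrable_on linepath a b" if "closed_segment a b \<subseteq> S - {0}" for a b
    using cont that by (intro contour_integrable_continuous_linepath) (rule continuous_on_subset)
  have 0: "0 \<in> box ?a ?c" using l R by (simp add: in_box_complex_iff)
  then have "0 \<in> interior S" using sub S box_subset_cbox by (auto simp: interior_open)
  have img: "path_image (rectpath ?a ?c) \<subseteq> S - {0}"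
    using path_image_rectpath_cbox_minus_box[of ?a ?c] l R sub 0 by auto
  have "(?\<phi> has_contour_integral (2 * of_real pi * \<i> * winding_number (rectpath ?a ?c) 0 * f 0)) (rectpath ?a ?c)"
    using Cauchy_integral_formula_convex_simple[OF S(2) f \<open>0 \<in> interior S\<close> _ img] by simp
  then have val: "contour_integral (rectpath ?a ?c) ?\<phi> = 2 * of_real pi * \<i> * f 0"
    using winding_number_rectpath[OF 0] by (simp add: contour_integral_unique)
  have seg: "closed_segment ?a (Complex R (-R)) \<subseteq> S - {0}" "closed_segment (Complex R (-R)) ?c \<subseteq> S - {0}"
    "closed_segment ?c (Complex (-l) R) \<subseteq> S - {0}" "closed_segment (Complex (-l) R) ?a \<subseteq> S - {0}"
    using img by (simp_all add: rectpath_def Let_def path_image_join)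
  have "contour_integral (rectpath ?a ?c) ?\<phi> =
      J ?a (Complex R (-R)) + (J (Complex R (-R)) ?c + (J ?c (Complex (-l) R) + J (Complex (-l) R) ?a))"
    using int[OF seg(1)] int[OF seg(2)] int[OF seg(3)] int[OF seg(4)]
    by (simp add: rectpath_def Let_def J_def)
  also have "J ?a (Complex R (-R)) = J ?a (Complex 0 (-R)) + J (Complex 0 (-R)) (Complex R (-R))"
    unfolding J_def
    by (rule contour_integral_split_linepath[OF continuous_on_subset[OF cont seg(1)]])
      (use l R in \<open>simp add: closed_segment_same_Im closed_segment_eq_real_ivl\<close>)
  also have "J ?c (Complex (-l) R) = J ?c (Complex 0 R) + J (Complex 0 R) (Complex (-l) R)"
    unfolding J_def
    by (rule contour_integral_split_linepath[OF continuous_on_subset[OF cont seg(3)]])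
      (use l R in \<open>simp add: closed_segment_same_Im closed_segment_eq_real_ivl\<close>)
  finally show "2 * of_real pi * \<i> * f 0 =
      J (Complex 0 (-R)) (Complex R (-R)) + J (Complex R (-R)) (Complex R R) + J (Complex R R) (Complex 0 R)
    + J (Complex 0 R) (Complex (-l) R) + J (Complex (-l) R) (Complex (-l) (-R)) + J (Complex (-l) (-R)) (Complex 0 (-R))"
    unfolding val by (simp add: algebra_simps)
qed

lemma contour_integral_linepath_le:
  assumes "f contour_integrable_on linepath a b" "B \<ge> 0" "\<And>z. z \<in> closed_segment a b \<Longrightarrow> norm (f z) \<le> B" "norm (b - a) \<le> L"
  shows "norm (contour_integral (linepath a b) f) \<le> B * L"
proof -
  have "norm (contour_integral (linepath a b) f) \<le> B * norm (b - a)"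
    by (rule has_contour_integral_bound_linepath[OF has_contour_integral_integral[OF assms(1)] assms(2,3)])
  also have "\<dots> \<le> B * L" using assms by (intro mult_left_mono) auto
  finally show ?thesis .
qed

text \<open>The factor \<open>(1 + z\<^sup>2 / R\<^sup>2)\<^sup>2\<close> vanishes to second order at \<open>\<plusminus>iR\<close>, which absorbs the factors
  \<open>(1 + 1 / Re z)\<^sup>2\<close> and \<open>1 / Re z\<close> of the hypotheses on the horizontal sides.\<close>

definition newman_kernel :: "real \<Rightarrow> real \<Rightarrow> complex \<Rightarrow> complex" where
  "newman_kernel R T z = exp (of_real T * z) * (1 + z\<^sup>2 / of_real R ^ 2)\<^sup>2"

text \<open>On |Im z| = R the real part of z^2 + R^2 is just (Re z)^2, so its norm is at most |Re
  z|^2 + 2 |Re z| R <= 3 |Re z| R.\<close>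

lemma newman_kernel_horizontal:
  assumes R: "R > 0" and z: "\<bar>Im z\<bar> = R" "\<bar>Re z\<bar> \<le> R"
  shows "norm (newman_kernel R T z) \<le> exp (T * Re z) * (9 * (Re z)\<^sup>2 / R\<^sup>2)"
proof -
  define u where "u = \<bar>Re z\<bar>"
  have u: "0 \<le> u" "u \<le> R" using z by (auto simp: u_def)
  have "Re (z\<^sup>2 + of_real R ^ 2) = (Re z)\<^sup>2" "Im (z\<^sup>2 + of_real R ^ 2) = 2 * Re z * Im z"
    using z(1) by (auto simp: power2_eq_square abs_if split: if_splits simp flip: of_real_power)
  then have "norm (z\<^sup>2 + of_real R ^ 2) \<le> u\<^sup>2 + 2 * u * R"
    using cmod_le[of "z\<^sup>2 + of_real R ^ 2"] z(1) by (simp add: abs_mult u_def)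
  also have "\<dots> \<le> 3 * u * R"
    using mult_left_mono[OF u(2,1)] by (simp add: power2_eq_square mult.commute)
  finally have n: "norm (z\<^sup>2 + of_real R ^ 2) \<le> 3 * u * R" .
  have "1 + z\<^sup>2 / of_real R ^ 2 = (z\<^sup>2 + of_real R ^ 2) / of_real R ^ 2"
    using R by (simp add: field_simps)
  then have "norm (1 + z\<^sup>2 / of_real R ^ 2) = norm (z\<^sup>2 + of_real R ^ 2) / R\<^sup>2"
    using R by (simp add: norm_divide norm_power)
  also have "\<dots> \<le> 3 * u * R / R\<^sup>2" using n by (intro divide_right_mono) auto
  also have "\<dots> = 3 * u / R" using R by (simp add: power2_eq_square)
  finally have "norm (1 + z\<^sup>2 / of_real R ^ 2) ^ 2 \<le> (3 * u / R) ^ 2" by (intro power_mono) auto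
  also have "\<dots> = 9 * (Re z)\<^sup>2 / R\<^sup>2" by (simp add: power_divide power_mult_distrib u_def)
  finally have "exp (T * Re z) * norm (1 + z\<^sup>2 / of_real R ^ 2) ^ 2 \<le> exp (T * Re z) * (9 * (Re z)\<^sup>2 / R\<^sup>2)"
    by (rule mult_left_mono) simp
  then show ?thesis
    by (simp only: newman_kernel_def norm_mult norm_power norm_exp_eq_Re Re_complex_of_real Im_complex_of_real times_complex.sel mult_zero_left diff_zero)
qed

lemma newman_kernel_le:
  assumes R: "R > 0" and z: "\<bar>Im z\<bar> \<le> R" "\<bar>Re z\<bar> \<le> R"
  shows "norm (newman_kernel R T z) \<le> exp (T * Re z) * 9"
proof -
  have "(Re z)\<^sup>2 \<le> R\<^sup>2" "(Im z)\<^sup>2 \<le> R\<^sup>2" using R z by (auto simp: abs_le_square_iff[symmetric])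
  then have "(norm z)\<^sup>2 \<le> 2 * R\<^sup>2" by (simp add: cmod_power2)
  then have "norm (z\<^sup>2 / of_real R ^ 2) \<le> 2"
    using R by (simp add: norm_divide norm_power field_simps)
  then have "norm (1 + z\<^sup>2 / of_real R ^ 2) \<le> 3"
    using norm_triangle_ineq[of 1 "z\<^sup>2 / of_real R ^ 2"] by simp
  then have "norm (1 + z\<^sup>2 / of_real R ^ 2) ^ 2 \<le> 3 ^ 2" by (intro power_mono) auto
  then show ?thesis
    by (simp add: newman_kernel_def norm_mult norm_power)
qed

text \<open>Both values at 0 are written by Cauchy's formula with the kernel inserted. On the right
  only g - h is estimated, its decay e^(-T Re z) cancelling the growth of the kernel. On the left
  the two are estimated separately: h is entire, so its path can go out to Re z = -R, where the
  kernel again cancels its growth; g stays at Re z = \<open>- \<delta>\<close> and there profits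
  from the factor exp(\<open>- \<delta> * T\<close>).\<close>

lemma newman_contour_estimate:
  fixes g h :: "complex \<Rightarrow> complex" and R T \<delta> B M :: real
  assumes R: "R \<ge> 1" and \<delta>: "0 < \<delta>" "\<delta> \<le> 1" and B: "B \<ge> 0" and M: "M \<ge> 0"
    and S: "open S" "convex S" "g holomorphic_on S" "cbox (Complex (-\<delta>) (-R)) (Complex R R) \<subseteq> S"
    and h: "h holomorphic_on UNIV"
    and right: "\<And>z. Re z > 0 \<Longrightarrow> norm (g z - h z) \<le> B * (1 + 1 / Re z)\<^sup>2 * exp (- T * Re z) / norm z"
    and left: "\<And>z. Re z < 0 \<Longrightarrow> norm (h z) \<le> B * exp (- T * Re z) / \<bar>Re z\<bar>"
    and gleft: "\<And>z. - \<delta> \<le> Re z \<Longrightarrow> Re z \<le> 0 \<Longrightarrow> \<bar>Im z\<bar> \<le> R \<Longrightarrow> Re z = - \<delta> \<or> \<bar>Im z\<bar> = R \<Longrightarrow>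
      norm (g z) \<le> M"
    and T: "T \<ge> 0"
  shows "norm (g 0 - h 0) \<le> 30 * B / R + 3 * M * R * exp (- \<delta> * T) / \<delta> + 3 * M / R ^ 3"
proof -
  let ?K = "newman_kernel R T"
  let ?F = "\<lambda>z. g z * ?K z" and ?H = "\<lambda>z. h z * ?K z"
  have R0: "R > 0" using R by simp
  have K_hol: "?K holomorphic_on A" for A
    unfolding newman_kernel_def by (intro holomorphic_intros) (use R0 in auto)
  have F_hol: "?F holomorphic_on S" and H_hol: "?H holomorphic_on UNIV"
    using S(3) h K_hol by (auto intro: holomorphic_on_mult)
  have K0: "?K 0 = 1" by (simp add: newman_kernel_def)
  define JF where "JF a b = contour_integral (linepath a b) (\<lambda>z. ?F z / z)" for a b
  define JH where "JH a b = contour_integral (linepath a b) (\<lambda>z. ?H z / z)" for a b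
  note F = rectangle_Cauchy_formula[OF \<delta>(1) R0 S(1,2) F_hol S(4), folded JF_def]
  note H = rectangle_Cauchy_formula[OF R0 R0 open_UNIV convex_UNIV H_hol subset_UNIV, folded JH_def]
  let ?o1 = "Complex 0 (-R)" and ?o2 = "Complex 0 R" and ?c1 = "Complex R (-R)" and ?c2 = "Complex R R"
    and ?b1 = "Complex (-\<delta>) (-R)" and ?b2 = "Complex (-\<delta>) R" and ?p1 = "Complex (-R) (-R)" and ?p2 = "Complex (-R) R"
  have nz: "norm z \<ge> R" if "\<bar>Im z\<bar> = R \<or> \<bar>Re z\<bar> = R" for z
    using that abs_Im_le_cmod[of z] abs_Re_le_cmod[of z] by auto
  note seg = closed_segment_same_Re closed_segment_same_Im closed_segment_eq_real_ivl
  have hseg: "\<bar>Im z\<bar> = R \<and> 0 \<le> Re z \<and> Re z \<le> R" if "z \<in> closed_segment ?o1 ?c1 \<union> closed_segment ?c2 ?o2" for z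
    using that R0 by (auto simp: seg)
  have vseg: "\<bar>Im z\<bar> \<le> R \<and> Re z = R" if "z \<in> closed_segment ?c1 ?c2" for z
    using that R0 by (auto simp: seg)
  have lseg: "\<bar>Im z\<bar> = R \<and> - l \<le> Re z \<and> Re z \<le> 0"
    if "z \<in> closed_segment ?o2 (Complex (-l) R) \<union> closed_segment (Complex (-l) (-R)) ?o1" "l > 0" for z l
    using that R0 by (auto simp: seg)
  have lvseg: "\<bar>Im z\<bar> \<le> R \<and> Re z = - l" if "z \<in> closed_segment (Complex (-l) R) (Complex (-l) (-R))" for z l
    using that R0 by (auto simp: seg)
  have inS: "z \<in> S" if "- \<delta> \<le> Re z" "Re z \<le> R" "\<bar>Im z\<bar> \<le> R" for z
    using that S(4) by (force simp: in_cbox_complex_iff)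
  have nz0: "z \<noteq> 0" if "\<bar>Im z\<bar> = R \<or> \<bar>Re z\<bar> = R" for z
    using nz[OF that] R0 by auto
  have hS: "z \<in> S - {0}" if "\<bar>Im z\<bar> = R \<and> 0 \<le> Re z \<and> Re z \<le> R" for z
    using inS[of z] nz0[of z] that \<delta> by auto
  have hS': "z \<in> S - {0}" if "\<bar>Im z\<bar> \<le> R \<and> Re z = R" for z
    using inS[of z] nz0[of z] that R0 \<delta> by auto
  have lS: "z \<in> S - {0}" if "\<bar>Im z\<bar> = R \<and> - \<delta> \<le> Re z \<and> Re z \<le> 0" for z
    using inS[of z] nz0[of z] that R0 by auto
  have lS': "z \<in> S - {0}" if "\<bar>Im z\<bar> \<le> R \<and> Re z = - \<delta>" for z
    using inS[of z] that R0 \<delta> by auto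
  have n1: "norm (b - a) \<le> \<bar>Re b - Re a\<bar> + \<bar>Im b - Im a\<bar>" for a b
    using cmod_le[of "b - a"] by simp
  have iF: "(\<lambda>z. ?F z / z) contour_integrable_on linepath ?o1 ?c1" "(\<lambda>z. ?F z / z) contour_integrable_on linepath ?c2 ?o2"
    "(\<lambda>z. ?F z / z) contour_integrable_on linepath ?c1 ?c2"
    "(\<lambda>z. ?F z / z) contour_integrable_on linepath ?o2 ?b2" "(\<lambda>z. ?F z / z) contour_integrable_on linepath ?b2 ?b1"
    "(\<lambda>z. ?F z / z) contour_integrable_on linepath ?b1 ?o1"
    using hS[OF hseg] hS'[OF vseg] lS[OF lseg[OF _ \<delta>(1)]] lS'[OF lvseg] by (intro F(2) subsetI; blast)+
  have iH: "(\<lambda>z. ?H z / z) contour_integrable_on linepath ?o1 ?c1" "(\<lambda>z. ?H z / z) contour_integrable_on linepath ?c2 ?o2"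
    "(\<lambda>z. ?H z / z) contour_integrable_on linepath ?c1 ?c2"
    "(\<lambda>z. ?H z / z) contour_integrable_on linepath ?o2 ?p2" "(\<lambda>z. ?H z / z) contour_integrable_on linepath ?p2 ?p1"
    "(\<lambda>z. ?H z / z) contour_integrable_on linepath ?p1 ?o1"
    using nz0 hseg vseg lseg[OF _ R0] lvseg by (intro H(2) subsetI; force)+
  let ?D = "\<lambda>z. ?F z / z - ?H z / z"
  have D_eq: "?D z = (g z - h z) * ?K z / z" for z
    by (simp add: diff_divide_distrib left_diff_distrib)
  have R_hor: "norm (?D z) \<le> 36 * B / R\<^sup>2" if z: "\<bar>Im z\<bar> = R \<and> 0 \<le> Re z \<and> Re z \<le> R" for z
  proof (cases "Re z = 0")
    case True
    then have "norm (?K z) \<le> 0" using newman_kernel_horizontal[OF R0, of z T] z R0 by simp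
    then show ?thesis using B by simp
  next
    case False
    define x where "x = Re z"
    have x: "x > 0" "x \<le> R" using False z by (auto simp: x_def)
    have zR: "norm z \<ge> R" using nz z by blast
    have "norm (?D z) = norm (g z - h z) * norm (?K z) / norm z"
      by (simp only: D_eq norm_mult norm_divide)
    also have "\<dots> \<le> (B * (1 + 1 / x)\<^sup>2 * exp (- T * x) / R) * (exp (T * x) * (9 * x\<^sup>2 / R\<^sup>2)) / R"
    proof (intro frac_le mult_mono)
      have "norm (g z - h z) \<le> B * (1 + 1 / x)\<^sup>2 * exp (- T * x) / norm z"
        using right[of z] x by (simp add: x_def)
      also have "\<dots> \<le> B * (1 + 1 / x)\<^sup>2 * exp (- T * x) / R"
        using zR R0 B by (intro divide_left_mono) (auto intro!: mult_pos_pos)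
      finally show "norm (g z - h z) \<le> B * (1 + 1 / x)\<^sup>2 * exp (- T * x) / R" .
      show "norm (?K z) \<le> exp (T * x) * (9 * x\<^sup>2 / R\<^sup>2)"
        unfolding x_def by (rule newman_kernel_horizontal[OF R0]) (use z in auto)
    qed (use zR R0 B in auto)
    also have "\<dots> = 9 * B * ((1 + 1 / x) * x)\<^sup>2 / R\<^sup>2 / R\<^sup>2 * (exp (- T * x) * exp (T * x))"
      by (simp add: power_mult_distrib power2_eq_square mult_ac)
    also have "exp (- T * x) * exp (T * x) = 1" by (simp flip: exp_add)
    also have "(1 + 1 / x) * x = x + 1" using x by (simp add: field_simps)
    also have "9 * B * (x + 1)\<^sup>2 / R\<^sup>2 / R\<^sup>2 * 1 \<le> 9 * B * (2 * R)\<^sup>2 / R\<^sup>2 / R\<^sup>2 * 1"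
      using x R B by (intro mult_right_mono divide_right_mono mult_left_mono power_mono) auto
    also have "\<dots> = 36 * B / R\<^sup>2" using R0 by (simp add: power_mult_distrib)
    finally show ?thesis .
  qed
  have R_ver: "norm (?D z) \<le> 36 * B / R\<^sup>2" if z: "\<bar>Im z\<bar> \<le> R \<and> Re z = R" for z
  proof -
    have zR: "norm z \<ge> R" using nz z R0 by auto
    have "norm (?D z) = norm (g z - h z) * norm (?K z) / norm z"
      by (simp only: D_eq norm_mult norm_divide)
    also have "\<dots> \<le> (B * (1 + 1 / R)\<^sup>2 * exp (- T * R) / R) * (exp (T * R) * 9) / R"
    proof (intro frac_le mult_mono)
      have "norm (g z - h z) \<le> B * (1 + 1 / R)\<^sup>2 * exp (- T * R) / norm z"
        using right[of z] z R0 by simp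
      also have "\<dots> \<le> B * (1 + 1 / R)\<^sup>2 * exp (- T * R) / R"
        using zR R0 B by (intro divide_left_mono) (auto intro!: mult_pos_pos)
      finally show "norm (g z - h z) \<le> B * (1 + 1 / R)\<^sup>2 * exp (- T * R) / R" .
      show "norm (?K z) \<le> exp (T * R) * 9"
        using newman_kernel_le[OF R0, of z T] z R0 by simp
    qed (use zR R0 B in auto)
    also have "\<dots> = 9 * B * (1 + 1 / R)\<^sup>2 / R\<^sup>2 * (exp (- T * R) * exp (T * R))"
      by (simp add: power2_eq_square mult_ac)
    also have "exp (- T * R) * exp (T * R) = 1" by (simp flip: exp_add)
    also have "9 * B * (1 + 1 / R)\<^sup>2 / R\<^sup>2 * 1 \<le> 9 * B * 2\<^sup>2 / R\<^sup>2 * 1"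
      using R B by (intro mult_right_mono divide_right_mono mult_left_mono power_mono) auto
    finally show ?thesis by simp
  qed
  have bR: "norm (JF a b - JH a b) \<le> 36 * B / R\<^sup>2 * L"
    if "(\<lambda>z. ?F z / z) contour_integrable_on linepath a b" "(\<lambda>z. ?H z / z) contour_integrable_on linepath a b"
      "\<And>z. z \<in> closed_segment a b \<Longrightarrow> norm (?D z) \<le> 36 * B / R\<^sup>2" "norm (b - a) \<le> L" for a b L
  proof -
    have "JF a b - JH a b = contour_integral (linepath a b) ?D"
      unfolding JF_def JH_def using contour_integral_diff[OF that(1,2)] by simp
    then show ?thesis
      using contour_integral_linepath_le[OF contour_integrable_diff[OF that(1,2)] _ that(3,4)] B by simp
  qed
  have R1: "norm (JF ?o1 ?c1 - JH ?o1 ?c1) \<le> 36 * B / R\<^sup>2 * R"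
    by (rule bR[OF iF(1) iH(1)]) (use n1[of ?c1 ?o1] R0 R_hor hseg in auto)
  have R2: "norm (JF ?c1 ?c2 - JH ?c1 ?c2) \<le> 36 * B / R\<^sup>2 * (2 * R)"
    by (rule bR[OF iF(3) iH(3)]) (use n1[of ?c2 ?c1] R0 R_ver vseg in auto)
  have R3: "norm (JF ?c2 ?o2 - JH ?c2 ?o2) \<le> 36 * B / R\<^sup>2 * R"
    by (rule bR[OF iF(2) iH(2)]) (use n1[of ?o2 ?c2] R0 R_hor hseg in auto)
  have H_hor: "norm (?H z / z) \<le> 9 * B / R\<^sup>2" if z: "\<bar>Im z\<bar> = R \<and> - R \<le> Re z \<and> Re z \<le> 0" for z
  proof (cases "Re z = 0")
    case True
    then have "norm (?K z) \<le> 0" using newman_kernel_horizontal[OF R0, of z T] z R0 by simp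
    then show ?thesis using B by simp
  next
    case False
    define x where "x = - Re z"
    have x: "x > 0" "x \<le> R" "Re z = - x" using False z by (auto simp: x_def)
    have zR: "norm z \<ge> R" using nz z by blast
    have "norm (?H z / z) = norm (h z) * norm (?K z) / norm z" by (simp add: norm_mult norm_divide)
    also have "\<dots> \<le> (B * exp (T * x) / x) * (exp (- T * x) * (9 * x\<^sup>2 / R\<^sup>2)) / R"
    proof (intro frac_le mult_mono)
      show "norm (h z) \<le> B * exp (T * x) / x" using left[of z] x by simp
      show "norm (?K z) \<le> exp (- T * x) * (9 * x\<^sup>2 / R\<^sup>2)"
        using newman_kernel_horizontal[OF R0, of z T] z x by simp
    qed (use zR R0 B x in auto)
    also have "\<dots> = 9 * B * x / R\<^sup>2 / R * (exp (T * x) * exp (- T * x))"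
      using x by (simp add: power2_eq_square mult_ac)
    also have "exp (T * x) * exp (- T * x) = 1" by (simp flip: exp_add)
    also have "9 * B * x / R\<^sup>2 / R * 1 \<le> 9 * B * R / R\<^sup>2 / R * 1"
      using x R0 B by (intro mult_right_mono divide_right_mono mult_left_mono) auto
    finally show ?thesis using R0 by simp
  qed
  have H_ver: "norm (?H z / z) \<le> 9 * B / R\<^sup>2" if z: "\<bar>Im z\<bar> \<le> R \<and> Re z = - R" for z
  proof -
    have zR: "norm z \<ge> R" using nz z R0 by auto
    have "norm (?H z / z) = norm (h z) * norm (?K z) / norm z" by (simp add: norm_mult norm_divide)
    also have "\<dots> \<le> (B * exp (T * R) / R) * (exp (- T * R) * 9) / R"
    proof (intro frac_le mult_mono)
      show "norm (h z) \<le> B * exp (T * R) / R" using left[of z] z R0 by simp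
      show "norm (?K z) \<le> exp (- T * R) * 9" using newman_kernel_le[OF R0, of z T] z R0 by simp
    qed (use zR R0 B in auto)
    also have "\<dots> = 9 * B / R\<^sup>2 * (exp (T * R) * exp (- T * R))"
      by (simp add: power2_eq_square mult_ac)
    also have "exp (T * R) * exp (- T * R) = 1" by (simp flip: exp_add)
    finally show ?thesis by simp
  qed
  have B9: "0 \<le> 9 * B / R\<^sup>2" using B by simp
  have H1: "norm (JH ?o2 ?p2) \<le> 9 * B / R\<^sup>2 * R"
    unfolding JH_def by (rule contour_integral_linepath_le[OF iH(4) B9]) (use n1[of ?p2 ?o2] R0 H_hor lseg[OF _ R0] in auto)
  have H2: "norm (JH ?p2 ?p1) \<le> 9 * B / R\<^sup>2 * (2 * R)"
    unfolding JH_def by (rule contour_integral_linepath_le[OF iH(5) B9]) (use n1[of ?p1 ?p2] R0 H_ver lvseg in auto)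
  have H3: "norm (JH ?p1 ?o1) \<le> 9 * B / R\<^sup>2 * R"
    unfolding JH_def by (rule contour_integral_linepath_le[OF iH(6) B9]) (use n1[of ?o1 ?p1] R0 H_hor lseg[OF _ R0] in auto)
  have F_hor: "norm (?F z / z) \<le> 9 * M / R ^ 3" if z: "\<bar>Im z\<bar> = R \<and> - \<delta> \<le> Re z \<and> Re z \<le> 0" for z
  proof -
    have zR: "norm z \<ge> R" using nz z by blast
    have "norm (?F z / z) = norm (g z) * norm (?K z) / norm z" by (simp add: norm_mult norm_divide)
    also have "\<dots> \<le> M * (1 * (9 * 1 / R\<^sup>2)) / R"
    proof (intro frac_le mult_mono)
      show "norm (g z) \<le> M" using gleft z by auto
      have "(Re z)\<^sup>2 \<le> 1\<^sup>2" using z \<delta> by (intro abs_le_square_iff[THEN iffD1]) auto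
      then have "exp (T * Re z) * (9 * (Re z)\<^sup>2 / R\<^sup>2) \<le> 1 * (9 * 1 / R\<^sup>2)"
        using T z by (intro mult_mono divide_right_mono mult_left_mono) (auto simp: mult_nonneg_nonpos)
      then show "norm (?K z) \<le> 1 * (9 * 1 / R\<^sup>2)"
        using newman_kernel_horizontal[OF R0, of z T] z R \<delta> by simp
    qed (use zR R0 M in auto)
    also have "\<dots> = 9 * M / R ^ 3" by (simp add: power2_eq_square power3_eq_cube)
    finally show ?thesis .
  qed
  have F_ver: "norm (?F z / z) \<le> 9 * M * exp (- \<delta> * T) / \<delta>" if z: "\<bar>Im z\<bar> \<le> R \<and> Re z = - \<delta>" for z
  proof -
    have zd: "norm z \<ge> \<delta>" using abs_Re_le_cmod[of z] z \<delta> by simp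
    have "norm (?F z / z) = norm (g z) * norm (?K z) / norm z" by (simp add: norm_mult norm_divide)
    also have "\<dots> \<le> M * (exp (- \<delta> * T) * 9) / \<delta>"
    proof (intro frac_le mult_mono)
      show "norm (g z) \<le> M" using gleft z \<delta> by auto
      show "norm (?K z) \<le> exp (- \<delta> * T) * 9" using newman_kernel_le[OF R0, of z T] z R \<delta> by (simp add: mult.commute)
    qed (use zd \<delta> M in auto)
    finally show ?thesis by (simp add: mult_ac)
  qed
  have M9: "0 \<le> 9 * M / R ^ 3" "0 \<le> 9 * M * exp (- \<delta> * T) / \<delta>" using M R0 \<delta> by auto
  have F1: "norm (JF ?o2 ?b2) \<le> 9 * M / R ^ 3 * 1"
    unfolding JF_def by (rule contour_integral_linepath_le[OF iF(4) M9(1)]) (use n1[of ?b2 ?o2] \<delta> R0 F_hor lseg[OF _ \<delta>(1)] in auto)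
  have F2: "norm (JF ?b2 ?b1) \<le> 9 * M * exp (- \<delta> * T) / \<delta> * (2 * R)"
    unfolding JF_def by (rule contour_integral_linepath_le[OF iF(5) M9(2)]) (use n1[of ?b1 ?b2] \<delta> R0 F_ver lvseg in auto)
  have F3: "norm (JF ?b1 ?o1) \<le> 9 * M / R ^ 3 * 1"
    unfolding JF_def by (rule contour_integral_linepath_le[OF iF(6) M9(1)]) (use n1[of ?o1 ?b1] \<delta> R0 F_hor lseg[OF _ \<delta>(1)] in auto)
  have regroup: "(r1 + r2 + r3 + l1 + l2 + l3) - (s1 + s2 + s3 + k1 + k2 + k3)
      = (r1 - s1) + (r2 - s2) + (r3 - s3) + l1 + l2 + l3 - k1 - k2 - k3" for r1 r2 r3 l1 l2 l3 s1 s2 s3 k1 k2 k3 :: complex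
    by simp
  have triangle: "norm (r1 + r2 + r3 + l1 + l2 + l3 - k1 - k2 - k3)
      \<le> norm r1 + norm r2 + norm r3 + norm l1 + norm l2 + norm l3 + norm k1 + norm k2 + norm k3"
    for r1 r2 r3 l1 l2 l3 k1 k2 k3 :: complex
    by ((rule order_trans[OF norm_triangle_ineq4 add_right_mono])+, (rule order_trans[OF norm_triangle_ineq add_right_mono])+, rule order_refl)
  have "2 * of_real pi * \<i> * (g 0 - h 0) = 2 * of_real pi * \<i> * ?F 0 - 2 * of_real pi * \<i> * ?H 0"
    by (simp add: K0 algebra_simps)
  also have "\<dots> =
      (JF ?o1 ?c1 - JH ?o1 ?c1) + (JF ?c1 ?c2 - JH ?c1 ?c2) + (JF ?c2 ?o2 - JH ?c2 ?o2)
      + JF ?o2 ?b2 + JF ?b2 ?b1 + JF ?b1 ?o1 - JH ?o2 ?p2 - JH ?p2 ?p1 - JH ?p1 ?o1"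
    unfolding F(1) H(1) by (rule regroup)
  finally have "norm (2 * of_real pi * \<i> * (g 0 - h 0)) \<le> norm (JF ?o1 ?c1 - JH ?o1 ?c1) + norm (JF ?c1 ?c2 - JH ?c1 ?c2) + norm (JF ?c2 ?o2 - JH ?c2 ?o2)
      + norm (JF ?o2 ?b2) + norm (JF ?b2 ?b1) + norm (JF ?b1 ?o1) + norm (JH ?o2 ?p2) + norm (JH ?p2 ?p1) + norm (JH ?p1 ?o1)"
    by (simp only: triangle)
  also have "\<dots> \<le> 36 * B / R\<^sup>2 * R + 36 * B / R\<^sup>2 * (2 * R) + 36 * B / R\<^sup>2 * R
      + 9 * M / R ^ 3 * 1 + 9 * M * exp (- \<delta> * T) / \<delta> * (2 * R) + 9 * M / R ^ 3 * 1 + 9 * B / R\<^sup>2 * R + 9 * B / R\<^sup>2 * (2 * R) + 9 * B / R\<^sup>2 * R"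
    by (intro add_mono R1 R2 R3 F1 F2 F3 H1 H2 H3)
  also have "\<dots> = 180 * (B / R) + 18 * (M / R ^ 3) + 18 * (M * R * exp (- \<delta> * T) / \<delta>)"
  proof -
    have "36 * B / R\<^sup>2 * R = 36 * (B / R)" "36 * B / R\<^sup>2 * (2 * R) = 72 * (B / R)"
      "9 * B / R\<^sup>2 * R = 9 * (B / R)" "9 * B / R\<^sup>2 * (2 * R) = 18 * (B / R)"
      using R0 by (simp_all add: power2_eq_square)
    moreover have "9 * M * exp (- \<delta> * T) / \<delta> * (2 * R) = 18 * (M * R * exp (- \<delta> * T) / \<delta>)" by simp
    moreover have "9 * M / R ^ 3 * 1 = 9 * (M / R ^ 3)" by simp
    ultimately show ?thesis by linarith
  qed
  also have "norm (2 * of_real pi * \<i> * (g 0 - h 0)) = 2 * pi * norm (g 0 - h 0)"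
    by (simp add: norm_mult)
  finally have "2 * pi * norm (g 0 - h 0) \<le> 6 * (30 * (B / R) + 3 * (M / R ^ 3) + 3 * (M * R * exp (- \<delta> * T) / \<delta>))" by simp
  \<comment> \<open>Replacing 2 pi by 6 divides the totals 180, 18, 18 into the constants 30, 3, 3
    of the statement.\<close>
  moreover have "6 * norm (g 0 - h 0) \<le> 2 * pi * norm (g 0 - h 0)"
    using pi_gt3 by (intro mult_right_mono) auto
  ultimately show ?thesis by simp
qed

section \<open>Convergence of the series\<close>

definition coeff_a_sum :: "real \<Rightarrow> real" where
  "coeff_a_sum T = (\<Sum>n\<in>exp_seg T. coeff_a n)"

definition coeff_a_log_sum :: "real \<Rightarrow> real" where
  "coeff_a_log_sum T = (\<Sum>n\<in>exp_seg T. coeff_a n * ln (real n))"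

text \<open>\<open>partial_transform T z\<close> is \<open>z\<close> times the Laplace transform of \<open>coeff_a_sum - 1/2\<close> over \<open>[0, T]\<close>,
  and \<open>coeff_a_transform z - 1/2\<close> is \<open>z\<close> times its full Laplace transform.\<close>

definition partial_transform :: "real \<Rightarrow> complex \<Rightarrow> complex" where
  "partial_transform T z = (\<Sum>n\<in>exp_seg T. of_real (coeff_a n) * of_nat n powr (-z)) - 1 / 2
     - of_real (coeff_a_sum T - 1 / 2) * exp (- of_real T * z)"

text \<open>Removes the singularity at 0. The redundant-looking \<open>z - 0\<close> is the shape in
  which \<open>pole_lemma_open\<close> proves holomorphy.\<close>

definition difference_quotient :: "(complex \<Rightarrow> complex) \<Rightarrow> complex \<Rightarrow> complex" where
  "difference_quotient f z = (if z = 0 then deriv f 0 else (f z - f 0) / (z - 0))"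

lemma difference_quotient_holomorphic:
  "f holomorphic_on S \<Longrightarrow> open S \<Longrightarrow> difference_quotient f holomorphic_on S"
  unfolding difference_quotient_def[abs_def] by (rule pole_lemma_open)

lemma partial_transform_0: "partial_transform T 0 = 0"
proof -
  have "(\<Sum>n\<in>exp_seg T. of_real (coeff_a n) * of_nat n powr (-0)) = (of_real (coeff_a_sum T) :: complex)"
    unfolding coeff_a_sum_def of_real_sum by (rule sum.cong) (auto simp: exp_seg_def)
  then show ?thesis by (simp add: partial_transform_def)
qed

lemma partial_transform_has_field_derivative:
  "(partial_transform T has_field_derivative
     (\<Sum>n\<in>exp_seg T. of_real (coeff_a n) * (- (of_nat n powr (-z) * of_real (ln (real n)))))
      + of_real (coeff_a_sum T - 1 / 2) * (of_real T * exp (- of_real T * z))) (at z)"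
proof -
  have p: "((\<lambda>z. of_real (coeff_a n) * of_nat n powr (-z)) has_field_derivative
      of_real (coeff_a n) * (- (of_nat n powr (-z) * of_real (ln (real n))))) (at z)"
    if "n \<in> exp_seg T" for n
  proof -
    have n: "n > 0" using that by (simp add: exp_seg_def)
    have "ln (of_nat n :: complex) = of_real (ln (real n))"
      using Ln_of_real[of "real n"] n by simp
    then have "((\<lambda>z. of_nat n powr z) has_field_derivative of_real (ln (real n)) * of_nat n powr (-z)) (at (-z))"
      using has_field_derivative_powr_right[of "of_nat n" "-z"] n by simp
    moreover have "((\<lambda>z. -z) has_field_derivative -1) (at z)"
      by (auto intro!: derivative_eq_intros)
    ultimately have "((\<lambda>z. (of_nat n :: complex) powr (-z)) has_field_derivative of_real (ln (real n)) * of_nat n powr (-z) * (-1)) (at z)"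
      using DERIV_chain2[of "\<lambda>z. of_nat n powr z" _ "\<lambda>z. -z" z "-1" UNIV] by blast
    then show ?thesis
      by (rule DERIV_cmult[THEN DERIV_cong]) (simp add: mult.commute)
  qed
  have e: "((\<lambda>z. exp (- of_real T * z)) has_field_derivative exp (- of_real T * z) * (- of_real T)) (at z)"
    by (auto intro!: derivative_eq_intros)
  show ?thesis
    unfolding partial_transform_def[abs_def]
    by (rule DERIV_diff[OF DERIV_diff[OF DERIV_sum[OF p] DERIV_const] DERIV_cmult[OF e], THEN DERIV_cong])
      (simp_all add: mult.commute)
qed

lemma partial_transform_holomorphic: "partial_transform T holomorphic_on UNIV"
  by (rule holomorphic_onI)
    (meson partial_transform_has_field_derivative field_differentiable_def field_differentiable_at_within)

text \<open>This is Q(T) of the Abel summation. It enters as a derivative at 0, so no integral of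
  the step function A has to be formed.\<close>

lemma difference_quotient_partial_transform_0:
  "difference_quotient (partial_transform T) 0 = of_real (T * (coeff_a_sum T - 1 / 2) - coeff_a_log_sum T)"
proof -
  have "(\<Sum>n\<in>exp_seg T. of_real (coeff_a n) * (- (of_nat n powr (-0) * of_real (ln (real n))))) = - (of_real (coeff_a_log_sum T) :: complex)"
    unfolding coeff_a_log_sum_def of_real_sum sum_negf[symmetric] by (rule sum.cong) (auto simp: exp_seg_def)
  then show ?thesis
    using DERIV_imp_deriv[OF partial_transform_has_field_derivative[of T 0]]
    by (simp add: difference_quotient_def)
qed

lemma coeff_a_transform_0: "coeff_a_transform 0 = 1 / 2"
  by (simp add: coeff_a_transform_def reg_zeta_1)

text \<open>In the quotient rule the numerator contributes gamma and the denominator takes away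
  gamma/2.\<close>

lemma difference_quotient_coeff_a_transform_0:
  "difference_quotient coeff_a_transform 0 = of_real (euler_mascheroni / 2)"
proof -
  have z2: "((\<lambda>z. reg_zeta (1 + 2 * z)) has_field_derivative euler_mascheroni * 2) (at 0)"
    by (rule DERIV_chain2[of reg_zeta]) (auto intro!: derivative_eq_intros simp: reg_zeta_deriv_1)
  have z1: "((\<lambda>z. 2 * reg_zeta (1 + z)) has_field_derivative 2 * (euler_mascheroni * 1)) (at 0)"
    by (intro DERIV_cmult DERIV_chain2[of reg_zeta]) (auto intro!: derivative_eq_intros simp: reg_zeta_deriv_1)
  have "(coeff_a_transform has_field_derivative euler_mascheroni / 2) (at 0)"
    unfolding coeff_a_transform_def[abs_def]
    by (rule DERIV_divide[OF z2 z1, THEN DERIV_cong]) (simp_all add: reg_zeta_1)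
  then show ?thesis
    by (simp add: difference_quotient_def DERIV_imp_deriv)
qed

lemma partial_transform_left:
  assumes T: "T \<ge> 0" and z: "Re z < 0"
  shows "norm (difference_quotient (partial_transform T) z) \<le> 3 * (1 + T)\<^sup>2 * exp (- T * Re z) / \<bar>Re z\<bar>"
proof -
  let ?E = "exp (- T * Re z)"
  define A where "A = (\<Sum>n\<in>exp_seg T. \<bar>coeff_a n\<bar>)"
  have A: "A \<le> (1 + T)\<^sup>2" unfolding A_def by (rule sum_abs_coeff_a_exp_seg[OF T])
  have E1: "?E \<ge> 1" using T z by (simp add: mult_nonneg_nonpos)
  have "norm (\<Sum>n\<in>exp_seg T. of_real (coeff_a n) * (of_nat n :: complex) powr (-z)) \<le> (\<Sum>n\<in>exp_seg T. \<bar>coeff_a n\<bar> * ?E)"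
  proof (rule sum_norm_le)
    fix n assume "n \<in> exp_seg T"
    then have n: "n > 0" "real n \<le> exp T" by (auto simp: exp_seg_def)
    have "real n powr (- Re z) \<le> exp T powr (- Re z)" using n z by (intro powr_mono2) auto
    also have "\<dots> = ?E" by (simp add: powr_def mult.commute)
    finally show "norm (of_real (coeff_a n) * (of_nat n :: complex) powr (-z)) \<le> \<bar>coeff_a n\<bar> * ?E"
      by (simp add: norm_mult norm_nat_powr mult_left_mono)
  qed
  also have "\<dots> = A * ?E" by (simp add: A_def sum_distrib_right)
  finally have n1: "norm (\<Sum>n\<in>exp_seg T. of_real (coeff_a n) * (of_nat n :: complex) powr (-z)) \<le> A * ?E" .
  have "\<bar>coeff_a_sum T - 1 / 2\<bar> \<le> A + 1 / 2"
    using sum_abs[of coeff_a "exp_seg T"] unfolding coeff_a_sum_def A_def by linarith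
  then have n2: "norm (of_real (coeff_a_sum T - 1 / 2) * exp (- of_real T * z)) \<le> (A + 1 / 2) * ?E"
    by (simp only: norm_mult norm_of_real norm_exp_eq_Re) (simp add: mult_right_mono)
  have "norm (partial_transform T z) \<le> A * ?E + 1 / 2 + (A + 1 / 2) * ?E"
    unfolding partial_transform_def
    by (intro order_trans[OF norm_triangle_ineq4] add_mono n1 n2) simp_all
  also have "\<dots> \<le> A * ?E + 1 / 2 * ?E + (A + 1 / 2) * ?E" using E1 by simp
  also have "\<dots> = (2 * A + 1) * ?E" by (simp add: algebra_simps)
  also have "\<dots> \<le> (3 * (1 + T)\<^sup>2) * ?E"
  proof (rule mult_right_mono)
    have "1 \<le> (1 + T)\<^sup>2" using T by simp
    then show "2 * A + 1 \<le> 3 * (1 + T)\<^sup>2" using A by linarith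
  qed simp
  finally have "norm (partial_transform T z) / norm z \<le> (3 * (1 + T)\<^sup>2) * ?E / \<bar>Re z\<bar>"
    using abs_Re_le_cmod[of z] z by (intro frac_le) auto
  then show ?thesis
    using z by (auto simp: difference_quotient_def partial_transform_0 norm_divide)
qed

text \<open>The terms with n <= e^T cancel, leaving the tail of the absolutely convergent series and
  the boundary term with A(T) - 1/2. The constant is 34 = 2 * 4^2 + 2: the 4 turns 1 + 4/x into 4 (1
  + 1/x), and the last 2 is the boundary term.\<close>

lemma partial_transform_right:
  assumes T: "T \<ge> 0" and z: "Re z > 0"
  shows "norm (difference_quotient coeff_a_transform z - difference_quotient (partial_transform T) z)
    \<le> 34 * (1 + T)\<^sup>2 * (1 + 1 / Re z)\<^sup>2 * exp (- T * Re z) / norm z"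
proof -
  let ?E = "exp (- T * Re z)" and ?x = "Re z"
  let ?f = "\<lambda>n. of_real (coeff_a n) * (of_nat n :: complex) powr (-z)"
  let ?W = "(1 + T)\<^sup>2 * (1 + 1 / ?x)\<^sup>2"
  have z0: "z \<noteq> 0" using z by auto
  define U where "U = {0<..} - exp_seg T"
  have sub: "exp_seg T \<subseteq> {0<..}" by (auto simp: exp_seg_def)
  have norm_f: "norm (?f n) = \<bar>coeff_a n\<bar> * real n powr (- ?x)" for n
    by (simp add: norm_mult norm_nat_powr)
  have abs_sm: "(\<lambda>n. \<bar>coeff_a n\<bar> * real n powr (- ?x)) summable_on U"
    by (rule summable_on_subset[OF coeff_a_series(2)[OF z]]) (auto simp: U_def)
  have "(?f has_sum (coeff_a_transform z - sum ?f (exp_seg T))) U"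
    unfolding U_def
    by (rule has_sum_Diff[OF coeff_a_series(1)[OF z] has_sum_finite sub]) simp
  then have inf: "coeff_a_transform z - sum ?f (exp_seg T) = infsum ?f U"
    by (simp add: infsumI)
  have "norm (infsum ?f U) \<le> infsum (\<lambda>n. norm (?f n)) U"
    by (rule norm_infsum_bound) (use abs_sm in \<open>simp only: norm_f\<close>)
  also have "\<dots> \<le> 2 * ((1 + T)\<^sup>2 * (1 + 4 / ?x)\<^sup>2) * exp (- ?x * T)"
    unfolding norm_f
  proof (rule infsum_le_finite_sums[OF abs_sm])
    fix F assume "finite F" "F \<subseteq> U"
    then show "(\<Sum>n\<in>F. \<bar>coeff_a n\<bar> * real n powr (- ?x)) \<le> 2 * ((1 + T)\<^sup>2 * (1 + 4 / ?x)\<^sup>2) * exp (- ?x * T)"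
      using z T by (intro sum_abs_coeff_a_tail) (auto simp: U_def exp_seg_def subset_iff not_le)
  qed
  also have "\<dots> \<le> 2 * ((1 + T)\<^sup>2 * (4 * (1 + 1 / ?x))\<^sup>2) * ?E"
  proof -
    have "(1 + 4 / ?x)\<^sup>2 \<le> (4 * (1 + 1 / ?x))\<^sup>2" using z by (intro power_mono) auto
    then have "(1 + T)\<^sup>2 * (1 + 4 / ?x)\<^sup>2 \<le> (1 + T)\<^sup>2 * (4 * (1 + 1 / ?x))\<^sup>2" by (rule mult_left_mono) simp
    then show ?thesis by (simp add: mult.commute)
  qed
  also have "\<dots> = 32 * ?W * ?E" by (simp only: power_mult_distrib) simp
  finally have n1: "norm (infsum ?f U) \<le> 32 * ?W * ?E" .
  have W1: "(1 + T)\<^sup>2 + 1 / 2 \<le> 2 * ?W"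
  proof -
    have "1 \<le> (1 + 1 / ?x)\<^sup>2" using z by simp
    then have "(1 + T)\<^sup>2 * 1 \<le> ?W" by (intro mult_left_mono) auto
    moreover have "1 \<le> (1 + T)\<^sup>2" using T by simp
    ultimately show ?thesis by linarith
  qed
  have "\<bar>coeff_a_sum T - 1 / 2\<bar> \<le> (1 + T)\<^sup>2 + 1 / 2"
    using sum_abs[of coeff_a "exp_seg T"] sum_abs_coeff_a_exp_seg[OF T] unfolding coeff_a_sum_def by linarith
  also note W1
  finally have n2: "norm (of_real (coeff_a_sum T - 1 / 2) * exp (- of_real T * z)) \<le> 2 * ?W * ?E"
    by (simp only: norm_mult norm_of_real norm_exp_eq_Re) (simp add: mult_right_mono)
  have "coeff_a_transform z - 1 / 2 - partial_transform T z
      = infsum ?f U + of_real (coeff_a_sum T - 1 / 2) * exp (- of_real T * z)"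
    unfolding partial_transform_def inf[symmetric] by simp
  then have "norm (coeff_a_transform z - 1 / 2 - partial_transform T z) \<le> 32 * ?W * ?E + 2 * ?W * ?E"
    using norm_triangle_mono[OF n1 n2] by simp
  also have "\<dots> = 34 * ?W * ?E" by simp
  finally have "norm (coeff_a_transform z - 1 / 2 - partial_transform T z) / norm z \<le> 34 * ?W * ?E / norm z"
    by (rule divide_right_mono) simp
  moreover have "difference_quotient coeff_a_transform z - difference_quotient (partial_transform T) z
      = (coeff_a_transform z - 1 / 2 - partial_transform T z) / z"
    using z0 by (simp add: difference_quotient_def partial_transform_0 coeff_a_transform_0 diff_divide_distrib)
  ultimately show ?thesis by (simp add: norm_divide mult.assoc)
qed

text \<open>The contour estimate with B of order T^2, R = T^7 and M of order R^2 /
  \<open>\<delta>\<close>. Then B/R gives T^-5; the left vertical side gives R^3 /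
  \<open>\<delta>\<close>^2 times exp(\<open>- \<delta> * T\<close>), at most a constant times T^22
  exp(-d sqrt T); the short horizontal sides give 1/(\<open>\<delta>\<close> R), again absorbed by
  T^-5.\<close>

lemma partial_transform_remainder:
  obtains K d where "K > 0" "d > 0"
    "\<And>T. T \<ge> 1 \<Longrightarrow> \<bar>T * (coeff_a_sum T - 1 / 2) - coeff_a_log_sum T - euler_mascheroni / 2\<bar>
      \<le> K / T ^ 5 + K * T ^ 22 * exp (- d * sqrt T)"
proof -
  have e: "0 < 1 / (70::real)" "1 / (70::real) \<le> 1 / 4" by simp_all
  obtain c m where c: "0 < c" "c \<le> 1 / 4" and m: "0 < m"
    and lower: "\<And>z. Re z \<le> 0 \<Longrightarrow> - c * (3 + \<bar>Im z\<bar>) powr (- 5 * (1 / 70)) \<le> Re z \<Longrightarrow> m \<le> norm (reg_zeta (1 + z))"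
    using reg_zeta_lower_bound[OF e] by blast
  obtain C where C: "C > 0"
    "\<And>s. 1 - 1 / 2 \<le> Re s \<Longrightarrow> Re s \<le> 3 \<Longrightarrow> norm (reg_zeta s) \<le> C * (3 + \<bar>Im s\<bar>) powr (1 + 1)"
    using reg_zeta_growth[of 1] by auto
  \<comment> \<open>A factor 1/5 comes from 4 + R <= 5 R, a factor 1/2 from halving
    \<open>\<delta>0\<close>.\<close>
  define d where "d = c / 10"
  have d: "d > 0" using c by (simp add: d_def)
  define C1 where "C1 = 25 * C / (2 * m) + 1"
  have C1: "C1 > 0" using C m by (simp add: C1_def add_pos_pos)
  \<comment> \<open>4080 = 30 * 34 * 4, the 4 from (1 + T)^2 <= (2 T)^2.\<close>
  define K where "K = 4080 + 3 * C1 / d + 3 * C1 / d\<^sup>2"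
  have K: "K \<ge> 4080 + 3 * C1 / d" "K \<ge> 3 * C1 / d\<^sup>2" "K > 0"
    using C1 d by (auto simp: K_def add_pos_pos)
  have "\<bar>T * (coeff_a_sum T - 1 / 2) - coeff_a_log_sum T - euler_mascheroni / 2\<bar>
      \<le> K / T ^ 5 + K * T ^ 22 * exp (- d * sqrt T)" if T: "T \<ge> 1" for T
  proof -
    define R where "R = T ^ 7"
    \<comment> \<open>The base is 4 + R because the open region \<open>S\<close> reaches height R +
      1; the contour uses half the width so that it lies inside \<open>S\<close>.\<close>
    define \<delta>0 where "\<delta>0 = c * (4 + R) powr (- 5 * (1 / 70))"
    define \<delta> where "\<delta> = \<delta>0 / 2"
    have R: "R \<ge> 1" using T by (simp add: R_def)
    have "(4 + R) powr (- 5 * (1 / 70)) \<le> (4 + R) powr 0" using R by (intro powr_mono) auto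
    then have "\<delta>0 \<le> c * 1" unfolding \<delta>0_def using c R by (intro mult_left_mono) auto
    then have "\<delta>0 \<le> 1 / 4" using c(2) by linarith
    moreover have "0 < \<delta>0" using c R by (simp add: \<delta>0_def)
    ultimately have \<delta>0: "0 < \<delta>0" "\<delta>0 \<le> 1 / 4" by auto
    have \<delta>: "0 < \<delta>" "\<delta> \<le> 1" "\<delta> \<le> 1 / 8" "\<delta> < \<delta>0" using \<delta>0 by (auto simp: \<delta>_def)
    have sT: "sqrt T \<ge> 1" "sqrt T * sqrt T = T" using T by auto
    have \<delta>_ge: "d / sqrt T \<le> \<delta>"
    proof -
      have "R = T powr 7" using T powr_realpow[of T 7] by (simp add: R_def)
      \<comment> \<open>The choice of \<open>\<eta>\<close> pays off here: 5/70 = 1/14 and 7/14 =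
        1/2.\<close>
      then have "R powr (1 / 14) = T powr (1 / 2)" by (simp add: powr_powr)
      then have "sqrt T = R powr (1 / 14)" using T by (simp add: powr_half_sqrt)
      then have "1 / (5 * sqrt T) = 5 powr (-1) * R powr (- (1 / 14))"
        using R by (simp add: powr_minus_divide)
      also have "\<dots> \<le> 5 powr (- (1 / 14)) * R powr (- (1 / 14))"
        by (intro mult_right_mono powr_mono) auto
      also have "\<dots> = (5 * R) powr (- (1 / 14))" using R by (simp add: powr_mult)
      also have "\<dots> \<le> (4 + R) powr (- (1 / 14))" using R by (intro powr_mono2') auto
      finally have "c * (1 / (5 * sqrt T)) \<le> \<delta>0"
        unfolding \<delta>0_def using c by (intro mult_left_mono) auto
      then show ?thesis by (simp add: d_def \<delta>_def)
    qed
    define S where "S = {z. Re z > - \<delta>0} \<inter> {z. Im z < R + 1} \<inter> {z. Im z > - (R + 1)}"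
    have S: "open S" "convex S"
      unfolding S_def by (intro open_Int convex_Int open_halfspace_Re_gt open_halfspace_Im_lt open_halfspace_Im_gt
          convex_halfspace_Re_gt convex_halfspace_Im_lt convex_halfspace_Im_gt)+
    have lowS: "m \<le> norm (reg_zeta (1 + z))" if "z \<in> S" "Re z \<le> 0" for z
    proof (rule lower[OF that(2)])
      have "(4 + R) powr (- 5 * (1 / 70)) \<le> (3 + \<bar>Im z\<bar>) powr (- 5 * (1 / 70))"
        using that by (intro powr_mono2') (auto simp: S_def)
      then have "\<delta>0 \<le> c * (3 + \<bar>Im z\<bar>) powr (- 5 * (1 / 70))"
        unfolding \<delta>0_def using c by (intro mult_left_mono) auto
      then show "- c * (3 + \<bar>Im z\<bar>) powr (- 5 * (1 / 70)) \<le> Re z"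
        using that by (simp add: S_def)
    qed
    have nz: "reg_zeta (1 + z) \<noteq> 0" if z: "z \<in> S" for z
    proof (cases "Re z > 0")
      case True
      then have "z \<noteq> 0" by auto
      then show ?thesis
        using reg_zeta_eq_zeta_series[of "1 + z"] zeta_series_nonzero[of "1 + z"] True by simp
    next
      case False
      then show ?thesis using lowS[OF z] m by auto
    qed
    have Sre: "Re z > - 1 / 4" if "z \<in> S" for z
      using that \<delta>0 by (simp add: S_def)
    have hol: "(\<lambda>z. reg_zeta (1 + a * z)) holomorphic_on S" if "a = 1 \<or> a = 2" for a
    proof -
      have "(reg_zeta \<circ> (\<lambda>z. 1 + a * z)) holomorphic_on S"
        by (rule holomorphic_on_compose_gen[OF _ reg_zeta_holomorphic])
          (use that Sre in \<open>force intro!: holomorphic_intros\<close>)+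
      then show ?thesis by (simp add: o_def)
    qed
    have "coeff_a_transform holomorphic_on S"
      unfolding coeff_a_transform_def[abs_def]
      using hol[of 2] hol[of 1] nz by (auto intro!: holomorphic_intros)
    then have g: "difference_quotient coeff_a_transform holomorphic_on S"
      using S by (intro difference_quotient_holomorphic)
    have "norm (difference_quotient coeff_a_transform 0 - difference_quotient (partial_transform T) 0)
      \<le> 30 * (34 * (1 + T)\<^sup>2) / R + 3 * (C1 * R\<^sup>2 / \<delta>) * R * exp (- \<delta> * T) / \<delta> + 3 * (C1 * R\<^sup>2 / \<delta>) / R ^ 3"
    proof (rule newman_contour_estimate[OF R \<delta>(1,2) _ _ S g])
      show "0 \<le> 34 * (1 + T)\<^sup>2" "0 \<le> C1 * R\<^sup>2 / \<delta>" "0 \<le> T" using C1 \<delta> T by auto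
      show "cbox (Complex (- \<delta>) (- R)) (Complex R R) \<subseteq> S"
        using \<delta> R by (auto simp: S_def in_cbox_complex_iff)
      show "difference_quotient (partial_transform T) holomorphic_on UNIV"
        by (intro difference_quotient_holomorphic partial_transform_holomorphic) simp
      show "norm (difference_quotient coeff_a_transform z - difference_quotient (partial_transform T) z)
          \<le> 34 * (1 + T)\<^sup>2 * (1 + 1 / Re z)\<^sup>2 * exp (- T * Re z) / norm z" if "Re z > 0" for z
        using T that by (intro partial_transform_right) auto
      show "norm (difference_quotient (partial_transform T) z) \<le> 34 * (1 + T)\<^sup>2 * exp (- T * Re z) / \<bar>Re z\<bar>" if "Re z < 0" for z
      proof -
        have "norm (difference_quotient (partial_transform T) z) \<le> 3 * (1 + T)\<^sup>2 * exp (- T * Re z) / \<bar>Re z\<bar>"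
          using T that by (intro partial_transform_left) auto
        also have "\<dots> \<le> 34 * (1 + T)\<^sup>2 * exp (- T * Re z) / \<bar>Re z\<bar>"
          by (intro divide_right_mono mult_right_mono) auto
        finally show ?thesis .
      qed
      show "norm (difference_quotient coeff_a_transform z) \<le> C1 * R\<^sup>2 / \<delta>"
        if z: "- \<delta> \<le> Re z" "Re z \<le> 0" "\<bar>Im z\<bar> \<le> R" "Re z = - \<delta> \<or> \<bar>Im z\<bar> = R" for z
      proof -
        have zS: "z \<in> S" using z \<delta> R by (auto simp: S_def)
        \<comment> \<open>On these sides the division by z in the difference quotient costs at most
          1/\<open>\<delta>\<close>, since R >= 1 >= \<open>\<delta>\<close>.\<close>
        have nz: "norm z \<ge> \<delta>"
          using z(4) abs_Re_le_cmod[of z] abs_Im_le_cmod[of z] \<delta> R by auto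
        have "norm (reg_zeta (1 + 2 * z)) \<le> C * (3 + \<bar>Im (1 + 2 * z)\<bar>) powr (1 + 1)"
          using z \<delta> by (intro C(2)) auto
        also have "\<dots> = C * (3 + 2 * \<bar>Im z\<bar>)\<^sup>2"
          by (simp add: abs_mult flip: powr_numeral)
        also have "\<dots> \<le> C * (5 * R)\<^sup>2"
          using C z R by (intro mult_left_mono power_mono) auto
        finally have num: "norm (reg_zeta (1 + 2 * z)) \<le> 25 * C * R\<^sup>2" by (simp add: power_mult_distrib)
        have "norm (coeff_a_transform z) = norm (reg_zeta (1 + 2 * z)) / (2 * norm (reg_zeta (1 + z)))"
          by (simp add: coeff_a_transform_def norm_divide norm_mult)
        also have "\<dots> \<le> 25 * C * R\<^sup>2 / (2 * m)"
          using num lowS[OF zS z(2)] m C by (intro frac_le) auto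
        finally have "norm (coeff_a_transform z) \<le> 25 * C / (2 * m) * R\<^sup>2" by simp
        moreover have "norm (coeff_a_transform z - 1 / 2) \<le> norm (coeff_a_transform z) + 1 / 2"
          using norm_triangle_ineq4[of "coeff_a_transform z" "1 / 2"] by simp
        moreover have "1 / 2 \<le> R\<^sup>2" using one_le_power[OF R, of 2] by linarith
        ultimately have "norm (coeff_a_transform z - 1 / 2) \<le> C1 * R\<^sup>2"
          unfolding C1_def distrib_right by linarith
        then have "norm (coeff_a_transform z - 1 / 2) / norm z \<le> C1 * R\<^sup>2 / \<delta>"
          using C1 nz \<delta> by (intro frac_le) auto
        moreover have "z \<noteq> 0" using nz \<delta> by auto
        ultimately show ?thesis
          by (simp add: difference_quotient_def coeff_a_transform_0 norm_divide)
      qed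
    qed
    also have "30 * (34 * (1 + T)\<^sup>2) / R \<le> 4080 / T ^ 5"
    proof -
      have "(1 + T)\<^sup>2 \<le> (2 * T)\<^sup>2" using T by (intro power_mono) auto
      then have "30 * (34 * (1 + T)\<^sup>2) / R \<le> 30 * (34 * (2 * T)\<^sup>2) / R" using R by (intro divide_right_mono) auto
      also have "\<dots> = 4080 / T ^ 5" using T by (simp add: R_def field_simps eval_nat_numeral)
      finally show ?thesis .
    qed
    also have "3 * (C1 * R\<^sup>2 / \<delta>) * R * exp (- \<delta> * T) / \<delta> \<le> K * T ^ 22 * exp (- d * sqrt T)"
    proof -
      have i: "1 / \<delta> \<le> sqrt T / d" using \<delta>_ge \<delta> d sT by (simp add: field_simps)
      have "(1 / \<delta>)\<^sup>2 \<le> (sqrt T / d)\<^sup>2" using i \<delta> by (intro power_mono) auto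
      also have "\<dots> = T / d\<^sup>2" using sT T by (simp add: power_divide)
      finally have i2: "(1 / \<delta>)\<^sup>2 \<le> T / d\<^sup>2" .
      have "d / sqrt T * T \<le> \<delta> * T" using \<delta>_ge T by (intro mult_right_mono) auto
      moreover have "d / sqrt T * T = d * sqrt T" using sT by (simp add: field_simps)
      ultimately have e: "exp (- \<delta> * T) \<le> exp (- d * sqrt T)" by simp
      have "3 * (C1 * R\<^sup>2 / \<delta>) * R * exp (- \<delta> * T) / \<delta> = 3 * C1 * R ^ 3 * (1 / \<delta>)\<^sup>2 * exp (- \<delta> * T)"
        by (simp add: power2_eq_square power3_eq_cube)
      also have "\<dots> \<le> 3 * C1 * R ^ 3 * (T / d\<^sup>2) * exp (- d * sqrt T)"
        using i2 e C1 R T by (intro mult_mono mult_left_mono) auto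
      also have "\<dots> = 3 * C1 / d\<^sup>2 * T ^ 22 * exp (- d * sqrt T)"
        by (simp add: R_def power_mult[symmetric] eval_nat_numeral)
      also have "\<dots> \<le> K * T ^ 22 * exp (- d * sqrt T)"
        using K(2) T by (intro mult_right_mono) auto
      finally show ?thesis .
    qed
    also have "3 * (C1 * R\<^sup>2 / \<delta>) / R ^ 3 \<le> 3 * C1 / d / T ^ 5"
    proof -
      have i: "1 / \<delta> \<le> sqrt T / d" using \<delta>_ge \<delta> d sT by (simp add: field_simps)
      have "sqrt T * 1 \<le> sqrt T * sqrt T" using sT(1) by (intro mult_left_mono) auto
      also have "\<dots> = T" by (rule sT(2))
      also have "T \<le> T\<^sup>2" using T by (simp add: power2_eq_square)
      finally have "sqrt T \<le> T\<^sup>2" by simp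
      then have "sqrt T / d \<le> T\<^sup>2 / d" using d by (intro divide_right_mono) auto
      with i have i2: "1 / \<delta> \<le> T\<^sup>2 / d" by linarith
      have "3 * (C1 * R\<^sup>2 / \<delta>) / R ^ 3 = 3 * C1 * (1 / \<delta>) / R"
        using R by (simp add: power2_eq_square power3_eq_cube)
      also have "\<dots> \<le> 3 * C1 * (T\<^sup>2 / d) / R"
        using i2 C1 R by (intro divide_right_mono mult_left_mono) auto
      also have "\<dots> = 3 * C1 / d / T ^ 5" using T d by (simp add: R_def field_simps eval_nat_numeral)
      finally show ?thesis .
    qed
    finally have "norm (difference_quotient coeff_a_transform 0 - difference_quotient (partial_transform T) 0)
        \<le> (4080 + 3 * C1 / d) / T ^ 5 + K * T ^ 22 * exp (- d * sqrt T)"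
      by (simp add: add_divide_distrib)
    also have "\<dots> \<le> K / T ^ 5 + K * T ^ 22 * exp (- d * sqrt T)"
      using K(1) T by (intro add_right_mono divide_right_mono) auto
    also have "norm (difference_quotient coeff_a_transform 0 - difference_quotient (partial_transform T) 0)
        = \<bar>T * (coeff_a_sum T - 1 / 2) - coeff_a_log_sum T - euler_mascheroni / 2\<bar>"
      unfolding difference_quotient_coeff_a_transform_0 difference_quotient_partial_transform_0 of_real_diff[symmetric] norm_of_real
      by (rule abs_minus_commute)
    finally show ?thesis .
  qed
  with K d that show ?thesis by blast
qed

text \<open>Q is a primitive of A - 1/2, so its increment over a step h is h (A(T) - 1/2) plus an
  error that involves only the n in (e^T, e^(T + h)], each weighted by at most h. The short-interval
  bound for |a| controls that error.\<close>

lemma coeff_a_sum_difference: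
  assumes T: "T \<ge> 0" and h: "0 < h" "h \<le> 1"
  defines "Q \<equiv> \<lambda>T. T * (coeff_a_sum T - 1 / 2) - coeff_a_log_sum T"
  shows "\<bar>coeff_a_sum T - 1 / 2\<bar> \<le> \<bar>Q (T + h) - Q T\<bar> / h + 6 * (1 + T) * (h + exp (- T / 4))"
proof -
  let ?N = "exp_seg (T + h) - exp_seg T"
  have sub: "exp_seg T \<subseteq> exp_seg (T + h)"
  proof
    fix n assume "n \<in> exp_seg T"
    moreover have "exp T \<le> exp (T + h)" using h by simp
    ultimately show "n \<in> exp_seg (T + h)" unfolding exp_seg_def by (auto intro: order_trans)
  qed
  define r where "r = (\<Sum>n\<in>?N. coeff_a n * (T + h - ln (real n)))"
  have split: "(\<Sum>n\<in>exp_seg (T + h). f n) = (\<Sum>n\<in>exp_seg T. f n) + (\<Sum>n\<in>?N. f n)" for f :: "nat \<Rightarrow> real"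
    using sum.subset_diff[OF sub finite_exp_seg, of f] by simp
  have "r = (T + h) * (\<Sum>n\<in>?N. coeff_a n) - (\<Sum>n\<in>?N. coeff_a n * ln (real n))"
    by (simp add: r_def sum_distrib_left sum_subtractf algebra_simps)
  then have eq: "Q (T + h) - Q T = h * (coeff_a_sum T - 1 / 2) + r"
    unfolding Q_def coeff_a_sum_def coeff_a_log_sum_def split by (simp add: algebra_simps add_divide_distrib)
  have "\<bar>r\<bar> \<le> (\<Sum>n\<in>?N. \<bar>coeff_a n\<bar> * h)"
    unfolding r_def
  proof (rule order_trans[OF sum_abs sum_mono])
    fix n assume "n \<in> ?N"
    then have n: "n > 0" "real n \<le> exp (T + h)" "exp T < real n" by (auto simp: exp_seg_def)
    have "ln (real n) \<le> T + h" using n by (metis ln_exp ln_mono of_nat_0_less_iff)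
    moreover have "T < ln (real n)" using n by (metis ln_exp ln_less_cancel_iff exp_gt_zero of_nat_0_less_iff)
    ultimately show "\<bar>coeff_a n * (T + h - ln (real n))\<bar> \<le> \<bar>coeff_a n\<bar> * h"
      by (simp add: abs_mult mult_left_mono)
  qed
  also have "\<dots> = (\<Sum>n\<in>?N. \<bar>coeff_a n\<bar>) * h" by (simp add: sum_distrib_right)
  also have "\<dots> \<le> 6 * (1 + T) * (h + exp (- T / 4)) * h"
    using T h by (intro mult_right_mono sum_abs_coeff_a_short) auto
  finally have r: "\<bar>r\<bar> \<le> 6 * (1 + T) * (h + exp (- T / 4)) * h" .
  have "h * \<bar>coeff_a_sum T - 1 / 2\<bar> = \<bar>(Q (T + h) - Q T) - r\<bar>"
    using h unfolding eq by (simp add: abs_mult)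
  also have "\<dots> \<le> \<bar>Q (T + h) - Q T\<bar> + 6 * (1 + T) * (h + exp (- T / 4)) * h" using r by linarith
  also have "\<dots> = h * (\<bar>Q (T + h) - Q T\<bar> / h + 6 * (1 + T) * (h + exp (- T / 4)))"
    using h by (simp add: algebra_simps)
  finally show ?thesis using h by simp
qed

lemma coeff_a_log_sum_tendsto: "(coeff_a_log_sum \<longlongrightarrow> - euler_mascheroni / 2) at_top"
proof -
  define Q where "Q = (\<lambda>T. T * (coeff_a_sum T - 1 / 2) - coeff_a_log_sum T)"
  obtain K d where K: "K > 0" "d > 0"
    and Q1: "\<And>T. T \<ge> 1 \<Longrightarrow> \<bar>Q T - euler_mascheroni / 2\<bar> \<le> K / T ^ 5 + K * T ^ 22 * exp (- d * sqrt T)"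
    using partial_transform_remainder unfolding Q_def by blast
  \<comment> \<open>27 = 22 + 5: the exponential term is to be dominated by T^-5.\<close>
  have "((\<lambda>T::real. T ^ 27 * exp (- d * sqrt T)) \<longlongrightarrow> 0) at_top"
    using K(2) by real_asymp
  then have "\<forall>\<^sub>F T in at_top. T ^ 27 * exp (- d * sqrt T) < 1"
    by (rule order_tendstoD) simp
  then obtain T0 where T0: "\<And>T. T \<ge> T0 \<Longrightarrow> T ^ 27 * exp (- d * sqrt T) < 1"
    by (auto simp: eventually_at_top_linorder)
  have Q2: "\<bar>Q T - euler_mascheroni / 2\<bar> \<le> 2 * K / T ^ 5" if T: "T \<ge> max 1 T0" for T
  proof -
    have "T ^ 22 * exp (- d * sqrt T) * T ^ 5 = T ^ 27 * exp (- d * sqrt T)"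
      by (simp add: algebra_simps flip: power_add)
    also have "\<dots> \<le> 1" using T0[of T] T by simp
    finally have "T ^ 22 * exp (- d * sqrt T) \<le> 1 / T ^ 5"
      using T by (simp add: field_simps)
    then have "K * (T ^ 22 * exp (- d * sqrt T)) \<le> K * (1 / T ^ 5)"
      using K by (intro mult_left_mono) auto
    then show ?thesis using Q1[of T] T by simp
  qed
  \<comment> \<open>With step T^-3 both the difference quotient and the short-interval error are
    O(T^-2), which leaves O(1/T) after multiplication by T.\<close>
  have bound: "\<bar>T * (coeff_a_sum T - 1 / 2)\<bar> \<le> T * (4 * K / T ^ 5 * T ^ 3 + 6 * (1 + T) * (1 / T ^ 3 + exp (- T / 4)))"
    if T: "T \<ge> max 1 T0" for T
  proof -
    define h where "h = 1 / T ^ 3"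
    have h: "0 < h" "h \<le> 1" using T by (auto simp: h_def)
    have "(T :: real) ^ 5 \<le> (T + h) ^ 5" using T h by (intro power_mono) auto
    then have "2 * K / (T + h) ^ 5 \<le> 2 * K / T ^ 5"
      using K T h by (intro divide_left_mono) auto
    then have "\<bar>Q (T + h) - Q T\<bar> \<le> 4 * K / T ^ 5"
      using Q2[of T] Q2[of "T + h"] T h by simp
    then have "\<bar>Q (T + h) - Q T\<bar> / h \<le> 4 * K / T ^ 5 / h"
      using h by (intro divide_right_mono) auto
    moreover have "\<bar>coeff_a_sum T - 1 / 2\<bar> \<le> \<bar>Q (T + h) - Q T\<bar> / h + 6 * (1 + T) * (h + exp (- T / 4))"
      unfolding Q_def using T h by (intro coeff_a_sum_difference) auto
    ultimately have "\<bar>coeff_a_sum T - 1 / 2\<bar> \<le> 4 * K / T ^ 5 * T ^ 3 + 6 * (1 + T) * (1 / T ^ 3 + exp (- T / 4))"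
      by (simp add: h_def)
    then show ?thesis using T by (simp add: abs_mult mult_left_mono)
  qed
  have "((\<lambda>T::real. T * (4 * K / T ^ 5 * T ^ 3 + 6 * (1 + T) * (1 / T ^ 3 + exp (- T / 4)))) \<longlongrightarrow> 0) at_top"
    by real_asymp
  then have l1: "((\<lambda>T. T * (coeff_a_sum T - 1 / 2)) \<longlongrightarrow> 0) at_top"
    by (rule Lim_null_comparison[rotated])
      (use bound in \<open>auto simp: eventually_at_top_linorder simp del: max.bounded_iff intro!: exI[of _ "max 1 T0"]\<close>)
  have "((\<lambda>T::real. 2 * K / T ^ 5) \<longlongrightarrow> 0) at_top"
    by real_asymp
  then have "((\<lambda>T. Q T - euler_mascheroni / 2) \<longlongrightarrow> 0) at_top"
    by (rule Lim_null_comparison[rotated])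
      (use Q2 in \<open>auto simp: eventually_at_top_linorder simp del: max.bounded_iff intro!: exI[of _ "max 1 T0"]\<close>)
  then have "((\<lambda>T. T * (coeff_a_sum T - 1 / 2) - (Q T - euler_mascheroni / 2) - euler_mascheroni / 2) \<longlongrightarrow> 0 - 0 - euler_mascheroni / 2) at_top"
    by (intro tendsto_intros l1)
  then show ?thesis by (simp add: Q_def)
qed

theorem theorem4p3:
  shows "(\<lambda>n. real_of_int (coeff_c (Suc n)) * ln (real (Suc n)) / real (Suc n)) sums (- (euler_mascheroni :: real) / 2)"
proof -
  have "(\<lambda>N. coeff_a_log_sum (ln (real N))) \<longlonglongrightarrow> - euler_mascheroni / 2"
    by (rule filterlim_compose[OF coeff_a_log_sum_tendsto
          filterlim_compose[OF ln_at_top filterlim_real_sequentially]])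
  moreover have "coeff_a_log_sum (ln (real N)) = (\<Sum>n<N. real_of_int (coeff_c (Suc n)) * ln (real (Suc n)) / real (Suc n))"
    if "N > 0" for N
  proof -
    \<comment> \<open>Sampling at T = ln N gives the integers 1 to N, which the shift by
      \<open>Suc\<close> matches with the first N terms of the series.\<close>
    have "exp_seg (ln (real N)) = Suc ` {..<N}"
      using that by (auto simp: exp_seg_def image_iff gr0_conv_Suc Suc_le_eq)
    then show ?thesis
      by (simp add: coeff_a_log_sum_def sum.reindex coeff_a_def)
  qed
  then have "\<forall>\<^sub>F N in sequentially. coeff_a_log_sum (ln (real N)) =
      (\<Sum>n<N. real_of_int (coeff_c (Suc n)) * ln (real (Suc n)) / real (Suc n))"
    using eventually_gt_at_top[of 0] by (rule eventually_mono[rotated]) simp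
  ultimately show ?thesis
    unfolding sums_def by (rule Lim_transform_eventually)
qed

end
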